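(* Let $A \# H$ and $A' \#' H'$ be two semi-direct products of Hopf algebras associated to two left actions $\triangleright : H \otimes A \to A$ and $\triangleright' : H' \otimes A' \to A'$. Then there exists a bijection between the set of all morphisms of Hopf algebras $\psi : A \# H \to A' \#' H'$ and the set of all quadruples $(u, p, r, v)$, where $u: A \to A'$, $r: H \to A'$ are unitary coalgebra maps, $p: A \to H'$, $v: H \to H'$ are morphisms of Hopf algebras satisfying, for all $a, b \in A$, $g, h \in H$: \begin{align*} u(a_{(1)}) \otimes p(a_{(2)}) &= u(a_{(2)}) \otimes p(a_{(1)})\\ r(h_{(1)}) \otimes v(h_{(2)}) &= r(h_{(2)}) \otimes v(h_{(1)})\\ u(ab) &= u(a_{(1)}) \, \bigl( p (a_{(2)}) \triangleright' u(b) \bigr)\\ r(hg) &= r(h_{(1)}) \, \bigl(v(h_{(2)}) \triangleright' r(g)\bigr)\\ r(h_{(1)}) \bigl(v(h_{(2)}) \triangleright' u(b) \bigr) &= u (h_{(1)} \triangleright b_{(1)}) \, \Bigl( p (h_{(2)} \triangleright b_{(2)}) \triangleright' r(h_{(3)}) \Bigr)\\ v(h) \, p(b) &= p (h_{(1)} \triangleright b ) \, v (h_{(2)}). \end{align*} Under this bijection the morphism of Hopf algebras $\psi$ corresponding to $(u, p, r, v)$ is given, for all $a \in A$, $h \in H$, by $$\psi(a \# h) = u(a_{(1)}) \, \bigl( p(a_{(2)}) \triangleright' r(h_{(1)}) \bigr) \; \#' \; p(a_{(3)}) \, v(h_{(2)}).$$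
   Context: $k$ is a field; all algebras, coalgebras, Hopf algebras, tensor products and homomorphisms are over $k$. Sweedler notation $\Delta(c) = c_{(1)} \otimes c_{(2)}$ is used. A map $f$ between Hopf algebras is called unitary if $f(1) = 1$. Semi-direct (smash) product: let $A$, $H$ be Hopf algebras and $\triangleright : H \otimes A \to A$ a left action such that $(A, \triangleright)$ is both a left $H$-module coalgebra (i.e. $\triangleright$ is a module action that is a coalgebra map) and a left $H$-module algebra, and $g_{(1)} \otimes g_{(2)} \triangleright a = g_{(2)} \otimes g_{(1)} \triangleright a$ for all $g \in H$, $a \in A$. Then $A \# H$ is the vector space $A \otimes H$ (with $a \# h := a \otimes h$), with unit $1_A \# 1_H$, multiplication $(a \# h)(c \# g) = a (h_{(1)} \triangleright c) \# h_{(2)} g$ and the tensor product coalgebra structure; it is a Hopf algebra. $A' \#' H'$ is defined in the same way from $\triangleright'$. *)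

theory Defs
  imports "HOL-Algebra.Module" "HOL-Algebra.AbelCoset" "HOL-Library.FuncSet"
begin

section \<open>Linear and bilinear maps\<close>

text \<open>
  Throughout, \<open>K\<close> is the ground field and a vector space over \<open>K\<close> is a \<open>module K M\<close>. The record
  \<open>module\<close> also carries \<open>mult\<close> and \<open>one\<close>; these are meaningful only where \<open>M\<close> is used as an
  algebra.
\<close>

definition lin_map ::
    "('k, 'm) ring_scheme \<Rightarrow> ('k, 'a, 'n) module_scheme \<Rightarrow> ('k, 'b, 'o) module_scheme
      \<Rightarrow> ('a \<Rightarrow> 'b) \<Rightarrow> bool" where
  "lin_map K M N f \<longleftrightarrow>
     f \<in> carrier M \<rightarrow> carrier N \<and>
     (\<forall>x\<in>carrier M. \<forall>y\<in>carrier M. f (x \<oplus>\<^bsub>M\<^esub> y) = f x \<oplus>\<^bsub>N\<^esub> f y) \<and>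
     (\<forall>c\<in>carrier K. \<forall>x\<in>carrier M. f (c \<odot>\<^bsub>M\<^esub> x) = c \<odot>\<^bsub>N\<^esub> f x)"

definition bilin_map ::
    "('k, 'm) ring_scheme \<Rightarrow> ('k, 'a, 'n) module_scheme \<Rightarrow> ('k, 'b, 'o) module_scheme
      \<Rightarrow> ('k, 'c, 'q) module_scheme \<Rightarrow> ('a \<Rightarrow> 'b \<Rightarrow> 'c) \<Rightarrow> bool" where
  "bilin_map K M N V F \<longleftrightarrow>
     (\<forall>y\<in>carrier N. lin_map K M V (\<lambda>x. F x y)) \<and> (\<forall>x\<in>carrier M. lin_map K N V (F x))"

definition ground :: "('k, 'm) ring_scheme \<Rightarrow> ('k, 'k) module" where
  "ground K = \<lparr>carrier = carrier K, mult = mult K, one = one K, zero = zero K, add = add K,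
     smult = mult K\<rparr>"


section \<open>Tensor products\<close>

text \<open>
  \<open>M \<otimes> N\<close> is the quotient of the free vector space on \<open>carrier M \<times> carrier N\<close> by the subspace
  spanned by the bilinearity relations; its elements are cosets of finitely supported functions.
\<close>

type_synonym ('k, 'a, 'b) tensor = "('a \<times> 'b \<Rightarrow> 'k) set"

definition free_mod :: "('k, 'm) ring_scheme \<Rightarrow> 'x set \<Rightarrow> ('k, 'x \<Rightarrow> 'k) module" where
  "free_mod K X =
     \<lparr>carrier = {f. (\<forall>x. f x \<in> carrier K) \<and> finite {x. f x \<noteq> \<zero>\<^bsub>K\<^esub>} \<and> {x. f x \<noteq> \<zero>\<^bsub>K\<^esub>} \<subseteq> X},
      mult = undefined, one = undefined, zero = (\<lambda>_. \<zero>\<^bsub>K\<^esub>),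
      add = (\<lambda>f g x. f x \<oplus>\<^bsub>K\<^esub> g x), smult = (\<lambda>c f x. c \<otimes>\<^bsub>K\<^esub> f x)\<rparr>"

definition free_gen :: "('k, 'm) ring_scheme \<Rightarrow> 'x \<Rightarrow> 'x \<Rightarrow> 'k" where
  "free_gen K x = (\<lambda>y. if y = x then \<one>\<^bsub>K\<^esub> else \<zero>\<^bsub>K\<^esub>)"

definition span_mod :: "('k, 'm) ring_scheme \<Rightarrow> ('k, 'a, 'n) module_scheme \<Rightarrow> 'a set \<Rightarrow> 'a set" where
  "span_mod K M S = \<Inter>{N. submodule N K M \<and> S \<subseteq> N}"

definition quot_mod :: "('k, 'a, 'n) module_scheme \<Rightarrow> 'a set \<Rightarrow> ('k, 'a set) module" where
  "quot_mod M N =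
     \<lparr>carrier = a_rcosets\<^bsub>M\<^esub> N, mult = undefined, one = undefined, zero = N,
      add = (\<lambda>X Y. X <+>\<^bsub>M\<^esub> Y), smult = (\<lambda>c X. \<Union>x\<in>X. N +>\<^bsub>M\<^esub> (c \<odot>\<^bsub>M\<^esub> x))\<rparr>"

definition tensor_free ::
    "('k, 'm) ring_scheme \<Rightarrow> ('k, 'a, 'n) module_scheme \<Rightarrow> ('k, 'b, 'o) module_scheme
      \<Rightarrow> ('k, 'a \<times> 'b \<Rightarrow> 'k) module" where
  "tensor_free K M N = free_mod K (carrier M \<times> carrier N)"

definition tensor_rels ::
    "('k, 'm) ring_scheme \<Rightarrow> ('k, 'a, 'n) module_scheme \<Rightarrow> ('k, 'b, 'o) module_scheme
      \<Rightarrow> ('a \<times> 'b \<Rightarrow> 'k) set" where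
  "tensor_rels K M N = (let F = tensor_free K M N; e = (\<lambda>a b. free_gen K (a, b)) in
     {e (a \<oplus>\<^bsub>M\<^esub> a') b \<ominus>\<^bsub>F\<^esub> (e a b \<oplus>\<^bsub>F\<^esub> e a' b) |a a' b.
        a \<in> carrier M \<and> a' \<in> carrier M \<and> b \<in> carrier N} \<union>
     {e a (b \<oplus>\<^bsub>N\<^esub> b') \<ominus>\<^bsub>F\<^esub> (e a b \<oplus>\<^bsub>F\<^esub> e a b') |a b b'.
        a \<in> carrier M \<and> b \<in> carrier N \<and> b' \<in> carrier N} \<union>
     {e (c \<odot>\<^bsub>M\<^esub> a) b \<ominus>\<^bsub>F\<^esub> (c \<odot>\<^bsub>F\<^esub> e a b) |c a b.
        c \<in> carrier K \<and> a \<in> carrier M \<and> b \<in> carrier N} \<union>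
     {e a (c \<odot>\<^bsub>N\<^esub> b) \<ominus>\<^bsub>F\<^esub> (c \<odot>\<^bsub>F\<^esub> e a b) |c a b.
        c \<in> carrier K \<and> a \<in> carrier M \<and> b \<in> carrier N})"

definition tensor_null ::
    "('k, 'm) ring_scheme \<Rightarrow> ('k, 'a, 'n) module_scheme \<Rightarrow> ('k, 'b, 'o) module_scheme
      \<Rightarrow> ('a \<times> 'b \<Rightarrow> 'k) set" where
  "tensor_null K M N = span_mod K (tensor_free K M N) (tensor_rels K M N)"

definition tensor_mod ::
    "('k, 'm) ring_scheme \<Rightarrow> ('k, 'a, 'n) module_scheme \<Rightarrow> ('k, 'b, 'o) module_scheme
      \<Rightarrow> ('k, ('k, 'a, 'b) tensor) module" where
  "tensor_mod K M N = quot_mod (tensor_free K M N) (tensor_null K M N)"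

definition tens ::
    "('k, 'm) ring_scheme \<Rightarrow> ('k, 'a, 'n) module_scheme \<Rightarrow> ('k, 'b, 'o) module_scheme
      \<Rightarrow> 'a \<Rightarrow> 'b \<Rightarrow> ('k, 'a, 'b) tensor" where
  "tens K M N a b = tensor_null K M N +>\<^bsub>tensor_free K M N\<^esub> free_gen K (a, b)"

text \<open>
  For \<open>F\<close> bilinear into \<open>V\<close>, \<open>tlift K V F\<close> is the linear map with \<open>a \<otimes> b \<mapsto> F a b\<close>: take any formal
  linear combination of pairs representing \<open>t\<close> and evaluate it. The value does not depend on the
  chosen representative when \<open>F\<close> is bilinear, and it is only used for such \<open>F\<close>.
\<close>

definition tlift ::
    "('k, 'm) ring_scheme \<Rightarrow> ('k, 'v, 'n) module_scheme \<Rightarrow> ('a \<Rightarrow> 'b \<Rightarrow> 'v)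
      \<Rightarrow> ('k, 'a, 'b) tensor \<Rightarrow> 'v" where
  "tlift K V F t = (let z = (SOME z. z \<in> t) in
     (\<Oplus>\<^bsub>V\<^esub>x\<in>{x. z x \<noteq> \<zero>\<^bsub>K\<^esub>}. z x \<odot>\<^bsub>V\<^esub> F (fst x) (snd x)))"

text \<open>\<open>tmap K M N f g\<close> is \<open>f \<otimes> g\<close>, where \<open>M\<close> and \<open>N\<close> are the codomains of \<open>f\<close> and \<open>g\<close>.\<close>

definition tmap ::
    "('k, 'm) ring_scheme \<Rightarrow> ('k, 'c, 'n) module_scheme \<Rightarrow> ('k, 'd, 'o) module_scheme
      \<Rightarrow> ('a \<Rightarrow> 'c) \<Rightarrow> ('b \<Rightarrow> 'd) \<Rightarrow> ('k, 'a, 'b) tensor \<Rightarrow> ('k, 'c, 'd) tensor" where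
  "tmap K M N f g = tlift K (tensor_mod K M N) (\<lambda>a b. tens K M N (f a) (g b))"

text \<open>The canonical isomorphism from \<open>(L \<otimes> M) \<otimes> N\<close> to \<open>L \<otimes> (M \<otimes> N)\<close>.\<close>

definition tassoc ::
    "('k, 'm) ring_scheme \<Rightarrow> ('k, 'a, 'n) module_scheme \<Rightarrow> ('k, 'b, 'o) module_scheme
      \<Rightarrow> ('k, 'c, 'q) module_scheme
      \<Rightarrow> ('k, ('k, 'a, 'b) tensor, 'c) tensor \<Rightarrow> ('k, 'a, ('k, 'b, 'c) tensor) tensor" where
  "tassoc K L M N = (let MN = tensor_mod K M N; V = tensor_mod K L MN in
     tlift K V (\<lambda>s c. tlift K V (\<lambda>a b. tens K L MN a (tens K M N b c)) s))"

text \<open>For algebras \<open>M\<close> and \<open>N\<close>: \<open>(a \<otimes> b) (c \<otimes> d) = a c \<otimes> b d\<close>.\<close>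

definition tensor_alg ::
    "('k, 'm) ring_scheme \<Rightarrow> ('k, 'a, 'n) module_scheme \<Rightarrow> ('k, 'b, 'o) module_scheme
      \<Rightarrow> ('k, ('k, 'a, 'b) tensor) module" where
  "tensor_alg K M N = (let T = tensor_mod K M N in
     T\<lparr>mult := (\<lambda>s t. tlift K T (\<lambda>a b. tlift K T (\<lambda>c d.
                 tens K M N (a \<otimes>\<^bsub>M\<^esub> c) (b \<otimes>\<^bsub>N\<^esub> d)) t) s),
       one := tens K M N \<one>\<^bsub>M\<^esub> \<one>\<^bsub>N\<^esub>\<rparr>)"


section \<open>Algebras, coalgebras and Hopf algebras\<close>

text \<open>The locale \<open>algebra\<close> of \<open>HOL-Algebra\<close> is about commutative algebras.\<close>

locale assoc_algebra = module K A + ring A for K (structure) and A (structure) +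
  assumes smult_mult_left:
      "\<lbrakk>c \<in> carrier K; x \<in> carrier A; y \<in> carrier A\<rbrakk>
        \<Longrightarrow> (c \<odot>\<^bsub>A\<^esub> x) \<otimes>\<^bsub>A\<^esub> y = c \<odot>\<^bsub>A\<^esub> (x \<otimes>\<^bsub>A\<^esub> y)"
    and smult_mult_right:
      "\<lbrakk>c \<in> carrier K; x \<in> carrier A; y \<in> carrier A\<rbrakk>
        \<Longrightarrow> x \<otimes>\<^bsub>A\<^esub> (c \<odot>\<^bsub>A\<^esub> y) = c \<odot>\<^bsub>A\<^esub> (x \<otimes>\<^bsub>A\<^esub> y)"

definition alg_hom ::
    "('k, 'm) ring_scheme \<Rightarrow> ('k, 'a, 'n) module_scheme \<Rightarrow> ('k, 'b, 'o) module_scheme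
      \<Rightarrow> ('a \<Rightarrow> 'b) \<Rightarrow> bool" where
  "alg_hom K A B f \<longleftrightarrow>
     lin_map K A B f \<and>
     (\<forall>x\<in>carrier A. \<forall>y\<in>carrier A. f (x \<otimes>\<^bsub>A\<^esub> y) = f x \<otimes>\<^bsub>B\<^esub> f y) \<and> f \<one>\<^bsub>A\<^esub> = \<one>\<^bsub>B\<^esub>"

text \<open>One record serves for coalgebras, bialgebras and Hopf algebras.\<close>

record ('k, 'a) bialg = "('k, 'a) module" +
  comult :: "'a \<Rightarrow> ('k, 'a, 'a) tensor"
  counit :: "'a \<Rightarrow> 'k"

text \<open>
  \<open>sweedler K V C c F\<close> is \<open>F c\<^sub>1 c\<^sub>2\<close> in Sweedler notation, for \<open>F\<close> bilinear into \<open>V\<close>. Longer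
  Sweedler expressions arise by applying it again to the second factor.
\<close>

definition sweedler ::
    "('k, 'm) ring_scheme \<Rightarrow> ('k, 'v, 'n) module_scheme \<Rightarrow> ('k, 'c, 'o) bialg_scheme
      \<Rightarrow> 'c \<Rightarrow> ('c \<Rightarrow> 'c \<Rightarrow> 'v) \<Rightarrow> 'v" where
  "sweedler K V C c F = tlift K V F (comult C c)"

locale coalgebra = module K C for K (structure) and C :: "('k, 'c, 'o) bialg_scheme" (structure) +
  assumes comult_lin: "lin_map K C (tensor_mod K C C) (comult C)"
    and counit_lin: "lin_map K C (ground K) (counit C)"
    and coassoc: "c \<in> carrier C \<Longrightarrow>
      tassoc K C C C (tmap K (tensor_mod K C C) C (comult C) id (comult C c)) =
      tmap K C (tensor_mod K C C) id (comult C) (comult C c)"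
    and counit_left: "c \<in> carrier C \<Longrightarrow> sweedler K C C c (\<lambda>x y. counit C x \<odot>\<^bsub>C\<^esub> y) = c"
    and counit_right: "c \<in> carrier C \<Longrightarrow> sweedler K C C c (\<lambda>x y. counit C y \<odot>\<^bsub>C\<^esub> x) = c"

locale bialgebra = assoc_algebra K A + coalgebra K A
    for K (structure) and A :: "('k, 'c, 'o) bialg_scheme" (structure) +
  assumes comult_alg_hom: "alg_hom K A (tensor_alg K A A) (comult A)"
    and counit_alg_hom: "alg_hom K A (ground K) (counit A)"

locale hopf_algebra = bialgebra +
  assumes antipode_exists: "\<exists>S. lin_map K A A S \<and> (\<forall>x\<in>carrier A.
      sweedler K A A x (\<lambda>y z. S y \<otimes>\<^bsub>A\<^esub> z) = counit A x \<odot>\<^bsub>A\<^esub> \<one>\<^bsub>A\<^esub> \<and>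
      sweedler K A A x (\<lambda>y z. y \<otimes>\<^bsub>A\<^esub> S z) = counit A x \<odot>\<^bsub>A\<^esub> \<one>\<^bsub>A\<^esub>)"

definition coalg_hom ::
    "('k, 'm) ring_scheme \<Rightarrow> ('k, 'a, 'n) bialg_scheme \<Rightarrow> ('k, 'b, 'o) bialg_scheme
      \<Rightarrow> ('a \<Rightarrow> 'b) \<Rightarrow> bool" where
  "coalg_hom K C D f \<longleftrightarrow>
     lin_map K C D f \<and>
     (\<forall>c\<in>carrier C. comult D (f c) = tmap K D D f f (comult C c)) \<and>
     (\<forall>c\<in>carrier C. counit D (f c) = counit C c)"

text \<open>Compatibility with the antipodes is automatic for a map of algebras and coalgebras.\<close>

definition hopf_hom ::
    "('k, 'm) ring_scheme \<Rightarrow> ('k, 'a, 'n) bialg_scheme \<Rightarrow> ('k, 'b, 'o) bialg_scheme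
      \<Rightarrow> ('a \<Rightarrow> 'b) \<Rightarrow> bool" where
  "hopf_hom K A B f \<longleftrightarrow> alg_hom K A B f \<and> coalg_hom K A B f"

definition unitary_coalg_hom ::
    "('k, 'm) ring_scheme \<Rightarrow> ('k, 'a, 'n) bialg_scheme \<Rightarrow> ('k, 'b, 'o) bialg_scheme
      \<Rightarrow> ('a \<Rightarrow> 'b) \<Rightarrow> bool" where
  "unitary_coalg_hom K C D f \<longleftrightarrow> coalg_hom K C D f \<and> f \<one>\<^bsub>C\<^esub> = \<one>\<^bsub>D\<^esub>"

text \<open>Maps are taken to be \<open>undefined\<close> off the carrier, so that they form honest sets of maps.\<close>

definition hopf_Hom ::
    "('k, 'm) ring_scheme \<Rightarrow> ('k, 'a, 'n) bialg_scheme \<Rightarrow> ('k, 'b, 'o) bialg_scheme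
      \<Rightarrow> ('a \<Rightarrow> 'b) set" where
  "hopf_Hom K A B = {f \<in> extensional (carrier A). hopf_hom K A B f}"

definition unitary_coalg_Hom ::
    "('k, 'm) ring_scheme \<Rightarrow> ('k, 'a, 'n) bialg_scheme \<Rightarrow> ('k, 'b, 'o) bialg_scheme
      \<Rightarrow> ('a \<Rightarrow> 'b) set" where
  "unitary_coalg_Hom K C D = {f \<in> extensional (carrier C). unitary_coalg_hom K C D f}"

definition tensor_coalg ::
    "('k, 'm) ring_scheme \<Rightarrow> ('k, 'a, 'n) bialg_scheme \<Rightarrow> ('k, 'b, 'o) bialg_scheme
      \<Rightarrow> ('k, ('k, 'a, 'b) tensor) bialg" where
  "tensor_coalg K C D = (let T = tensor_mod K C D; TT = tensor_mod K T T in
     module.extend T (bialg.fields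
       (tlift K TT (\<lambda>c d. sweedler K TT C c (\<lambda>c1 c2. sweedler K TT D d (\<lambda>d1 d2.
          tens K T T (tens K C D c1 d1) (tens K C D c2 d2)))))
       (tlift K (ground K) (\<lambda>c d. counit C c \<otimes>\<^bsub>K\<^esub> counit D d))))"


section \<open>Semi-direct products\<close>

text \<open>The action \<open>H \<otimes> A \<rightarrow> A\<close> is given by its curried bilinear map.\<close>

locale semidirect_action =
  H: hopf_algebra K H + A: hopf_algebra K A
  for K (structure) and H :: "('k, 'h, 'n) bialg_scheme" and A :: "('k, 'a, 'o) bialg_scheme" +
  fixes act :: "'h \<Rightarrow> 'a \<Rightarrow> 'a"  (infixr \<open>\<rhd>\<close> 75)
  assumes act_bilin: "bilin_map K H A A act"
    and act_one: "a \<in> carrier A \<Longrightarrow> \<one>\<^bsub>H\<^esub> \<rhd> a = a"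
    and act_mult: "\<lbrakk>g \<in> carrier H; h \<in> carrier H; a \<in> carrier A\<rbrakk>
      \<Longrightarrow> (g \<otimes>\<^bsub>H\<^esub> h) \<rhd> a = g \<rhd> (h \<rhd> a)"
    and act_coalg_hom: "coalg_hom K (tensor_coalg K H A) A (tlift K A act)"
    and act_on_mult: "\<lbrakk>h \<in> carrier H; a \<in> carrier A; b \<in> carrier A\<rbrakk>
      \<Longrightarrow> h \<rhd> (a \<otimes>\<^bsub>A\<^esub> b) = sweedler K A H h (\<lambda>h1 h2. (h1 \<rhd> a) \<otimes>\<^bsub>A\<^esub> (h2 \<rhd> b))"
    and act_on_one: "h \<in> carrier H \<Longrightarrow> h \<rhd> \<one>\<^bsub>A\<^esub> = counit H h \<odot>\<^bsub>A\<^esub> \<one>\<^bsub>A\<^esub>"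
    and act_cocomm: "\<lbrakk>g \<in> carrier H; a \<in> carrier A\<rbrakk> \<Longrightarrow>
      sweedler K (tensor_mod K H A) H g (\<lambda>g1 g2. tens K H A g1 (g2 \<rhd> a)) =
      sweedler K (tensor_mod K H A) H g (\<lambda>g1 g2. tens K H A g2 (g1 \<rhd> a))"

text \<open>\<open>(a # h) (c # g) = a (h\<^sub>1 \<rhd> c) # h\<^sub>2 g\<close> on the tensor product coalgebra \<open>A \<otimes> H\<close>; \<open>a # h\<close> is
  \<open>tens K A H a h\<close>.\<close>

definition smash ::
    "('k, 'm) ring_scheme \<Rightarrow> ('k, 'a, 'n) bialg_scheme \<Rightarrow> ('k, 'h, 'o) bialg_scheme
      \<Rightarrow> ('h \<Rightarrow> 'a \<Rightarrow> 'a) \<Rightarrow> ('k, ('k, 'a, 'h) tensor) bialg" where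
  "smash K A H act = (let T = tensor_mod K A H in
     (tensor_coalg K A H)
       \<lparr>mult := (\<lambda>s t. tlift K T (\<lambda>a h. tlift K T (\<lambda>c g.
           sweedler K T H h (\<lambda>h1 h2. tens K A H (a \<otimes>\<^bsub>A\<^esub> act h1 c) (h2 \<otimes>\<^bsub>H\<^esub> g))) t) s),
        one := tens K A H \<one>\<^bsub>A\<^esub> \<one>\<^bsub>H\<^esub>\<rparr>)"

definition smash_quadruples ::
    "('k, 'm) ring_scheme
      \<Rightarrow> ('k, 'a, 'n) bialg_scheme \<Rightarrow> ('k, 'h, 'o) bialg_scheme \<Rightarrow> ('h \<Rightarrow> 'a \<Rightarrow> 'a)
      \<Rightarrow> ('k, 'c, 'q) bialg_scheme \<Rightarrow> ('k, 'd, 'r) bialg_scheme \<Rightarrow> ('d \<Rightarrow> 'c \<Rightarrow> 'c)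
      \<Rightarrow> (('a \<Rightarrow> 'c) \<times> ('a \<Rightarrow> 'd) \<times> ('h \<Rightarrow> 'c) \<times> ('h \<Rightarrow> 'd)) set" where
  "smash_quadruples K A H act A' H' act' = {(u, p, r, v).
     u \<in> unitary_coalg_Hom K A A' \<and> p \<in> hopf_Hom K A H' \<and>
     r \<in> unitary_coalg_Hom K H A' \<and> v \<in> hopf_Hom K H H' \<and>
     (\<forall>a\<in>carrier A.
        sweedler K (tensor_mod K A' H') A a (\<lambda>a1 a2. tens K A' H' (u a1) (p a2)) =
        sweedler K (tensor_mod K A' H') A a (\<lambda>a1 a2. tens K A' H' (u a2) (p a1))) \<and>
     (\<forall>h\<in>carrier H.
        sweedler K (tensor_mod K A' H') H h (\<lambda>h1 h2. tens K A' H' (r h1) (v h2)) =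
        sweedler K (tensor_mod K A' H') H h (\<lambda>h1 h2. tens K A' H' (r h2) (v h1))) \<and>
     (\<forall>a\<in>carrier A. \<forall>b\<in>carrier A.
        u (a \<otimes>\<^bsub>A\<^esub> b) = sweedler K A' A a (\<lambda>a1 a2. u a1 \<otimes>\<^bsub>A'\<^esub> act' (p a2) (u b))) \<and>
     (\<forall>h\<in>carrier H. \<forall>g\<in>carrier H.
        r (h \<otimes>\<^bsub>H\<^esub> g) = sweedler K A' H h (\<lambda>h1 h2. r h1 \<otimes>\<^bsub>A'\<^esub> act' (v h2) (r g))) \<and>
     (\<forall>h\<in>carrier H. \<forall>b\<in>carrier A.
        sweedler K A' H h (\<lambda>h1 h2. r h1 \<otimes>\<^bsub>A'\<^esub> act' (v h2) (u b)) =
        sweedler K A' H h (\<lambda>h1 h'. sweedler K A' H h' (\<lambda>h2 h3.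
          sweedler K A' A b (\<lambda>b1 b2. u (act h1 b1) \<otimes>\<^bsub>A'\<^esub> act' (p (act h2 b2)) (r h3))))) \<and>
     (\<forall>h\<in>carrier H. \<forall>b\<in>carrier A.
        v h \<otimes>\<^bsub>H'\<^esub> p b = sweedler K H' H h (\<lambda>h1 h2. p (act h1 b) \<otimes>\<^bsub>H'\<^esub> v h2))}"

end

theory Submission
  imports Defs
begin

text \<open>
  Three facts about maps carry the proof.

  A coalgebra map into \<open>A' \<otimes> H'\<close> is the same thing as a pair of coalgebra maps \<open>f\<close>, \<open>g\<close> into \<open>A'\<close>
  and \<open>H'\<close> with \<open>f(e\<^sub>1) \<otimes> g(e\<^sub>2) = f(e\<^sub>2) \<otimes> g(e\<^sub>1)\<close>: the map is \<open>e \<mapsto> f(e\<^sub>1) \<otimes> g(e\<^sub>2)\<close>, and \<open>f\<close>, \<open>g\<close> are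
  recovered by applying the counit of one factor (\<open>coalg_hom_conv_pair\<close>, \<open>conv_pair_coalg_hom\<close>). In
  particular two coalgebra maps into \<open>A' \<otimes> H'\<close> agree as soon as their components agree
  (\<open>coalg_hom_eqI\<close>).

  Let \<open>E\<close> be a bialgebra and \<open>\<phi> = (f, g)\<close> a coalgebra map \<open>E \<rightarrow> A' #' H'\<close>. Both \<open>\<phi>(bc)\<close> and \<open>\<phi>(b)\<phi>(c)\<close>
  are coalgebra maps \<open>E \<otimes> E \<rightarrow> A' #' H'\<close>, because multiplication of a bialgebra is a coalgebra map.
  Comparing components, \<open>\<phi>\<close> is multiplicative iff \<open>g\<close> is and \<open>f(bc) = f(b\<^sub>1) (g(b\<^sub>2) \<rhd>' f(c))\<close>
  (\<open>conv_pair_hopf_hom\<close>, \<open>hopf_hom_components\<close>). For \<open>E = A\<close> and \<open>E = H\<close> this gives the conditions on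
  \<open>(u, p)\<close> and on \<open>(r, v)\<close>.

  Since \<open>a # h = (a # 1)(1 # h)\<close> and \<open>(1 # h)(b # 1) = h\<^sub>1 \<rhd> b # h\<^sub>2\<close>, a Hopf algebra map \<open>A # H \<rightarrow> B\<close> is
  the same thing as a pair of Hopf algebra maps \<open>\<alpha> : A \<rightarrow> B\<close>, \<open>\<beta> : H \<rightarrow> B\<close> with
  \<open>\<beta>(h) \<alpha>(b) = \<alpha>(h\<^sub>1 \<rhd> b) \<beta>(h\<^sub>2)\<close> (\<open>smash_hopf_homI\<close>, \<open>smash_hopf_homD\<close>).

  For \<open>B = A' #' H'\<close>, \<open>\<alpha> = (u, p)\<close> and \<open>\<beta> = (r, v)\<close>, both sides of this last identity are coalgebra maps
  \<open>H \<otimes> A \<rightarrow> A' #' H'\<close>, so it is again equivalent to the equality of the components, and these are the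
  two sides of the last two conditions on a quadruple (\<open>quadruple_compat\<close>).

  All of this takes place in Sweedler notation, so it is preceded by the universal property of the
  tensor product, a calculus for \<open>sweedler\<close>, and the proof that smash products are bialgebras.
\<close>

section \<open>Linear maps, free modules and quotients\<close>

lemma lin_mapI:
  assumes "\<And>x. x \<in> carrier M \<Longrightarrow> f x \<in> carrier N"
    and "\<And>x y. x \<in> carrier M \<Longrightarrow> y \<in> carrier M \<Longrightarrow> f (x \<oplus>\<^bsub>M\<^esub> y) = f x \<oplus>\<^bsub>N\<^esub> f y"
    and "\<And>c x. c \<in> carrier K \<Longrightarrow> x \<in> carrier M \<Longrightarrow> f (c \<odot>\<^bsub>M\<^esub> x) = c \<odot>\<^bsub>N\<^esub> f x"
  shows "lin_map K M N f"
  using assms unfolding lin_map_def by blast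

lemma lin_map_closed: "lin_map K M N f \<Longrightarrow> x \<in> carrier M \<Longrightarrow> f x \<in> carrier N"
  unfolding lin_map_def by blast

lemma lin_map_add:
  "lin_map K M N f \<Longrightarrow> x \<in> carrier M \<Longrightarrow> y \<in> carrier M \<Longrightarrow> f (x \<oplus>\<^bsub>M\<^esub> y) = f x \<oplus>\<^bsub>N\<^esub> f y"
  unfolding lin_map_def by blast

lemma lin_map_smult:
  "lin_map K M N f \<Longrightarrow> c \<in> carrier K \<Longrightarrow> x \<in> carrier M \<Longrightarrow> f (c \<odot>\<^bsub>M\<^esub> x) = c \<odot>\<^bsub>N\<^esub> f x"
  unfolding lin_map_def by blast

lemma lin_map_cong:
  assumes M: "module K M" and eq: "\<And>x. x \<in> carrier M \<Longrightarrow> f x = g x"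
    and g: "lin_map K M N g"
  shows "lin_map K M N f"
proof -
  interpret module K M by fact
  show ?thesis
    by (rule lin_mapI) (simp_all add: eq lin_map_closed[OF g] lin_map_add[OF g] lin_map_smult[OF g])
qed

lemma lin_map_id: "lin_map K M M (\<lambda>x. x)"
  by (rule lin_mapI) auto

lemma lin_map_compose:
  assumes g: "lin_map K M N g" and f: "lin_map K L M f"
  shows "lin_map K L N (\<lambda>x. g (f x))"
  by (rule lin_mapI)
     (simp_all add: lin_map_closed[OF g] lin_map_add[OF g] lin_map_smult[OF g]
        lin_map_closed[OF f] lin_map_add[OF f] lin_map_smult[OF f])

lemma lin_smult_vec:
  assumes "module K V" "k \<in> carrier K" "lin_map K L V f"
  shows "lin_map K L V (\<lambda>x. k \<odot>\<^bsub>V\<^esub> f x)"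
proof -
  interpret V: module K V by fact
  have "lin_map K V V (\<lambda>x. k \<odot>\<^bsub>V\<^esub> x)"
    by (rule lin_mapI)
       (use assms in \<open>simp_all add: V.smult_r_distr V.smult_assoc1[symmetric] V.R.m_comm\<close>)
  then show ?thesis by (rule lin_map_compose) fact
qed

lemma lin_map_sum:
  assumes L: "module K L" and V: "module K V" and "finite S"
    and "\<And>x. x \<in> S \<Longrightarrow> lin_map K L V (\<lambda>z. g z x)"
  shows "lin_map K L V (\<lambda>z. \<Oplus>\<^bsub>V\<^esub>x\<in>S. g z x)"
proof -
  interpret L: module K L by fact
  interpret V: module K V by fact
  show ?thesis using assms(3,4)
  proof (induct S)
    case empty
    show ?case by (rule lin_mapI) simp_all
  next
    case (insert a S)
    have a: "lin_map K L V (\<lambda>z. g z a)" and S: "lin_map K L V (\<lambda>z. \<Oplus>\<^bsub>V\<^esub>x\<in>S. g z x)"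
      using insert by simp_all
    have "lin_map K L V (\<lambda>z. g z a \<oplus>\<^bsub>V\<^esub> (\<Oplus>\<^bsub>V\<^esub>x\<in>S. g z x))"
      by (rule lin_mapI)
         (simp_all add: lin_map_closed[OF a] lin_map_closed[OF S] lin_map_add[OF a] lin_map_add[OF S]
           lin_map_smult[OF a] lin_map_smult[OF S] V.smult_r_distr V.M.a_ac)
    then show ?case
      by (rule lin_map_cong[OF L, rotated])
         (use insert lin_map_closed in \<open>force intro!: V.finsum_insert\<close>)
  qed
qed

lemma bilin_mapI:
  assumes "\<And>y. y \<in> carrier N \<Longrightarrow> lin_map K M V (\<lambda>x. F x y)"
    and "\<And>x. x \<in> carrier M \<Longrightarrow> lin_map K N V (\<lambda>y. F x y)"
  shows "bilin_map K M N V F"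
  using assms by (auto simp: bilin_map_def)

lemma bilin_map_lin1: "bilin_map K M N V F \<Longrightarrow> y \<in> carrier N \<Longrightarrow> lin_map K M V (\<lambda>x. F x y)"
  by (auto simp: bilin_map_def)

lemma bilin_map_lin2: "bilin_map K M N V F \<Longrightarrow> x \<in> carrier M \<Longrightarrow> lin_map K N V (\<lambda>y. F x y)"
  by (auto simp: bilin_map_def)

lemma bilin_map_closed:
  "bilin_map K M N V F \<Longrightarrow> x \<in> carrier M \<Longrightarrow> y \<in> carrier N \<Longrightarrow> F x y \<in> carrier V"
  by (rule lin_map_closed[OF bilin_map_lin2])

locale lin_pair = M: module K M + N: module K N
  for K and M and N +
  fixes f
  assumes lin: "lin_map K M N f"
begin

lemma zero: "f \<zero>\<^bsub>M\<^esub> = \<zero>\<^bsub>N\<^esub>"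
proof -
  have "f (\<zero>\<^bsub>K\<^esub> \<odot>\<^bsub>M\<^esub> \<zero>\<^bsub>M\<^esub>) = \<zero>\<^bsub>K\<^esub> \<odot>\<^bsub>N\<^esub> f \<zero>\<^bsub>M\<^esub>"
    by (rule lin_map_smult[OF lin]) auto
  then show ?thesis using lin_map_closed[OF lin, of "\<zero>\<^bsub>M\<^esub>"] by simp
qed

lemma uminus: "x \<in> carrier M \<Longrightarrow> f (\<ominus>\<^bsub>M\<^esub> x) = \<ominus>\<^bsub>N\<^esub> f x"
proof -
  assume x: "x \<in> carrier M"
  have "f (\<ominus>\<^bsub>M\<^esub> x) \<oplus>\<^bsub>N\<^esub> f x = \<zero>\<^bsub>N\<^esub>"
    using lin_map_add[OF lin, of "\<ominus>\<^bsub>M\<^esub> x" x] x zero by (simp add: M.M.l_neg)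
  then show ?thesis using x lin_map_closed[OF lin] by (metis M.M.a_inv_closed N.M.minus_equality)
qed

lemma minus: "x \<in> carrier M \<Longrightarrow> y \<in> carrier M \<Longrightarrow> f (x \<ominus>\<^bsub>M\<^esub> y) = f x \<ominus>\<^bsub>N\<^esub> f y"
  by (simp add: a_minus_def lin_map_add[OF lin] uminus)

lemma kernel: "submodule {x \<in> carrier M. f x = \<zero>\<^bsub>N\<^esub>} K M"
  by (rule M.submoduleI)
     (auto simp: zero uminus lin_map_add[OF lin] lin_map_smult[OF lin])

lemma finsum:
  "g \<in> S \<rightarrow> carrier M \<Longrightarrow> f (\<Oplus>\<^bsub>M\<^esub>x\<in>S. g x) = (\<Oplus>\<^bsub>N\<^esub>x\<in>S. f (g x))"
proof (induct S rule: infinite_finite_induct)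
  case (insert a S)
  then have "f (\<Oplus>\<^bsub>M\<^esub>x\<in>insert a S. g x) = f (g a \<oplus>\<^bsub>M\<^esub> (\<Oplus>\<^bsub>M\<^esub>x\<in>S. g x))" by simp
  also have "\<dots> = f (g a) \<oplus>\<^bsub>N\<^esub> (\<Oplus>\<^bsub>N\<^esub>x\<in>S. f (g x))"
    using insert by (subst lin_map_add[OF lin]) auto
  also have "\<dots> = (\<Oplus>\<^bsub>N\<^esub>x\<in>insert a S. f (g x))"
    using insert by (subst N.M.finsum_insert) (auto intro!: lin_map_closed[OF lin])
  finally show ?case .
qed (auto simp: zero)

end

lemma lin_pairI: "module K M \<Longrightarrow> module K N \<Longrightarrow> lin_map K M N f \<Longrightarrow> lin_pair K M N f"
  by (simp add: lin_pair_def lin_pair_axioms_def)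

lemma span_mod_submodule:
  assumes "module K M" "S \<subseteq> carrier M" shows "submodule (span_mod K M S) K M"
proof -
  interpret module K M by fact
  have c: "carrier M \<in> {N. submodule N K M \<and> S \<subseteq> N}"
    using carrier_is_submodule assms by auto
  show ?thesis unfolding span_mod_def
  proof (rule submoduleI)
    show "\<zero>\<^bsub>M\<^esub> \<in> \<Inter>{N. submodule N K M \<and> S \<subseteq> N}"
      by (auto dest!: submodule.axioms(1) subgroup.one_closed)
  next
    show "a \<oplus>\<^bsub>M\<^esub> b \<in> \<Inter>{N. submodule N K M \<and> S \<subseteq> N}"
      if "a \<in> \<Inter>{N. submodule N K M \<and> S \<subseteq> N}" "b \<in> \<Inter>{N. submodule N K M \<and> S \<subseteq> N}" for a b
      using that by (auto intro: submoduleE(5))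
  qed (use c in \<open>auto intro: submoduleE(3,4)\<close>)
qed

lemma span_mod_incl: "S \<subseteq> span_mod K M S"
  by (auto simp: span_mod_def)

lemma span_mod_least: "submodule N K M \<Longrightarrow> S \<subseteq> N \<Longrightarrow> span_mod K M S \<subseteq> N"
  by (auto simp: span_mod_def)

locale quot = module K M for K and M (structure) and N +
  assumes sub: "submodule N K M"
begin

lemma ab: "abelian_subgroup N M"
  by (rule abelian_subgroupI3)
     (use sub in \<open>auto simp: submodule_def additive_subgroup_def abelian_group_axioms\<close>)

sublocale abelian_subgroup N M by (rule ab)

abbreviation Q where "Q \<equiv> quot_mod M N"

lemma Q_carrierE:
  assumes "t \<in> carrier Q" obtains x where "x \<in> carrier M" "t = N +> x"
  using assms by (auto simp: quot_mod_def A_RCOSETS_def')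

lemma coset_carrier: "x \<in> carrier M \<Longrightarrow> N +> x \<in> carrier Q"
  by (auto simp: quot_mod_def A_RCOSETS_def')

lemma coset_eqD:
  assumes "x \<in> carrier M" "y \<in> N +> x" shows "y \<in> carrier M" "N +> y = N +> x"
  using a_elemrcos_carrier[OF assms] a_repr_independence'[OF assms(2,1)] by simp_all

lemma coset_eq_iff:
  assumes "x \<in> carrier M" "y \<in> carrier M" shows "N +> x = N +> y \<longleftrightarrow> x \<ominus> y \<in> N"
proof -
  have "N +> x = N +> y \<longleftrightarrow> x \<in> N +> y"
    using a_rcos_self[OF assms(1)] a_repr_independence'[of x y] assms(2) by metis
  then show ?thesis using assms a_rcos_module[of y x] by (simp add: a_minus_def)
qed

lemma coset_add:
  assumes "x \<in> carrier M" "y \<in> carrier M" shows "(N +> x) \<oplus>\<^bsub>Q\<^esub> (N +> y) = N +> (x \<oplus> y)"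
  using a_rcos_sum[OF assms] by (simp add: quot_mod_def)

lemma coset_smult:
  assumes c: "c \<in> carrier K" and x: "x \<in> carrier M" shows "c \<odot>\<^bsub>Q\<^esub> (N +> x) = N +> (c \<odot> x)"
proof -
  have *: "N +> (c \<odot> y) = N +> (c \<odot> x)" if "y \<in> N +> x" for y
  proof -
    have y: "y \<in> carrier M" and e: "N +> y = N +> x" using coset_eqD[OF x that] by simp_all
    have "y \<ominus> x \<in> N" using e coset_eq_iff[OF y x] by simp
    then have "c \<odot> (y \<ominus> x) \<in> N" by (rule submoduleE(4)[OF sub c])
    then have "c \<odot> y \<ominus> c \<odot> x \<in> N"
      using x y c by (simp add: a_minus_def smult_r_distr smult_r_minus)
    then show ?thesis using x y c by (simp add: coset_eq_iff)
  qed
  have "x \<in> N +> x" using x by (rule a_rcos_self)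
  then have "(\<Union>y\<in>N +> x. N +> (c \<odot> y)) = N +> (c \<odot> x)" using * by blast
  then show ?thesis by (simp add: quot_mod_def)
qed

lemma coset_zero: "N +> \<zero> = \<zero>\<^bsub>Q\<^esub>"
  by (simp add: quot_mod_def a_subset)

lemma Q_module: "module K Q"
proof -
  have neg: "\<exists>y\<in>carrier Q. y \<oplus>\<^bsub>Q\<^esub> (N +> a) = \<zero>\<^bsub>Q\<^esub>" if a: "a \<in> carrier M" for a
    by (rule bexI[OF _ coset_carrier[of "\<ominus> a"]]) (use a in \<open>simp_all add: coset_add M.l_neg coset_zero\<close>)
  have zero: "\<zero>\<^bsub>Q\<^esub> \<in> carrier Q" using coset_carrier[of \<zero>] by (simp add: coset_zero)
  have l_zero: "\<zero>\<^bsub>Q\<^esub> \<oplus>\<^bsub>Q\<^esub> (N +> a) = N +> a" if a: "a \<in> carrier M" for a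
    using coset_add[of \<zero> a] a by (simp add: coset_zero)
  have "abelian_group Q"
    by (rule abelian_groupI; (elim Q_carrierE)?)
       (simp_all add: coset_add coset_carrier M.a_ac zero l_zero neg)
  from R.is_cring this show ?thesis
    by (rule moduleI; (elim Q_carrierE)?)
       (simp_all add: coset_add coset_smult coset_carrier
        smult_l_distr smult_r_distr smult_assoc1)
qed

lemma coset_lin: "lin_map K M Q (\<lambda>x. N +> x)"
  by (rule lin_mapI) (simp_all add: coset_carrier coset_add coset_smult)

end

lemma free_mod_carrier:
  "f \<in> carrier (free_mod K X) \<longleftrightarrow>
     (\<forall>x. f x \<in> carrier K) \<and> finite {x. f x \<noteq> \<zero>\<^bsub>K\<^esub>} \<and> {x. f x \<noteq> \<zero>\<^bsub>K\<^esub>} \<subseteq> X"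
  by (simp add: free_mod_def)

lemma free_mod_simps:
  "f \<oplus>\<^bsub>free_mod K X\<^esub> g = (\<lambda>x. f x \<oplus>\<^bsub>K\<^esub> g x)"
  "c \<odot>\<^bsub>free_mod K X\<^esub> f = (\<lambda>x. c \<otimes>\<^bsub>K\<^esub> f x)"
  "\<zero>\<^bsub>free_mod K X\<^esub> = (\<lambda>x. \<zero>\<^bsub>K\<^esub>)"
  by (simp_all add: free_mod_def)

lemma free_mod_module:
  assumes "cring K" shows "module K (free_mod K X)"
proof -
  interpret K: cring K by fact
  have add: "f \<oplus>\<^bsub>free_mod K X\<^esub> g \<in> carrier (free_mod K X)"
    if "f \<in> carrier (free_mod K X)" "g \<in> carrier (free_mod K X)" for f g
  proof -
    have "{x. f x \<oplus>\<^bsub>K\<^esub> g x \<noteq> \<zero>\<^bsub>K\<^esub>} \<subseteq> {x. f x \<noteq> \<zero>\<^bsub>K\<^esub>} \<union> {x. g x \<noteq> \<zero>\<^bsub>K\<^esub>}" by auto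
    then show ?thesis using that
      by (auto simp: free_mod_carrier free_mod_simps intro: finite_subset)
  qed
  have smult: "c \<odot>\<^bsub>free_mod K X\<^esub> g \<in> carrier (free_mod K X)"
    if "c \<in> carrier K" "g \<in> carrier (free_mod K X)" for c g
  proof -
    have "{x. c \<otimes>\<^bsub>K\<^esub> g x \<noteq> \<zero>\<^bsub>K\<^esub>} \<subseteq> {x. g x \<noteq> \<zero>\<^bsub>K\<^esub>}" using that by auto
    then show ?thesis using that
      by (auto simp: free_mod_carrier free_mod_simps intro: finite_subset)
  qed
  show ?thesis
  proof (rule moduleI)
    show "cring K" by fact
    show "abelian_group (free_mod K X)"
    proof (rule abelian_groupI)
      fix f assume f: "f \<in> carrier (free_mod K X)"
      show "\<exists>g\<in>carrier (free_mod K X). g \<oplus>\<^bsub>free_mod K X\<^esub> f = \<zero>\<^bsub>free_mod K X\<^esub>"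
      proof
        show "(\<ominus>\<^bsub>K\<^esub> \<one>\<^bsub>K\<^esub>) \<odot>\<^bsub>free_mod K X\<^esub> f \<in> carrier (free_mod K X)" by (rule smult[OF _ f]) simp
        show "((\<ominus>\<^bsub>K\<^esub> \<one>\<^bsub>K\<^esub>) \<odot>\<^bsub>free_mod K X\<^esub> f) \<oplus>\<^bsub>free_mod K X\<^esub> f = \<zero>\<^bsub>free_mod K X\<^esub>"
          using f by (simp add: free_mod_carrier free_mod_simps K.l_minus K.l_neg)
      qed
    qed (use add in \<open>auto simp: free_mod_carrier free_mod_simps K.a_ac\<close>)
  qed (use smult in \<open>auto simp: free_mod_carrier free_mod_simps K.l_distr K.r_distr K.m_assoc\<close>)
qed

definition lin_ext :: "('k, 'm) ring_scheme \<Rightarrow> ('k, 'v, 'n) module_scheme \<Rightarrow> ('x \<Rightarrow> 'v) \<Rightarrow> ('x \<Rightarrow> 'k) \<Rightarrow> 'v" where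
  "lin_ext K V \<phi> z = (\<Oplus>\<^bsub>V\<^esub>x\<in>{x. z x \<noteq> \<zero>\<^bsub>K\<^esub>}. z x \<odot>\<^bsub>V\<^esub> \<phi> x)"

locale lin_extension = V: module K V for K and V and X :: "'x set" and \<phi> +
  assumes phi_closed: "\<And>x. x \<in> X \<Longrightarrow> \<phi> x \<in> carrier V"
begin

abbreviation FX where "FX \<equiv> free_mod K X"

lemma lin_ext_superset:
  assumes "z \<in> carrier FX" "finite Y" "{x. z x \<noteq> \<zero>\<^bsub>K\<^esub>} \<subseteq> Y" "Y \<subseteq> X"
  shows "lin_ext K V \<phi> z = (\<Oplus>\<^bsub>V\<^esub>x\<in>Y. z x \<odot>\<^bsub>V\<^esub> \<phi> x)"
  unfolding lin_ext_def
  by (rule V.add.finprod_mono_neutral_cong_left)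
     (use assms phi_closed in \<open>auto simp: free_mod_carrier\<close>)

lemma lin_ext_lin: "lin_map K FX V (lin_ext K V \<phi>)"
proof (rule lin_mapI)
  fix z assume z: "z \<in> carrier FX"
  then show "lin_ext K V \<phi> z \<in> carrier V"
    unfolding lin_ext_def
    by (intro V.finsum_closed) (use phi_closed in \<open>auto simp: free_mod_carrier\<close>)
next
  fix z w assume z: "z \<in> carrier FX" and w: "w \<in> carrier FX"
  let ?Y = "{x. z x \<noteq> \<zero>\<^bsub>K\<^esub>} \<union> {x. w x \<noteq> \<zero>\<^bsub>K\<^esub>}"
  have Y: "finite ?Y" "?Y \<subseteq> X" using z w by (auto simp: free_mod_carrier)
  interpret F: module K FX by (rule free_mod_module) (rule V.R.is_cring)
  have zw: "z \<oplus>\<^bsub>FX\<^esub> w \<in> carrier FX" using z w by simp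
  have "lin_ext K V \<phi> (z \<oplus>\<^bsub>FX\<^esub> w) = (\<Oplus>\<^bsub>V\<^esub>x\<in>?Y. (z \<oplus>\<^bsub>FX\<^esub> w) x \<odot>\<^bsub>V\<^esub> \<phi> x)"
    by (rule lin_ext_superset[OF zw Y(1) _ Y(2)]) (auto simp: free_mod_simps)
  also have "\<dots> = (\<Oplus>\<^bsub>V\<^esub>x\<in>?Y. z x \<odot>\<^bsub>V\<^esub> \<phi> x \<oplus>\<^bsub>V\<^esub> w x \<odot>\<^bsub>V\<^esub> \<phi> x)"
    by (rule V.finsum_cong')
       (use z w Y phi_closed in \<open>auto simp: free_mod_carrier free_mod_simps V.smult_l_distr\<close>)
  also have "\<dots> = (\<Oplus>\<^bsub>V\<^esub>x\<in>?Y. z x \<odot>\<^bsub>V\<^esub> \<phi> x) \<oplus>\<^bsub>V\<^esub> (\<Oplus>\<^bsub>V\<^esub>x\<in>?Y. w x \<odot>\<^bsub>V\<^esub> \<phi> x)"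
    by (rule V.finsum_addf) (use z w Y phi_closed in \<open>auto simp: free_mod_carrier\<close>)
  also have "\<dots> = lin_ext K V \<phi> z \<oplus>\<^bsub>V\<^esub> lin_ext K V \<phi> w"
    using lin_ext_superset[OF z Y(1) _ Y(2)] lin_ext_superset[OF w Y(1) _ Y(2)] by auto
  finally show "lin_ext K V \<phi> (z \<oplus>\<^bsub>FX\<^esub> w) = lin_ext K V \<phi> z \<oplus>\<^bsub>V\<^esub> lin_ext K V \<phi> w" .
next
  fix c z assume c: "c \<in> carrier K" and z: "z \<in> carrier FX"
  let ?Y = "{x. z x \<noteq> \<zero>\<^bsub>K\<^esub>}"
  have Y: "finite ?Y" "?Y \<subseteq> X" using z by (auto simp: free_mod_carrier)
  interpret F: module K FX by (rule free_mod_module) (rule V.R.is_cring)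
  have "lin_ext K V \<phi> (c \<odot>\<^bsub>FX\<^esub> z) = (\<Oplus>\<^bsub>V\<^esub>x\<in>?Y. (c \<odot>\<^bsub>FX\<^esub> z) x \<odot>\<^bsub>V\<^esub> \<phi> x)"
    by (rule lin_ext_superset[OF F.smult_closed[OF c z] Y(1) _ Y(2)])
       (use c in \<open>auto simp: free_mod_simps\<close>)
  also have "\<dots> = (\<Oplus>\<^bsub>V\<^esub>x\<in>?Y. c \<odot>\<^bsub>V\<^esub> (z x \<odot>\<^bsub>V\<^esub> \<phi> x))"
    by (rule V.finsum_cong')
       (use z c Y phi_closed in \<open>auto simp: free_mod_carrier free_mod_simps V.smult_assoc1\<close>)
  also have "\<dots> = c \<odot>\<^bsub>V\<^esub> lin_ext K V \<phi> z"
    unfolding lin_ext_def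
    by (rule V.finsum_smult_ldistr[symmetric])
       (use z c Y phi_closed in \<open>auto simp: free_mod_carrier\<close>)
  finally show "lin_ext K V \<phi> (c \<odot>\<^bsub>FX\<^esub> z) = c \<odot>\<^bsub>V\<^esub> lin_ext K V \<phi> z" .
qed

end

lemma free_gen_carrier:
  assumes "cring K" "x \<in> X" shows "free_gen K x \<in> carrier (free_mod K X)"
proof -
  interpret cring K by fact
  show ?thesis using assms(2) by (auto simp: free_gen_def free_mod_carrier)
qed

lemma (in lin_extension) lin_ext_gen:
  assumes x: "x \<in> X" shows "lin_ext K V \<phi> (free_gen K x) = \<phi> x"
proof -
  have "lin_ext K V \<phi> (free_gen K x) = (\<Oplus>\<^bsub>V\<^esub>y\<in>{x}. free_gen K x y \<odot>\<^bsub>V\<^esub> \<phi> y)"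
    by (rule lin_ext_superset) (use x free_gen_carrier V.R.is_cring in \<open>auto simp: free_gen_def\<close>)
  then show ?thesis using phi_closed[OF x] by (simp add: free_gen_def)
qed

text \<open>Makes a linear map out of a free module determined by its values on the basis.\<close>

lemma free_mod_expand:
  assumes K: "cring K" and z: "z \<in> carrier (free_mod K X)"
  shows "lin_ext K (free_mod K X) (free_gen K) z = z"
proof -
  interpret F: module K "free_mod K X" by (rule free_mod_module) fact
  interpret E: lin_extension K "free_mod K X" X "free_gen K"
    by unfold_locales (rule free_gen_carrier[OF K])
  let ?S = "{x. z x \<noteq> \<zero>\<^bsub>K\<^esub>}"
  have "(\<Oplus>\<^bsub>free_mod K X\<^esub>x\<in>S. z x \<odot>\<^bsub>free_mod K X\<^esub> free_gen K x) y = (if y \<in> S then z y else \<zero>\<^bsub>K\<^esub>)"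
    if "finite S" "S \<subseteq> X" for S y
    using that
  proof (induct S)
    case (insert a S)
    have c: "free_gen K x \<in> carrier (free_mod K X)" if "x \<in> insert a S" for x
      by (rule free_gen_carrier[OF K]) (use insert.prems that in auto)
    have zc: "z x \<in> carrier K" for x using z by (simp add: free_mod_carrier)
    have cc: "z x \<odot>\<^bsub>free_mod K X\<^esub> free_gen K x \<in> carrier (free_mod K X)" if "x \<in> insert a S" for x
      by (rule F.smult_closed[OF zc c[OF that]])
    have "(\<Oplus>\<^bsub>free_mod K X\<^esub>x\<in>insert a S. z x \<odot>\<^bsub>free_mod K X\<^esub> free_gen K x)
        = z a \<odot>\<^bsub>free_mod K X\<^esub> free_gen K a
          \<oplus>\<^bsub>free_mod K X\<^esub> (\<Oplus>\<^bsub>free_mod K X\<^esub>x\<in>S. z x \<odot>\<^bsub>free_mod K X\<^esub> free_gen K x)"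
      by (rule F.finsum_insert) (use insert cc in auto)
    then show ?case
      using insert zc by (simp add: free_mod_simps(1)) (simp add: free_mod_simps free_gen_def)
  qed (auto simp: free_mod_simps)
  then show ?thesis using z unfolding lin_ext_def by (auto simp: free_mod_carrier)
qed

section \<open>The universal property of the tensor product\<close>

locale tensor = M: module K M + N: module K N
  for K and M :: "('k, 'a, 'm) module_scheme" and N :: "('k, 'b, 'n) module_scheme"
begin

abbreviation F where "F \<equiv> tensor_free K M N"
abbreviation Nul where "Nul \<equiv> tensor_null K M N"
abbreviation T where "T \<equiv> tensor_mod K M N"

lemma F_module: "module K F"
  unfolding tensor_free_def by (rule free_mod_module) (rule M.R.is_cring)

lemma gen_carrier:
  "a \<in> carrier M \<Longrightarrow> b \<in> carrier N \<Longrightarrow> free_gen K (a, b) \<in> carrier F"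
  unfolding tensor_free_def by (rule free_gen_carrier) (use M.R.is_cring in auto)

sublocale F: module K F by (rule F_module)

lemma rels_subset: "tensor_rels K M N \<subseteq> carrier F"
  unfolding tensor_rels_def Let_def by (auto intro!: F.minus_closed gen_carrier)

sublocale Q: quot K F Nul
  unfolding tensor_null_def
  by (intro quot.intro quot_axioms.intro F_module span_mod_submodule rels_subset)

lemma T_eq: "T = quot_mod F Nul" by (simp add: tensor_mod_def)

lemma T_module: "module K T" using Q.Q_module by (simp add: T_eq)

lemma tens_closed: "a \<in> carrier M \<Longrightarrow> b \<in> carrier N \<Longrightarrow> tens K M N a b \<in> carrier T"
  unfolding T_eq tens_def by (intro Q.coset_carrier gen_carrier)

lemma rel_cosets:
  assumes "x \<ominus>\<^bsub>F\<^esub> y \<in> tensor_rels K M N" "x \<in> carrier F" "y \<in> carrier F"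
  shows "Nul +>\<^bsub>F\<^esub> x = Nul +>\<^bsub>F\<^esub> y"
  using assms span_mod_incl[of "tensor_rels K M N" K F]
  by (subst Q.coset_eq_iff) (auto simp: tensor_null_def)

lemma tens_bilin: "bilin_map K M N T (tens K M N)"
proof (intro bilin_mapI lin_mapI)
  fix a a' b assume c: "a \<in> carrier M" "a' \<in> carrier M" "b \<in> carrier N"
  have "Nul +>\<^bsub>F\<^esub> free_gen K (a \<oplus>\<^bsub>M\<^esub> a', b) = Nul +>\<^bsub>F\<^esub> (free_gen K (a, b) \<oplus>\<^bsub>F\<^esub> free_gen K (a', b))"
    by (rule rel_cosets) (use c in \<open>auto intro!: gen_carrier F.a_closed simp: tensor_rels_def Let_def\<close>)
  then show "tens K M N (a \<oplus>\<^bsub>M\<^esub> a') b = tens K M N a b \<oplus>\<^bsub>T\<^esub> tens K M N a' b"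
    using c by (simp add: tens_def T_eq Q.coset_add gen_carrier)
next
  fix a b b' assume c: "a \<in> carrier M" "b \<in> carrier N" "b' \<in> carrier N"
  have "Nul +>\<^bsub>F\<^esub> free_gen K (a, b \<oplus>\<^bsub>N\<^esub> b') = Nul +>\<^bsub>F\<^esub> (free_gen K (a, b) \<oplus>\<^bsub>F\<^esub> free_gen K (a, b'))"
    by (rule rel_cosets) (use c in \<open>auto intro!: gen_carrier F.a_closed simp: tensor_rels_def Let_def\<close>)
  then show "tens K M N a (b \<oplus>\<^bsub>N\<^esub> b') = tens K M N a b \<oplus>\<^bsub>T\<^esub> tens K M N a b'"
    using c by (simp add: tens_def T_eq Q.coset_add gen_carrier)
next
  fix k a b assume c: "k \<in> carrier K" "a \<in> carrier M" "b \<in> carrier N"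
  have "Nul +>\<^bsub>F\<^esub> free_gen K (k \<odot>\<^bsub>M\<^esub> a, b) = Nul +>\<^bsub>F\<^esub> (k \<odot>\<^bsub>F\<^esub> free_gen K (a, b))"
    by (rule rel_cosets) (use c in \<open>auto intro!: gen_carrier F.smult_closed simp: tensor_rels_def Let_def\<close>)
  then show "tens K M N (k \<odot>\<^bsub>M\<^esub> a) b = k \<odot>\<^bsub>T\<^esub> tens K M N a b"
    using c by (simp add: tens_def T_eq Q.coset_smult gen_carrier)
next
  fix k a b assume c: "k \<in> carrier K" "a \<in> carrier M" "b \<in> carrier N"
  have "Nul +>\<^bsub>F\<^esub> free_gen K (a, k \<odot>\<^bsub>N\<^esub> b) = Nul +>\<^bsub>F\<^esub> (k \<odot>\<^bsub>F\<^esub> free_gen K (a, b))"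
    by (rule rel_cosets) (use c in \<open>auto intro!: gen_carrier F.smult_closed simp: tensor_rels_def Let_def\<close>)
  then show "tens K M N a (k \<odot>\<^bsub>N\<^esub> b) = k \<odot>\<^bsub>T\<^esub> tens K M N a b"
    using c by (simp add: tens_def T_eq Q.coset_smult gen_carrier)
qed (auto intro: tens_closed)

definition rep :: "('k, 'a, 'b) tensor \<Rightarrow> ('a \<times> 'b \<Rightarrow> 'k)" where "rep t = (SOME z. z \<in> t)"

lemma rep: assumes "t \<in> carrier T" shows "rep t \<in> carrier F" "Nul +>\<^bsub>F\<^esub> rep t = t"
proof -
  obtain z where z: "z \<in> carrier F" "t = Nul +>\<^bsub>F\<^esub> z"
    using assms Q.Q_carrierE unfolding T_eq by blast
  then have "z \<in> t" by (simp add: Q.a_rcos_self)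
  then have "rep t \<in> t" unfolding rep_def by (rule someI[where P = "\<lambda>z. z \<in> t"])
  then show "rep t \<in> carrier F" "Nul +>\<^bsub>F\<^esub> rep t = t" using z Q.coset_eqD[of z "rep t"] by simp_all
qed

lemma tlift_rep: "tlift K V G t = lin_ext K V (\<lambda>x. G (fst x) (snd x)) (rep t)"
  by (simp only: tlift_def lin_ext_def rep_def Let_def)

text \<open>
  The linear extension of a bilinear map kills the defining relations, and its kernel is a submodule,
  so it kills their span. Hence \<open>tlift\<close> does not depend on the representative it picks.
\<close>

lemma lift_vanish:
  assumes V: "module K V" and G: "bilin_map K M N V G" and z: "z \<in> Nul"
  shows "lin_ext K V (\<lambda>x. G (fst x) (snd x)) z = \<zero>\<^bsub>V\<^esub>"
proof -
  interpret V: module K V by fact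
  interpret E: lin_extension K V "carrier M \<times> carrier N" "\<lambda>x. G (fst x) (snd x)"
    by unfold_locales (auto intro: bilin_map_closed[OF G])
  let ?e = "lin_ext K V (\<lambda>x. G (fst x) (snd x))"
  interpret P: lin_pair K F V ?e
    using E.lin_ext_lin by unfold_locales (simp add: tensor_free_def)
  have g: "?e (free_gen K (a, b)) = G a b" if "a \<in> carrier M" "b \<in> carrier N" for a b
    using E.lin_ext_gen[of "(a,b)"] that by simp
  note lin = lin_map_add[OF P.lin] lin_map_smult[OF P.lin]
    lin_map_add[OF bilin_map_lin1[OF G]] lin_map_smult[OF bilin_map_lin1[OF G]]
    lin_map_add[OF bilin_map_lin2[OF G]] lin_map_smult[OF bilin_map_lin2[OF G]]
  have "tensor_rels K M N \<subseteq> {x \<in> carrier F. ?e x = \<zero>\<^bsub>V\<^esub>}"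
    unfolding tensor_rels_def Let_def
    by (auto intro!: F.minus_closed gen_carrier
        simp: P.minus g gen_carrier lin V.M.r_neg a_minus_def P.uminus bilin_map_closed[OF G])
  then show ?thesis using z span_mod_least[OF P.kernel] by (auto simp: tensor_null_def)
qed

lemma
  assumes V: "module K V" and G: "bilin_map K M N V G"
  shows tlift_lin: "lin_map K T V (tlift K V G)"
    and tlift_tens: "\<And>a b. a \<in> carrier M \<Longrightarrow> b \<in> carrier N \<Longrightarrow> tlift K V G (tens K M N a b) = G a b"
proof -
  interpret V: module K V by fact
  interpret E: lin_extension K V "carrier M \<times> carrier N" "\<lambda>x. G (fst x) (snd x)"
    by unfold_locales (auto intro: bilin_map_closed[OF G])
  let ?e = "lin_ext K V (\<lambda>x. G (fst x) (snd x))"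
  interpret P: lin_pair K F V ?e
    using E.lin_ext_lin by unfold_locales (simp add: tensor_free_def)
  have coset: "tlift K V G (Nul +>\<^bsub>F\<^esub> z) = ?e z" if z: "z \<in> carrier F" for z
  proof -
    have t: "Nul +>\<^bsub>F\<^esub> z \<in> carrier T" using Q.coset_carrier z by (simp add: T_eq)
    let ?w = "rep (Nul +>\<^bsub>F\<^esub> z)"
    have w: "?w \<in> carrier F" "?w \<ominus>\<^bsub>F\<^esub> z \<in> Nul" using rep[OF t] Q.coset_eq_iff[OF rep(1)[OF t] z] by blast+
    then have "?e ?w \<ominus>\<^bsub>V\<^esub> ?e z = \<zero>\<^bsub>V\<^esub>" using lift_vanish[OF V G w(2)] P.minus[OF w(1) z] by simp
    then have "?e ?w = ?e z"
      using V.M.minus_equality[of "?e ?w" "\<ominus>\<^bsub>V\<^esub> ?e z"]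
        lin_map_closed[OF P.lin w(1)] lin_map_closed[OF P.lin z] by (simp add: a_minus_def)
    then show ?thesis by (simp add: tlift_rep)
  qed
  show "lin_map K T V (tlift K V G)" unfolding T_eq
    by (rule lin_mapI; elim Q.Q_carrierE)
       (auto simp: coset Q.coset_add Q.coset_smult lin_map_add[OF P.lin] lin_map_smult[OF P.lin]
         intro: lin_map_closed[OF P.lin])
  show "tlift K V G (tens K M N a b) = G a b" if "a \<in> carrier M" "b \<in> carrier N" for a b
    unfolding tens_def using that E.lin_ext_gen[of "(a,b)"] by (simp add: coset gen_carrier)
qed

text \<open>
  Every tensor is the class of a finite combination of basis elements of the free module, and these
  are mapped to pure tensors.
\<close>

lemma tens_ext:
  assumes V: "module K V" and f: "lin_map K T V f" and g: "lin_map K T V g"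
    and eq: "\<And>a b. a \<in> carrier M \<Longrightarrow> b \<in> carrier N \<Longrightarrow> f (tens K M N a b) = g (tens K M N a b)"
    and t: "t \<in> carrier T"
  shows "f t = g t"
proof -
  interpret V: module K V by fact
  obtain z where z: "z \<in> carrier F" "t = Nul +>\<^bsub>F\<^esub> z"
    using t Q.Q_carrierE unfolding T_eq by blast
  have FX: "F = free_mod K (carrier M \<times> carrier N)" by (simp add: tensor_free_def)
  let ?S = "{x. z x \<noteq> \<zero>\<^bsub>K\<^esub>}"
  let ?e = "\<lambda>h x. h (Nul +>\<^bsub>F\<^esub> x)"
  have zs: "z = (\<Oplus>\<^bsub>F\<^esub>x\<in>?S. z x \<odot>\<^bsub>F\<^esub> free_gen K x)"
    using free_mod_expand[OF M.R.is_cring z(1)[unfolded FX]] unfolding FX lin_ext_def by (rule sym)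
  have S: "?S \<subseteq> carrier M \<times> carrier N" "\<And>x. z x \<in> carrier K"
    using z(1) by (auto simp: FX free_mod_carrier)
  have sum: "h t = (\<Oplus>\<^bsub>V\<^esub>x\<in>?S. z x \<odot>\<^bsub>V\<^esub> h (tens K M N (fst x) (snd x)))"
    if h: "lin_map K T V h" for h
  proof -
    interpret P: lin_pair K F V "\<lambda>x. h (Nul +>\<^bsub>F\<^esub> x)"
      by unfold_locales (rule lin_map_compose[OF h[unfolded T_eq] Q.coset_lin])
    have gc: "x \<in> ?S \<Longrightarrow> free_gen K x \<in> carrier F" for x
      using S gen_carrier by (cases x) auto
    have "h t = h (Nul +>\<^bsub>F\<^esub> (\<Oplus>\<^bsub>F\<^esub>x\<in>?S. z x \<odot>\<^bsub>F\<^esub> free_gen K x))"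
      using zs z(2) by simp
    also have "\<dots> = (\<Oplus>\<^bsub>V\<^esub>x\<in>?S. h (Nul +>\<^bsub>F\<^esub> (z x \<odot>\<^bsub>F\<^esub> free_gen K x)))"
      by (rule P.finsum) (use S gc in auto)
    also have "\<dots> = (\<Oplus>\<^bsub>V\<^esub>x\<in>?S. z x \<odot>\<^bsub>V\<^esub> h (tens K M N (fst x) (snd x)))"
      by (rule V.finsum_cong')
         (use S gc h in \<open>auto simp: lin_map_smult[OF P.lin] tens_def
            intro!: V.smult_closed lin_map_closed[OF P.lin]\<close>)
    finally show ?thesis .
  qed
  show ?thesis unfolding sum[OF f] sum[OF g]
    by (rule V.finsum_cong')
       (use S eq in \<open>auto intro!: V.smult_closed lin_map_closed[OF g] tens_closed\<close>)
qed

end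

section \<open>Calculating with lifted maps\<close>

lemma tensorI: "module K M \<Longrightarrow> module K N \<Longrightarrow> tensor K M N"
  by (simp add: tensor_def)

lemmas tensor_module = tensor.T_module[OF tensorI]
lemmas tens_closed = tensor.tens_closed[OF tensorI]
lemmas tlift_tens = tensor.tlift_tens[OF tensorI]

lemma lin_tens1:
  assumes "module K M" "module K N" "b \<in> carrier N" "lin_map K L M f"
  shows "lin_map K L (tensor_mod K M N) (\<lambda>x. tens K M N (f x) b)"
  by (rule lin_map_compose[OF bilin_map_lin1[OF tensor.tens_bilin[OF tensorI]]]) fact+

lemma lin_tens2:
  assumes "module K M" "module K N" "a \<in> carrier M" "lin_map K L N f"
  shows "lin_map K L (tensor_mod K M N) (\<lambda>x. tens K M N a (f x))"
  by (rule lin_map_compose[OF bilin_map_lin2[OF tensor.tens_bilin[OF tensorI]]]) fact+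

lemma lin_tlift_arg:
  assumes "module K M" "module K N" "module K V" "bilin_map K M N V G" "lin_map K L (tensor_mod K M N) f"
  shows "lin_map K L V (\<lambda>x. tlift K V G (f x))"
  by (rule lin_map_compose[OF tensor.tlift_lin[OF tensorI]]) fact+

lemma foldSetD_cong:
  "(A, x) \<in> foldSetD D f e \<Longrightarrow> (\<And>a. a \<in> A \<Longrightarrow> f a = g a) \<Longrightarrow> (A, x) \<in> foldSetD D g e"
  by (induct set: foldSetD) (auto intro: foldSetD.intros)

text \<open>
  A finite sum evaluates its summand on the index set only, whether or not the values lie in the
  carrier. Without closure side conditions the rule can be used below binders.
\<close>

lemma finsum_cong_unconditional:
  fixes V :: "('c, 'n) ring_scheme"
  assumes "\<And>a. a \<in> A \<Longrightarrow> f a = g a"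
  shows "finsum V f A = finsum V g A"
proof -
  have "(A, x) \<in> foldSetD D (h \<circ> f) e \<longleftrightarrow> (A, x) \<in> foldSetD D (h \<circ> g) e" for h D e and x :: 'c
    using assms by (auto intro: foldSetD_cong)
  then show ?thesis by (simp add: finsum_def finprod_def foldD_def)
qed

lemma (in abelian_monoid) finsum_swap:
  assumes "finite A" "finite B" "\<And>x y. x \<in> A \<Longrightarrow> y \<in> B \<Longrightarrow> f x y \<in> carrier G"
  shows "(\<Oplus>x\<in>A. \<Oplus>y\<in>B. f x y) = (\<Oplus>y\<in>B. \<Oplus>x\<in>A. f x y)"
  using assms(1,3)
proof (induct A)
  case (insert a A)
  have c: "f a y \<in> carrier G" "(\<Oplus>x\<in>A. f x y) \<in> carrier G" if "y \<in> B" for y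
    using insert.prems that by (auto intro!: finsum_closed)
  have "(\<Oplus>x\<in>insert a A. \<Oplus>y\<in>B. f x y) = (\<Oplus>y\<in>B. f a y) \<oplus> (\<Oplus>x\<in>A. \<Oplus>y\<in>B. f x y)"
    using insert.hyps(1,2) insert.prems by (intro finsum_insert) (auto intro!: finsum_closed)
  also have "\<dots> = (\<Oplus>y\<in>B. f a y) \<oplus> (\<Oplus>y\<in>B. \<Oplus>x\<in>A. f x y)"
    using insert.hyps(3) insert.prems by simp
  also have "\<dots> = (\<Oplus>y\<in>B. f a y \<oplus> (\<Oplus>x\<in>A. f x y))"
    using c by (intro finsum_addf[symmetric]) auto
  also have "\<dots> = (\<Oplus>y\<in>B. \<Oplus>x\<in>insert a A. f x y)"
    by (rule finsum_cong_unconditional, rule finsum_insert[symmetric])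
       (use insert.hyps(1,2) insert.prems in auto)
  finally show ?case .
qed simp

context tensor
begin

text \<open>
  \<open>tlift\<close> evaluates one fixed formal linear combination representing the tensor. The next lemmas vary
  the function and keep the tensor, so each of them compares sums over the same representative.
\<close>

lemma rep_finite:
  assumes "t \<in> carrier T"
  shows "finite {x. rep t x \<noteq> \<zero>\<^bsub>K\<^esub>}"
    and "{x. rep t x \<noteq> \<zero>\<^bsub>K\<^esub>} \<subseteq> carrier M \<times> carrier N"
    and "rep t x \<in> carrier K"
  using rep(1)[OF assms] unfolding tensor_free_def free_mod_carrier by blast+

lemma tlift_sum: "tlift K V G t = (\<Oplus>\<^bsub>V\<^esub>x\<in>{x. rep t x \<noteq> \<zero>\<^bsub>K\<^esub>}. rep t x \<odot>\<^bsub>V\<^esub> G (fst x) (snd x))"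
  by (simp only: tlift_rep lin_ext_def)

lemma tlift_cong:
  assumes "t \<in> carrier T" "\<And>x y. x \<in> carrier M \<Longrightarrow> y \<in> carrier N \<Longrightarrow> G x y = G' x y"
  shows "tlift K V G t = tlift K V G' t"
  unfolding tlift_sum
  by (rule finsum_cong_unconditional) (use rep_finite(2)[OF assms(1)] assms(2) in force)

lemma summand_closed:
  assumes "module K V" "t \<in> carrier T" "\<And>x y. x \<in> carrier M \<Longrightarrow> y \<in> carrier N \<Longrightarrow> G x y \<in> carrier V"
    and "x \<in> {x. rep t x \<noteq> \<zero>\<^bsub>K\<^esub>}"
  shows "G (fst x) (snd x) \<in> carrier V" "rep t x \<odot>\<^bsub>V\<^esub> G (fst x) (snd x) \<in> carrier V"
proof -
  interpret V: module K V by fact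
  have "x \<in> carrier M \<times> carrier N" using assms(4) rep_finite(2)[OF assms(2)] by (rule set_rev_mp)
  then show g: "G (fst x) (snd x) \<in> carrier V" by (intro assms(3)) (simp_all add: mem_Times_iff)
  show "rep t x \<odot>\<^bsub>V\<^esub> G (fst x) (snd x) \<in> carrier V"
    by (intro V.smult_closed rep_finite(3)[OF assms(2)] g)
qed

lemma tlift_closed:
  assumes V: "module K V" and t: "t \<in> carrier T"
    and G: "\<And>x y. x \<in> carrier M \<Longrightarrow> y \<in> carrier N \<Longrightarrow> G x y \<in> carrier V"
  shows "tlift K V G t \<in> carrier V"
proof -
  interpret V: module K V by fact
  show ?thesis unfolding tlift_sum
    by (rule V.finsum_closed, rule Pi_I, rule summand_closed(2)[OF V t G])
qed

lemma tlift_apply: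
  assumes V: "module K V" and W: "module K W" and t: "t \<in> carrier T"
    and f: "lin_map K V W f"
    and G: "\<And>x y. x \<in> carrier M \<Longrightarrow> y \<in> carrier N \<Longrightarrow> G x y \<in> carrier V"
  shows "f (tlift K V G t) = tlift K W (\<lambda>x y. f (G x y)) t"
proof -
  interpret V: module K V by fact
  interpret P: lin_pair K V W f by (rule lin_pairI) fact+
  have "f (tlift K V G t) = (\<Oplus>\<^bsub>W\<^esub>x\<in>{x. rep t x \<noteq> \<zero>\<^bsub>K\<^esub>}. f (rep t x \<odot>\<^bsub>V\<^esub> G (fst x) (snd x)))"
    unfolding tlift_sum by (rule P.finsum, rule Pi_I, rule summand_closed(2)[OF V t G])
  also have "\<dots> = tlift K W (\<lambda>x y. f (G x y)) t"
    unfolding tlift_sum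
    by (rule finsum_cong_unconditional, rule lin_map_smult[OF f rep_finite(3)[OF t]])
       (rule summand_closed(1)[OF V t G])
  finally show ?thesis .
qed

lemma lin_tlift_param:
  assumes L: "module K L" and V: "module K V" and t: "t \<in> carrier T"
    and G: "\<And>x y. x \<in> carrier M \<Longrightarrow> y \<in> carrier N \<Longrightarrow> lin_map K L V (\<lambda>z. G z x y)"
  shows "lin_map K L V (\<lambda>z. tlift K V (G z) t)"
  unfolding tlift_sum
proof (rule lin_map_sum[OF L V rep_finite(1)[OF t]], rule lin_smult_vec[OF V rep_finite(3)[OF t]])
  fix x assume "x \<in> {x. rep t x \<noteq> \<zero>\<^bsub>K\<^esub>}"
  then have "x \<in> carrier M \<times> carrier N" using rep_finite(2)[OF t] by (rule set_rev_mp)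
  then show "lin_map K L V (\<lambda>z. G z (fst x) (snd x))" by (intro G) (simp_all add: mem_Times_iff)
qed

end

text \<open>Both sides are double sums over the two chosen representatives.\<close>

lemma tlift_swap:
  assumes T: "tensor K M N" and S: "tensor K P Q" and V: "module K V"
    and t: "t \<in> carrier (tensor_mod K M N)" and s: "s \<in> carrier (tensor_mod K P Q)"
    and G: "\<And>x y a b. x \<in> carrier M \<Longrightarrow> y \<in> carrier N \<Longrightarrow> a \<in> carrier P \<Longrightarrow> b \<in> carrier Q \<Longrightarrow>
      G x y a b \<in> carrier V"
  shows "tlift K V (\<lambda>x y. tlift K V (G x y) s) t = tlift K V (\<lambda>a b. tlift K V (\<lambda>x y. G x y a b) t) s"
proof -
  interpret T: tensor K M N by fact
  interpret S: tensor K P Q by fact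
  interpret V: module K V by fact
  let ?X = "{x. T.rep t x \<noteq> \<zero>\<^bsub>K\<^esub>}" and ?Y = "{x. S.rep s x \<noteq> \<zero>\<^bsub>K\<^esub>}"
  have cl: "G (fst x) (snd x) (fst y) (snd y) \<in> carrier V" if "x \<in> ?X" "y \<in> ?Y" for x y
  proof -
    have "x \<in> carrier M \<times> carrier N" using that(1) T.rep_finite(2)[OF t] by (rule set_rev_mp)
    moreover have "y \<in> carrier P \<times> carrier Q" using that(2) S.rep_finite(2)[OF s] by (rule set_rev_mp)
    ultimately show ?thesis by (intro G) (simp_all add: mem_Times_iff)
  qed
  note k = T.rep_finite(3)[OF t] S.rep_finite(3)[OF s]
  note fin = T.rep_finite(1)[OF t] S.rep_finite(1)[OF s]
  have "tlift K V (\<lambda>x y. tlift K V (G x y) s) t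
    = (\<Oplus>\<^bsub>V\<^esub>x\<in>?X. \<Oplus>\<^bsub>V\<^esub>y\<in>?Y. T.rep t x \<odot>\<^bsub>V\<^esub> (S.rep s y \<odot>\<^bsub>V\<^esub> G (fst x) (snd x) (fst y) (snd y)))"
    unfolding T.tlift_sum S.tlift_sum
    by (rule finsum_cong_unconditional, rule V.finsum_smult_ldistr[OF fin(2) k(1)], rule Pi_I,
        rule V.smult_closed[OF k(2)], rule cl)
  also have "\<dots> = (\<Oplus>\<^bsub>V\<^esub>y\<in>?Y. \<Oplus>\<^bsub>V\<^esub>x\<in>?X. T.rep t x \<odot>\<^bsub>V\<^esub> (S.rep s y \<odot>\<^bsub>V\<^esub> G (fst x) (snd x) (fst y) (snd y)))"
    by (rule V.finsum_swap[OF fin]) (intro V.smult_closed k cl)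
  also have "\<dots> = (\<Oplus>\<^bsub>V\<^esub>y\<in>?Y. \<Oplus>\<^bsub>V\<^esub>x\<in>?X. S.rep s y \<odot>\<^bsub>V\<^esub> (T.rep t x \<odot>\<^bsub>V\<^esub> G (fst x) (snd x) (fst y) (snd y)))"
    by (intro finsum_cong_unconditional)
       (simp only: V.smult_assoc1[symmetric] k cl T.M.R.m_comm)
  also have "\<dots> = tlift K V (\<lambda>a b. tlift K V (\<lambda>x y. G x y a b) t) s"
    unfolding T.tlift_sum S.tlift_sum
    by (rule finsum_cong_unconditional, rule V.finsum_smult_ldistr[OF fin(1) k(2), symmetric], rule Pi_I,
        rule V.smult_closed[OF k(1)], rule cl)
  finally show ?thesis .
qed

section \<open>Sweedler calculus\<close>

text \<open>
  The part of a coalgebra that Sweedler notation itself rests on. It is available for a new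
  comultiplication before the coalgebra laws have been established.
\<close>

definition has_comult :: "('k, 'm) ring_scheme \<Rightarrow> ('k, 'c, 'o) bialg_scheme \<Rightarrow> bool" where
  "has_comult K C \<longleftrightarrow> module K C \<and> lin_map K C (tensor_mod K C C) (comult C)"

lemma has_comult_module: "has_comult K C \<Longrightarrow> module K C"
  by (simp add: has_comult_def)

lemma has_comult_tensor: "has_comult K C \<Longrightarrow> tensor K C C"
  by (simp add: has_comult_def tensorI)

lemma comult_closed: "has_comult K C \<Longrightarrow> c \<in> carrier C \<Longrightarrow> comult C c \<in> carrier (tensor_mod K C C)"
  unfolding has_comult_def by (elim conjE) (rule lin_map_closed)

lemma coalgebra_has_comult: "coalgebra K C \<Longrightarrow> has_comult K C"
  by (simp add: has_comult_def coalgebra.comult_lin coalgebra.axioms(1))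

lemma coalgebra_module: "coalgebra K C \<Longrightarrow> module K C"
  by (rule coalgebra.axioms(1))

lemma sw_closed:
  assumes "has_comult K C" "module K V" "c \<in> carrier C"
    and "\<And>x y. x \<in> carrier C \<Longrightarrow> y \<in> carrier C \<Longrightarrow> G x y \<in> carrier V"
  shows "sweedler K V C c G \<in> carrier V"
  unfolding sweedler_def
  by (rule tensor.tlift_closed[OF has_comult_tensor _ comult_closed]) (use assms in simp_all)

lemma sw_cong:
  assumes "has_comult K C" "c \<in> carrier C"
    and "\<And>x y. x \<in> carrier C \<Longrightarrow> y \<in> carrier C \<Longrightarrow> G x y = G' x y"
  shows "sweedler K V C c G = sweedler K V C c G'"
  unfolding sweedler_def
  by (rule tensor.tlift_cong[OF has_comult_tensor comult_closed]) (use assms in simp_all)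

lemma lin_sw_param:
  assumes "has_comult K C" "module K L" "module K V" "c \<in> carrier C"
    and "\<And>x y. x \<in> carrier C \<Longrightarrow> y \<in> carrier C \<Longrightarrow> lin_map K L V (\<lambda>z. G z x y)"
  shows "lin_map K L V (\<lambda>z. sweedler K V C c (G z))"
  unfolding sweedler_def
  by (rule tensor.lin_tlift_param[OF has_comult_tensor _ _ comult_closed]) (use assms in simp_all)

lemma lin_sw_arg:
  assumes "has_comult K C" "module K V" "bilin_map K C C V G" "lin_map K L C f"
  shows "lin_map K L V (\<lambda>z. sweedler K V C (f z) G)"
proof -
  have "lin_map K L (tensor_mod K C C) (\<lambda>z. comult C (f z))"
    by (rule lin_map_compose[OF _ assms(4)]) (use assms(1) in \<open>simp add: has_comult_def\<close>)
  then show ?thesis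
    unfolding sweedler_def using assms by (intro lin_tlift_arg) (simp_all add: has_comult_module)
qed

lemma sw_apply:
  assumes "has_comult K C" "module K V" "module K W" "c \<in> carrier C" "lin_map K V W f"
    and "\<And>x y. x \<in> carrier C \<Longrightarrow> y \<in> carrier C \<Longrightarrow> G x y \<in> carrier V"
  shows "f (sweedler K V C c G) = sweedler K W C c (\<lambda>x y. f (G x y))"
  unfolding sweedler_def
  by (rule tensor.tlift_apply[OF has_comult_tensor _ _ comult_closed]) (use assms in simp_all)

lemma sw_swap:
  assumes "has_comult K C" "has_comult K D" "module K V" "c \<in> carrier C" "d \<in> carrier D"
    and "\<And>x y a b. x \<in> carrier C \<Longrightarrow> y \<in> carrier C \<Longrightarrow> a \<in> carrier D \<Longrightarrow> b \<in> carrier D \<Longrightarrow>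
      G x y a b \<in> carrier V"
  shows "sweedler K V C c (\<lambda>x y. sweedler K V D d (G x y))
    = sweedler K V D d (\<lambda>a b. sweedler K V C c (\<lambda>x y. G x y a b))"
  unfolding sweedler_def
  by (rule tlift_swap[OF has_comult_tensor has_comult_tensor _ comult_closed comult_closed])
     (use assms in simp_all)

lemma tlift_tens_self:
  assumes "module K M" "module K N" "t \<in> carrier (tensor_mod K M N)"
  shows "tlift K (tensor_mod K M N) (tens K M N) t = t"
proof -
  interpret tensor K M N using assms by (simp add: tensorI)
  show ?thesis
    by (rule tens_ext[OF T_module tlift_lin[OF T_module tens_bilin] lin_map_id _ assms(3)])
       (rule tlift_tens[OF T_module tens_bilin])
qed

lemma comult_sw: "has_comult K C \<Longrightarrow> c \<in> carrier C \<Longrightarrow>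
    comult C c = sweedler K (tensor_mod K C C) C c (tens K C C)"
  unfolding sweedler_def
  by (rule tlift_tens_self[symmetric]) (simp_all add: has_comult_module comult_closed)

lemma ground_simps [simp]:
  "carrier (ground K) = carrier K" "mult (ground K) = mult K" "one (ground K) = one K"
  "zero (ground K) = zero K" "add (ground K) = add K" "smult (ground K) = mult K"
  by (simp_all add: ground_def)

lemma ground_module: "cring K \<Longrightarrow> module K (ground K)"
proof -
  assume "cring K"
  then interpret cring K .
  have "\<exists>y\<in>carrier K. y \<oplus>\<^bsub>K\<^esub> x = \<zero>\<^bsub>K\<^esub>" if "x \<in> carrier K" for x
    using that l_neg a_inv_closed by blast
  then show ?thesis
    by (intro moduleI is_cring abelian_groupI) (simp_all add: a_ac m_assoc l_distr r_distr)
qed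

lemma module_cring: "module K M \<Longrightarrow> cring K"
  by (rule module.axioms(1))

lemma lin_smult_scal:
  assumes "module K V" "v \<in> carrier V" "lin_map K L (ground K) f"
  shows "lin_map K L V (\<lambda>x. f x \<odot>\<^bsub>V\<^esub> v)"
proof -
  interpret V: module K V by fact
  have "lin_map K (ground K) V (\<lambda>x. x \<odot>\<^bsub>V\<^esub> v)"
    by (rule lin_mapI) (use assms in \<open>simp_all add: V.smult_l_distr V.smult_assoc1\<close>)
  then show ?thesis by (rule lin_map_compose) fact
qed

lemma lin_scal_mult1:
  assumes "cring K" "k \<in> carrier K" "lin_map K L (ground K) f"
  shows "lin_map K L (ground K) (\<lambda>x. f x \<otimes>\<^bsub>K\<^esub> k)"
  using lin_smult_scal[OF ground_module[OF assms(1)], of k L f] assms by simp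

lemma lin_scal_mult2:
  assumes "cring K" "k \<in> carrier K" "lin_map K L (ground K) f"
  shows "lin_map K L (ground K) (\<lambda>x. k \<otimes>\<^bsub>K\<^esub> f x)"
  using lin_smult_vec[OF ground_module[OF assms(1)], of k L f] assms by simp

lemma lin_counit:
  "coalgebra K C \<Longrightarrow> lin_map K L C f \<Longrightarrow> lin_map K L (ground K) (\<lambda>x. counit C (f x))"
  by (rule lin_map_compose[OF coalgebra.counit_lin])

lemma lin_mult1:
  assumes "assoc_algebra K A" "b \<in> carrier A" "lin_map K L A f"
  shows "lin_map K L A (\<lambda>x. f x \<otimes>\<^bsub>A\<^esub> b)"
proof -
  interpret A: assoc_algebra K A by fact
  have "lin_map K A A (\<lambda>x. x \<otimes>\<^bsub>A\<^esub> b)"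
    by (rule lin_mapI) (use assms in \<open>simp_all add: A.l_distr A.smult_mult_left\<close>)
  then show ?thesis by (rule lin_map_compose) fact
qed

lemma lin_mult2:
  assumes "assoc_algebra K A" "a \<in> carrier A" "lin_map K L A f"
  shows "lin_map K L A (\<lambda>x. a \<otimes>\<^bsub>A\<^esub> f x)"
proof -
  interpret A: assoc_algebra K A by fact
  have "lin_map K A A (\<lambda>x. a \<otimes>\<^bsub>A\<^esub> x)"
    by (rule lin_mapI) (use assms in \<open>simp_all add: A.r_distr A.smult_mult_right\<close>)
  then show ?thesis by (rule lin_map_compose) fact
qed

lemmas lin_tlift_param = tensor.lin_tlift_param[OF tensorI]
lemmas tlift_cong = tensor.tlift_cong[OF tensorI]
lemmas tlift_apply = tensor.tlift_apply[OF tensorI]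
lemmas tens_ext = tensor.tens_ext[OF tensorI]

text \<open>
  Linearity in one variable of an expression is proved by applying such rules backwards. In a Sweedler
  expression every variable occurs once, so the outermost operation determines the rule.
\<close>

lemmas lin_basic = lin_map_id lin_tens1 lin_tens2 lin_smult_scal lin_smult_vec
  lin_scal_mult1 lin_scal_mult2 lin_counit lin_mult1 lin_mult2

lemmas lin_intros = lin_basic lin_sw_arg lin_sw_param

text \<open>
  Evaluating \<open>tmap\<close> and \<open>tassoc\<close> on the chosen representatives turns coassociativity into an identity of
  nested Sweedler expressions. This works in both directions: for using coassociativity and for
  establishing it.
\<close>

lemma
  assumes C: "has_comult K C" and c: "c \<in> carrier C"
  shows coassoc_lhs: "tassoc K C C C (tmap K (tensor_mod K C C) C (comult C) id (comult C c))
      = sweedler K (tensor_mod K C (tensor_mod K C C)) C c (\<lambda>x y.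
          sweedler K (tensor_mod K C (tensor_mod K C C)) C x (\<lambda>a b.
            tens K C (tensor_mod K C C) a (tens K C C b y)))" (is ?lhs)
    and coassoc_rhs: "tmap K C (tensor_mod K C C) id (comult C) (comult C c)
      = sweedler K (tensor_mod K C (tensor_mod K C C)) C c (\<lambda>x y.
          sweedler K (tensor_mod K C (tensor_mod K C C)) C y (\<lambda>a b.
            tens K C (tensor_mod K C C) x (tens K C C a b)))" (is ?rhs)
proof -
  let ?CC = "tensor_mod K C C"
  let ?W = "tensor_mod K C ?CC"
  let ?J = "\<lambda>s y. tlift K ?W (\<lambda>a b. tens K C ?CC a (tens K C C b y)) s"
  note [simp] = C c has_comult_module[OF C] tensor_module tens_closed comult_closed[OF C] tlift_tens
  note lins = bilin_mapI lin_tens1 lin_tens2 lin_map_id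
    lin_tlift_arg[where M = C and N = C] lin_tlift_param[where M = C and N = C]
  have J: "bilin_map K ?CC C ?W ?J"
    by (intro lins) simp_all
  have lJ: "lin_map K (tensor_mod K ?CC C) ?W (tlift K ?W ?J)"
    by (rule lin_tlift_arg[OF _ _ _ J lin_map_id]) simp_all
  have "tassoc K C C C (tmap K ?CC C (comult C) id (comult C c))
    = tlift K ?W ?J (tlift K (tensor_mod K ?CC C) (\<lambda>x y. tens K ?CC C (comult C x) (id y)) (comult C c))"
    by (simp add: tassoc_def tmap_def Let_def)
  also have "\<dots> = tlift K ?W (\<lambda>x y. tlift K ?W ?J (tens K ?CC C (comult C x) (id y))) (comult C c)"
    by (rule tlift_apply[where M = C and N = C]) (simp_all add: lJ)
  also have "\<dots> = tlift K ?W (\<lambda>x y. ?J (comult C x) y) (comult C c)"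
    by (rule tlift_cong[where M = C and N = C]) (simp_all add: J)
  finally show ?lhs by (simp add: sweedler_def)
  have "tmap K C ?CC id (comult C) (comult C c)
    = sweedler K ?W C c (\<lambda>x y. tens K C ?CC x (sweedler K ?CC C y (tens K C C)))"
    unfolding tmap_def sweedler_def
    by (rule tlift_cong[where M = C and N = C]) (simp_all add: tlift_tens_self)
  also have "\<dots> = sweedler K ?W C c (\<lambda>x y. sweedler K ?W C y (\<lambda>a b. tens K C ?CC x (tens K C C a b)))"
    by (rule sw_cong[OF C c], rule sw_apply[where f = "\<lambda>z. tens K C ?CC _ z"]) (simp_all add: lin_tens2 lin_map_id)
  finally show ?rhs .
qed

text \<open>
  A trilinear function factors through \<open>C \<otimes> (C \<otimes> C)\<close>, so it may be applied to both sides of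
  coassociativity.
\<close>

lemma sw_coassoc:
  assumes C: "coalgebra K C" and V: "module K V" and c: "c \<in> carrier C"
    and G1: "\<And>y z. y \<in> carrier C \<Longrightarrow> z \<in> carrier C \<Longrightarrow> lin_map K C V (\<lambda>x. G x y z)"
    and G2: "\<And>x z. x \<in> carrier C \<Longrightarrow> z \<in> carrier C \<Longrightarrow> lin_map K C V (\<lambda>y. G x y z)"
    and G3: "\<And>x y. x \<in> carrier C \<Longrightarrow> y \<in> carrier C \<Longrightarrow> lin_map K C V (\<lambda>z. G x y z)"
  shows "sweedler K V C c (\<lambda>x z. sweedler K V C x (\<lambda>a b. G a b z))
    = sweedler K V C c (\<lambda>x y. sweedler K V C y (\<lambda>a b. G x a b))"
proof -
  let ?CC = "tensor_mod K C C"
  let ?W = "tensor_mod K C ?CC"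
  let ?sw = "sweedler K V C" and ?swW = "sweedler K ?W C"
  let ?t = "tens K C C" and ?t2 = "tens K C ?CC"
  note [simp] = C c V coalgebra_has_comult[OF C] coalgebra_module[OF C] tensor_module tens_closed
    sw_closed
  let ?h = "tlift K V (\<lambda>x s. tlift K V (\<lambda>y z. G x y z) s)"
  have g: "bilin_map K C C V (G x)" if "x \<in> carrier C" for x
    using that by (intro bilin_mapI G2 G3)
  have b: "bilin_map K C ?CC V (\<lambda>x s. tlift K V (\<lambda>y z. G x y z) s)"
    by (intro bilin_mapI lin_tlift_arg[where M = C and N = C] lin_tlift_param[where M = C and N = C]
        g G1 lin_map_id) simp_all
  have h: "lin_map K ?W V ?h"
    by (rule lin_tlift_arg[where M = C and N = ?CC]) (simp_all add: b lin_map_id)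
  have ev: "?h (?t2 x (?t y z)) = G x y z"
    if "x \<in> carrier C" "y \<in> carrier C" "z \<in> carrier C" for x y z
    using that by (simp add: tlift_tens b g)
  have "?sw c (\<lambda>x z. ?sw x (\<lambda>a b. G a b z))
    = ?sw c (\<lambda>x z. ?sw x (\<lambda>a b. ?h (?t2 a (?t b z))))"
    by (intro sw_cong) (simp_all add: ev)
  also have "\<dots> = ?sw c (\<lambda>x z. ?h (?swW x (\<lambda>a b. ?t2 a (?t b z))))"
    by (intro sw_cong sw_apply[symmetric] h) simp_all
  also have "\<dots> = ?h (?swW c (\<lambda>x z. ?swW x (\<lambda>a b. ?t2 a (?t b z))))"
    by (intro sw_apply[symmetric] h) simp_all
  also have "\<dots> = ?h (?swW c (\<lambda>x y. ?swW y (\<lambda>a b. ?t2 x (?t a b))))"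
    using coalgebra.coassoc[OF C c] coassoc_lhs[of K C c] coassoc_rhs[of K C c] by simp
  also have "\<dots> = ?sw c (\<lambda>x y. ?h (?swW y (\<lambda>a b. ?t2 x (?t a b))))"
    by (intro sw_apply h) simp_all
  also have "\<dots> = ?sw c (\<lambda>x y. ?sw y (\<lambda>a b. ?h (?t2 x (?t a b))))"
    by (intro sw_cong sw_apply h) simp_all
  also have "\<dots> = ?sw c (\<lambda>x y. ?sw y (\<lambda>a b. G x a b))"
    by (intro sw_cong) (simp_all add: ev)
  finally show ?thesis .
qed

lemma sw_counit_left:
  assumes C: "coalgebra K C" and V: "module K V" and c: "c \<in> carrier C" and f: "lin_map K C V f"
  shows "sweedler K V C c (\<lambda>x y. counit C x \<odot>\<^bsub>V\<^esub> f y) = f c"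
proof -
  note [simp] = C c V coalgebra_has_comult[OF C] coalgebra_module[OF C] lin_map_closed[OF f]
    module.smult_closed[OF V] module.smult_closed[OF coalgebra_module[OF C]]
  have e: "counit C x \<in> carrier K" if "x \<in> carrier C" for x
    using lin_map_closed[OF coalgebra.counit_lin[OF C] that] by simp
  have "sweedler K V C c (\<lambda>x y. counit C x \<odot>\<^bsub>V\<^esub> f y) = sweedler K V C c (\<lambda>x y. f (counit C x \<odot>\<^bsub>C\<^esub> y))"
    by (rule sw_cong) (simp_all add: lin_map_smult[OF f e])
  also have "\<dots> = f (sweedler K C C c (\<lambda>x y. counit C x \<odot>\<^bsub>C\<^esub> y))"
    by (rule sw_apply[symmetric]) (simp_all add: f e)
  finally show ?thesis by (simp add: coalgebra.counit_left[OF C])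
qed

lemma sw_counit_right:
  assumes C: "coalgebra K C" and V: "module K V" and c: "c \<in> carrier C" and f: "lin_map K C V f"
  shows "sweedler K V C c (\<lambda>x y. counit C y \<odot>\<^bsub>V\<^esub> f x) = f c"
proof -
  note [simp] = C c V coalgebra_has_comult[OF C] coalgebra_module[OF C] lin_map_closed[OF f]
    module.smult_closed[OF V] module.smult_closed[OF coalgebra_module[OF C]]
  have e: "counit C x \<in> carrier K" if "x \<in> carrier C" for x
    using lin_map_closed[OF coalgebra.counit_lin[OF C] that] by simp
  have "sweedler K V C c (\<lambda>x y. counit C y \<odot>\<^bsub>V\<^esub> f x) = sweedler K V C c (\<lambda>x y. f (counit C y \<odot>\<^bsub>C\<^esub> x))"
    by (rule sw_cong) (simp_all add: lin_map_smult[OF f e])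
  also have "\<dots> = f (sweedler K C C c (\<lambda>x y. counit C y \<odot>\<^bsub>C\<^esub> x))"
    by (rule sw_apply[symmetric]) (simp_all add: f e)
  finally show ?thesis by (simp add: coalgebra.counit_right[OF C])
qed

lemma coalg_hom_lin: "coalg_hom K C D f \<Longrightarrow> lin_map K C D f"
  by (simp add: coalg_hom_def)

lemma tmap_comult_sw:
  assumes C: "has_comult K C"
  shows "tmap K D E f g (comult C c) = sweedler K (tensor_mod K D E) C c (\<lambda>x y. tens K D E (f x) (g y))"
  by (simp add: tmap_def sweedler_def)

lemma sw_coalg_hom:
  assumes C: "has_comult K C" and D: "has_comult K D" and V: "module K V"
    and f: "coalg_hom K C D f" and c: "c \<in> carrier C" and G: "bilin_map K D D V G"
  shows "sweedler K V D (f c) G = sweedler K V C c (\<lambda>x y. G (f x) (f y))"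
proof -
  note [simp] = C D c V has_comult_module[OF C] has_comult_module[OF D] tensor_module tens_closed
    lin_map_closed[OF coalg_hom_lin[OF f]]
  let ?T = "tensor_mod K D D"
  have "comult D (f c) = sweedler K ?T C c (\<lambda>x y. tens K D D (f x) (f y))"
    using f c tmap_comult_sw[OF C] unfolding coalg_hom_def by metis
  then have "sweedler K V D (f c) G = tlift K V G (sweedler K ?T C c (\<lambda>x y. tens K D D (f x) (f y)))"
    by (simp add: sweedler_def[of K V D])
  also have "\<dots> = sweedler K V C c (\<lambda>x y. tlift K V G (tens K D D (f x) (f y)))"
    by (rule sw_apply, intro C) (auto intro!: lin_tlift_arg G lin_map_id)
  also have "\<dots> = sweedler K V C c (\<lambda>x y. G (f x) (f y))"
    by (rule sw_cong) (simp_all add: tlift_tens G)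
  finally show ?thesis .
qed

text \<open>
  Since \<open>tens\<close> is the universal bilinear map, compatibility with the comultiplications only has to be
  checked for it.
\<close>

lemma coalg_homI:
  assumes C: "has_comult K C" and D: "has_comult K D" and f: "lin_map K C D f"
    and com: "\<And>c. c \<in> carrier C \<Longrightarrow> sweedler K (tensor_mod K D D) D (f c) (tens K D D)
      = sweedler K (tensor_mod K D D) C c (\<lambda>x y. tens K D D (f x) (f y))"
    and eps: "\<And>c. c \<in> carrier C \<Longrightarrow> counit D (f c) = counit C c"
  shows "coalg_hom K C D f"
  unfolding coalg_hom_def
  using f com eps by (simp add: comult_sw[OF D lin_map_closed[OF f]] tmap_comult_sw[OF C])

lemma coalg_hom_compose:
  assumes C: "has_comult K C" and D: "has_comult K D" and E: "has_comult K E"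
    and f: "coalg_hom K C D f" and g: "coalg_hom K D E g"
  shows "coalg_hom K C E (\<lambda>x. g (f x))"
proof -
  note [simp] = C D E has_comult_module[OF C] has_comult_module[OF D] has_comult_module[OF E]
    tensor_module lin_map_closed[OF coalg_hom_lin[OF f]] lin_map_closed[OF coalg_hom_lin[OF g]]
  show ?thesis
  proof (rule coalg_homI)
    show "lin_map K C E (\<lambda>x. g (f x))"
      by (rule lin_map_compose[OF coalg_hom_lin[OF g] coalg_hom_lin[OF f]])
    show "counit E (g (f c)) = counit C c" if "c \<in> carrier C" for c
      using f g that by (simp add: coalg_hom_def)
    fix c assume c: "c \<in> carrier C"
    let ?T = "tensor_mod K E E"
    have "sweedler K ?T E (g (f c)) (tens K E E) = sweedler K ?T D (f c) (\<lambda>x y. tens K E E (g x) (g y))"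
      using c lin_map_closed[OF coalg_hom_lin[OF f] c]
      by (intro sw_coalg_hom g bilin_mapI lin_tens1 lin_tens2 lin_map_id) simp_all
    also have "\<dots> = sweedler K ?T C c (\<lambda>x y. tens K E E (g (f x)) (g (f y)))"
      using c coalg_hom_lin[OF g] by (intro sw_coalg_hom f bilin_mapI lin_tens1 lin_tens2) simp_all
    finally show "sweedler K ?T E (g (f c)) (tens K E E)
      = sweedler K ?T C c (\<lambda>x y. tens K E E (g (f x)) (g (f y)))" .
  qed simp_all
qed

section \<open>Bialgebras and tensor products of coalgebras\<close>

text \<open>
  Tensor products of coalgebras and smash products have the underlying space of a tensor product, but
  as records they have different types; this relation takes the place of equality of the spaces.
\<close>

definition same_space :: "('k, 'a, 'n) module_scheme \<Rightarrow> ('k, 'a, 'o) module_scheme \<Rightarrow> bool" where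
  "same_space M N \<longleftrightarrow> carrier M = carrier N \<and> add M = add N \<and> zero M = zero N \<and> smult M = smult N"

context
  fixes M :: "('k, 'a, 'n) module_scheme" and N :: "('k, 'a, 'o) module_scheme"
  assumes same: "same_space M N"
begin

lemma same_carrier: "carrier M = carrier N"
  using same by (simp add: same_space_def)

lemma same_smult: "smult M = smult N"
  using same by (simp add: same_space_def)

lemma same_add: "add M = add N"
  using same by (simp add: same_space_def)

lemma same_lin_dom: "lin_map K M V f \<longleftrightarrow> lin_map K N V f"
  using same by (simp add: same_space_def lin_map_def)

lemma same_lin_cod: "lin_map K V M f \<longleftrightarrow> lin_map K V N f"
  using same by (simp add: same_space_def lin_map_def)

lemma same_tlift: "tlift K M = tlift K N"
  using same by (intro ext) (simp add: same_space_def tlift_def finsum_def finprod_def Let_def)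

lemma same_sweedler: "sweedler K M = sweedler K N"
  by (intro ext) (simp add: sweedler_def same_tlift)

lemma same_module: assumes "module K N" shows "module K M"
proof -
  interpret N: module K N by fact
  have eq: "carrier M = carrier N" "add M = add N" "zero M = zero N" "smult M = smult N"
    using same by (simp_all add: same_space_def)
  have "\<exists>y\<in>carrier N. y \<oplus>\<^bsub>N\<^esub> x = \<zero>\<^bsub>N\<^esub>" if "x \<in> carrier N" for x
    using that N.M.l_neg N.M.a_inv_closed by blast
  then show ?thesis
    by (intro moduleI abelian_groupI N.R.is_cring)
       (simp_all add: eq N.smult_l_distr N.smult_r_distr N.smult_assoc1 N.M.a_ac)
qed

end

context
  fixes M :: "('k, 'a, 'n) module_scheme" and N :: "('k, 'a, 'o) module_scheme"
    and M' :: "('k, 'b, 'p) module_scheme" and N' :: "('k, 'b, 'q) module_scheme"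
  assumes same: "same_space M N" and same': "same_space M' N'"
begin

lemma same_tensor_free: "tensor_free K M M' = tensor_free K N N'"
  using same same' by (simp add: same_space_def tensor_free_def)

lemma same_tensor_null: "tensor_null K M M' = tensor_null K N N'"
  using same same' unfolding tensor_null_def tensor_rels_def same_tensor_free
  by (simp add: same_space_def)

lemma same_tensor: "tensor_mod K M M' = tensor_mod K N N'"
  by (simp add: tensor_mod_def same_tensor_free same_tensor_null)

lemma same_tens: "tens K M M' = tens K N N'"
  by (intro ext) (simp add: tens_def same_tensor_free same_tensor_null)

end

lemma same_refl: "same_space M M"
  by (simp add: same_space_def)

lemma tensor_alg_same: "same_space (tensor_alg K M N) (tensor_mod K M N)"
  by (simp add: same_space_def tensor_alg_def Let_def)

lemma bialgebra_algebra: "bialgebra K A \<Longrightarrow> assoc_algebra K A"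
  by (rule bialgebra.axioms(1))

lemma bialgebra_coalgebra: "bialgebra K A \<Longrightarrow> coalgebra K A"
  by (rule bialgebra.axioms(2))

lemma tensor_alg_comult_mult:
  "comult A x \<otimes>\<^bsub>tensor_alg K A A\<^esub> comult A y
    = sweedler K (tensor_mod K A A) A x (\<lambda>x1 x2. sweedler K (tensor_mod K A A) A y (\<lambda>y1 y2.
        tens K A A (x1 \<otimes>\<^bsub>A\<^esub> y1) (x2 \<otimes>\<^bsub>A\<^esub> y2)))"
  by (simp add: tensor_alg_def Let_def sweedler_def)

lemma
  assumes A: "bialgebra K A" and V: "module K V" and G: "bilin_map K A A V G"
  shows sw_mult: "x \<in> carrier A \<Longrightarrow> y \<in> carrier A \<Longrightarrow> sweedler K V A (x \<otimes>\<^bsub>A\<^esub> y) G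
      = sweedler K V A x (\<lambda>x1 x2. sweedler K V A y (\<lambda>y1 y2. G (x1 \<otimes>\<^bsub>A\<^esub> y1) (x2 \<otimes>\<^bsub>A\<^esub> y2)))"
    and sw_one: "sweedler K V A \<one>\<^bsub>A\<^esub> G = G \<one>\<^bsub>A\<^esub> \<one>\<^bsub>A\<^esub>"
proof -
  interpret A: bialgebra K A by fact
  have C: "coalgebra K A" by (rule bialgebra_coalgebra[OF A])
  note [simp] = V coalgebra_has_comult[OF C] coalgebra_module[OF C] tensor_module tens_closed sw_closed
  let ?T = "tensor_mod K A A"
  have L: "lin_map K ?T V (tlift K V G)"
    by (rule lin_tlift_arg[where M = A and N = A and f = "\<lambda>x. x"]) (simp_all add: G lin_map_id)
  have ev: "tlift K V G (tens K A A a b) = G a b" if "a \<in> carrier A" "b \<in> carrier A" for a b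
    using that by (simp add: tlift_tens G)
  show "sweedler K V A \<one>\<^bsub>A\<^esub> G = G \<one>\<^bsub>A\<^esub> \<one>\<^bsub>A\<^esub>"
    using A.comult_alg_hom unfolding sweedler_def alg_hom_def
    by (simp add: tensor_alg_def Let_def ev)
  fix x y assume xy: "x \<in> carrier A" "y \<in> carrier A"
  note [simp] = xy
  have "sweedler K V A (x \<otimes>\<^bsub>A\<^esub> y) G = tlift K V G (comult A x \<otimes>\<^bsub>tensor_alg K A A\<^esub> comult A y)"
    using A.comult_alg_hom unfolding sweedler_def alg_hom_def by simp
  also have "\<dots> = sweedler K V A x (\<lambda>x1 x2. tlift K V G (sweedler K ?T A y (\<lambda>y1 y2.
        tens K A A (x1 \<otimes>\<^bsub>A\<^esub> y1) (x2 \<otimes>\<^bsub>A\<^esub> y2))))"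
    unfolding tensor_alg_comult_mult by (intro sw_apply L) simp_all
  also have "\<dots> = sweedler K V A x (\<lambda>x1 x2. sweedler K V A y (\<lambda>y1 y2.
        tlift K V G (tens K A A (x1 \<otimes>\<^bsub>A\<^esub> y1) (x2 \<otimes>\<^bsub>A\<^esub> y2))))"
    by (intro sw_cong sw_apply L) simp_all
  also have "\<dots> = sweedler K V A x (\<lambda>x1 x2. sweedler K V A y (\<lambda>y1 y2. G (x1 \<otimes>\<^bsub>A\<^esub> y1) (x2 \<otimes>\<^bsub>A\<^esub> y2)))"
    by (intro sw_cong) (simp_all add: ev)
  finally show "sweedler K V A (x \<otimes>\<^bsub>A\<^esub> y) G = \<dots>" .
qed

lemma counit_closed: "coalgebra K C \<Longrightarrow> c \<in> carrier C \<Longrightarrow> counit C c \<in> carrier K"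
  using lin_map_closed[OF coalgebra.counit_lin] by fastforce

lemma counit_mult:
  "bialgebra K A \<Longrightarrow> x \<in> carrier A \<Longrightarrow> y \<in> carrier A \<Longrightarrow>
    counit A (x \<otimes>\<^bsub>A\<^esub> y) = counit A x \<otimes>\<^bsub>K\<^esub> counit A y"
  using bialgebra.counit_alg_hom by (fastforce simp: alg_hom_def)

lemma counit_one: "bialgebra K A \<Longrightarrow> counit A \<one>\<^bsub>A\<^esub> = \<one>\<^bsub>K\<^esub>"
  using bialgebra.counit_alg_hom by (fastforce simp: alg_hom_def)

lemma bialgebraI:
  assumes A: "assoc_algebra K A" and C: "coalgebra K A"
    and com: "\<And>x y. x \<in> carrier A \<Longrightarrow> y \<in> carrier A \<Longrightarrow>
      sweedler K (tensor_mod K A A) A (x \<otimes>\<^bsub>A\<^esub> y) (tens K A A)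
      = sweedler K (tensor_mod K A A) A x (\<lambda>x1 x2. sweedler K (tensor_mod K A A) A y (\<lambda>y1 y2.
        tens K A A (x1 \<otimes>\<^bsub>A\<^esub> y1) (x2 \<otimes>\<^bsub>A\<^esub> y2)))"
    and com1: "comult A \<one>\<^bsub>A\<^esub> = tens K A A \<one>\<^bsub>A\<^esub> \<one>\<^bsub>A\<^esub>"
    and eps: "\<And>x y. x \<in> carrier A \<Longrightarrow> y \<in> carrier A \<Longrightarrow>
      counit A (x \<otimes>\<^bsub>A\<^esub> y) = counit A x \<otimes>\<^bsub>K\<^esub> counit A y"
    and eps1: "counit A \<one>\<^bsub>A\<^esub> = \<one>\<^bsub>K\<^esub>"
  shows "bialgebra K A"
proof -
  interpret A: assoc_algebra K A by fact
  interpret C: coalgebra K A by fact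
  have "comult A (x \<otimes>\<^bsub>A\<^esub> y) = comult A x \<otimes>\<^bsub>tensor_alg K A A\<^esub> comult A y"
    if "x \<in> carrier A" "y \<in> carrier A" for x y
    using that comult_sw[OF coalgebra_has_comult[OF C], of "x \<otimes>\<^bsub>A\<^esub> y"] com[OF that]
    unfolding tensor_alg_comult_mult by simp
  moreover have "\<one>\<^bsub>tensor_alg K A A\<^esub> = tens K A A \<one>\<^bsub>A\<^esub> \<one>\<^bsub>A\<^esub>"
    by (simp add: tensor_alg_def Let_def)
  ultimately show ?thesis
    by (intro bialgebra.intro bialgebra_axioms.intro A C)
       (simp_all add: alg_hom_def same_lin_cod[OF tensor_alg_same] C.comult_lin C.counit_lin
         com1 eps eps1)
qed

lemma tensor_coalg_same: "same_space (tensor_coalg K C D) (tensor_mod K C D)"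
  by (simp add: same_space_def tensor_coalg_def Let_def module.defs)

locale coalg_pair = C: coalgebra K C + D: coalgebra K D
  for K and C :: "('k, 'c, 'o) bialg_scheme" and D :: "('k, 'd, 'q) bialg_scheme"
begin

abbreviation CD where "CD \<equiv> tensor_mod K C D"
abbreviation P where "P \<equiv> tensor_coalg K C D"

lemma C: "coalgebra K C" and D: "coalgebra K D"
  by (rule C.coalgebra_axioms, rule D.coalgebra_axioms)

lemmas base = C D coalgebra_has_comult[OF C] coalgebra_has_comult[OF D] coalgebra_module[OF C]
  coalgebra_module[OF D] tensor_module[OF coalgebra_module[OF C] coalgebra_module[OF D]]
  tensor_module tens_closed sw_closed counit_closed[OF C] counit_closed[OF D]
  module_cring[OF coalgebra_module[OF C]] ground_module

lemmas P_simps = same_carrier[OF tensor_coalg_same] same_lin_dom[OF tensor_coalg_same]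
  same_lin_cod[OF tensor_coalg_same] same_tlift[OF tensor_coalg_same]
  same_sweedler[OF tensor_coalg_same] same_tensor[OF tensor_coalg_same tensor_coalg_same]
  same_tens[OF tensor_coalg_same tensor_coalg_same] same_smult[OF tensor_coalg_same]

lemma P_comult: "comult P = tlift K (tensor_mod K CD CD) (\<lambda>c d.
    sweedler K (tensor_mod K CD CD) C c (\<lambda>c1 c2. sweedler K (tensor_mod K CD CD) D d (\<lambda>d1 d2.
      tens K CD CD (tens K C D c1 d1) (tens K C D c2 d2))))"
  by (simp add: tensor_coalg_def Let_def module.defs bialg.defs)

lemma P_counit: "counit P = tlift K (ground K) (\<lambda>c d. counit C c \<otimes>\<^bsub>K\<^esub> counit D d)"
  by (simp add: tensor_coalg_def Let_def module.defs bialg.defs)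

lemma P_module: "module K P"
  by (rule same_module[OF tensor_coalg_same]) (simp add: base)

lemma comult_bilin:
  assumes V: "module K V"
    and G1: "\<And>c2 d1 d2. c2 \<in> carrier C \<Longrightarrow> d1 \<in> carrier D \<Longrightarrow> d2 \<in> carrier D \<Longrightarrow>
      lin_map K C V (\<lambda>c1. G c1 d1 c2 d2)"
    and G2: "\<And>c1 d1 d2. c1 \<in> carrier C \<Longrightarrow> d1 \<in> carrier D \<Longrightarrow> d2 \<in> carrier D \<Longrightarrow>
      lin_map K C V (\<lambda>c2. G c1 d1 c2 d2)"
    and G3: "\<And>c1 c2 d2. c1 \<in> carrier C \<Longrightarrow> c2 \<in> carrier C \<Longrightarrow> d2 \<in> carrier D \<Longrightarrow>
      lin_map K D V (\<lambda>d1. G c1 d1 c2 d2)"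
    and G4: "\<And>c1 c2 d1. c1 \<in> carrier C \<Longrightarrow> c2 \<in> carrier C \<Longrightarrow> d1 \<in> carrier D \<Longrightarrow>
      lin_map K D V (\<lambda>d2. G c1 d1 c2 d2)"
  shows "bilin_map K C D V (\<lambda>c d. sweedler K V C c (\<lambda>c1 c2. sweedler K V D d (\<lambda>d1 d2. G c1 d1 c2 d2)))"
  by (intro bilin_mapI lin_intros G1 G2 G3 G4) (simp_all add: base V)

lemma comult_bilin_tens: "bilin_map K C D (tensor_mod K CD CD) (\<lambda>c d.
    sweedler K (tensor_mod K CD CD) C c (\<lambda>c1 c2. sweedler K (tensor_mod K CD CD) D d (\<lambda>d1 d2.
      tens K CD CD (tens K C D c1 d1) (tens K C D c2 d2))))"
  by (rule comult_bilin) (intro lin_intros | simp add: base)+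

lemma P_has_comult: "has_comult K P"
  unfolding has_comult_def P_simps P_comult
  by (intro conjI P_module lin_tlift_arg[where M = C and N = D and f = "\<lambda>x. x"] comult_bilin_tens lin_map_id)
     (simp_all add: base)

lemma sw_tensor:
  assumes V: "module K V" and G: "bilin_map K CD CD V G"
    and c: "c \<in> carrier C" and d: "d \<in> carrier D"
  shows "sweedler K V P (tens K C D c d) G
    = sweedler K V C c (\<lambda>c1 c2. sweedler K V D d (\<lambda>d1 d2. G (tens K C D c1 d1) (tens K C D c2 d2)))"
proof -
  note [simp] = base V c d
  let ?W = "tensor_mod K CD CD"
  let ?t = "tens K CD CD"
  let ?C = "sweedler K V C" and ?D = "sweedler K V D" and ?CW = "sweedler K ?W C" and ?DW = "sweedler K ?W D"
  have L: "lin_map K ?W V (tlift K V G)"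
    by (rule lin_tlift_arg[where M = CD and N = CD and f = "\<lambda>x. x"]) (simp_all add: G lin_map_id)
  have "sweedler K V P (tens K C D c d) G = tlift K V G (?CW c (\<lambda>c1 c2. ?DW d (\<lambda>d1 d2.
      ?t (tens K C D c1 d1) (tens K C D c2 d2))))"
    unfolding sweedler_def[of K V P] P_comult by (subst tlift_tens[OF _ _ _ comult_bilin_tens]) simp_all
  also have "\<dots> = ?C c (\<lambda>c1 c2. tlift K V G (?DW d (\<lambda>d1 d2.
      ?t (tens K C D c1 d1) (tens K C D c2 d2))))"
    by (intro sw_apply L) simp_all
  also have "\<dots> = ?C c (\<lambda>c1 c2. ?D d (\<lambda>d1 d2. tlift K V G
      (?t (tens K C D c1 d1) (tens K C D c2 d2))))"
    by (intro sw_cong sw_apply L) simp_all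
  also have "\<dots> = ?C c (\<lambda>c1 c2. ?D d (\<lambda>d1 d2. G (tens K C D c1 d1) (tens K C D c2 d2)))"
    by (intro sw_cong) (simp_all add: tlift_tens G)
  finally show ?thesis .
qed

lemma counit_bilin: "bilin_map K C D (ground K) (\<lambda>c d. counit C c \<otimes>\<^bsub>K\<^esub> counit D d)"
  by (intro bilin_mapI lin_intros) (simp_all add: base)

lemma counit_tens:
  "c \<in> carrier C \<Longrightarrow> d \<in> carrier D \<Longrightarrow> counit P (tens K C D c d) = counit C c \<otimes>\<^bsub>K\<^esub> counit D d"
  unfolding P_counit by (rule tlift_tens[OF _ _ _ counit_bilin]) (simp_all add: base)

lemma P_counit_lin: "lin_map K CD (ground K) (counit P)"
  unfolding P_counit
  by (rule lin_tlift_arg[where M = C and N = D and f = "\<lambda>x. x"]) (simp_all add: base counit_bilin lin_map_id)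

lemma P_counit_compose: "lin_map K L CD f \<Longrightarrow> lin_map K L (ground K) (\<lambda>x. counit P (f x))"
  by (rule lin_map_compose[OF P_counit_lin])

lemma P_counit_closed: "t \<in> carrier CD \<Longrightarrow> counit P t \<in> carrier K"
  using lin_map_closed[OF P_counit_lin] by simp

lemma lin_sw_P:
  "module K V \<Longrightarrow> bilin_map K CD CD V G \<Longrightarrow> lin_map K L CD f \<Longrightarrow>
    lin_map K L V (\<lambda>z. sweedler K V P (f z) G)"
  using lin_sw_arg[OF P_has_comult, of V G L f] by (simp add: P_simps bilin_map_def)

lemma lin_sw_P_param:
  "module K L \<Longrightarrow> module K V \<Longrightarrow> t \<in> carrier CD \<Longrightarrow>
    (\<And>x y. x \<in> carrier CD \<Longrightarrow> y \<in> carrier CD \<Longrightarrow> lin_map K L V (\<lambda>z. G z x y)) \<Longrightarrow>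
    lin_map K L V (\<lambda>z. sweedler K V P t (G z))"
  using lin_sw_param[OF P_has_comult, of L V t G] by (simp add: P_simps)

lemmas lin_CD_sw = lin_sw_P lin_sw_P_param lin_sw_arg[of K C] lin_sw_param[of K C]
  lin_sw_arg[of K D] lin_sw_param[of K D]

text \<open>
  On a pure tensor, the expansions of the two factors are separated from each other, and then
  coassociativity of \<open>C\<close> and of \<open>D\<close> is used once each.
\<close>

lemma P_coassoc:
  assumes t: "t \<in> carrier CD"
  defines "W \<equiv> tensor_mod K CD (tensor_mod K CD CD)"
  shows "sweedler K W P t (\<lambda>x y. sweedler K W P x (\<lambda>a b. tens K CD (tensor_mod K CD CD) a (tens K CD CD b y)))
    = sweedler K W P t (\<lambda>x y. sweedler K W P y (\<lambda>a b. tens K CD (tensor_mod K CD CD) x (tens K CD CD a b)))"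
proof -
  let ?CC = "tensor_mod K CD CD"
  let ?t = "tens K CD CD" and ?t2 = "tens K CD ?CC"
  let ?P = "sweedler K W P" and ?C = "sweedler K W C" and ?D = "sweedler K W D"
  let ?E = "\<lambda>c1 d1 c2 d2 c3 d3. ?t2 (tens K C D c1 d1) (?t (tens K C D c2 d2) (tens K C D c3 d3))"
  note [simp] = base
  have [simp]: "module K W" by (simp add: W_def)
  note lW = lin_tens1[where K = K and M = CD and N = ?CC, folded W_def] lin_tens2[where K = K and M = CD and N = ?CC, folded W_def]
  have [simp]: "?t2 a b \<in> carrier W" if "a \<in> carrier CD" "b \<in> carrier ?CC" for a b
    using that by (simp add: W_def)
  note lins = bilin_mapI lW lin_CD_sw lin_basic
  show ?thesis
  proof (rule tens_ext[where V = W and f = "\<lambda>t. ?P t (\<lambda>x y. ?P x (\<lambda>a b. ?t2 a (?t b y)))"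
       and g = "\<lambda>t. ?P t (\<lambda>x y. ?P y (\<lambda>a b. ?t2 x (?t a b)))", OF _ _ _ _ _ _ t])
    fix c d assume [simp]: "c \<in> carrier C" "d \<in> carrier D"
    have "?P (tens K C D c d) (\<lambda>x y. ?P x (\<lambda>a b. ?t2 a (?t b y)))
      = ?C c (\<lambda>c1 c2. ?D d (\<lambda>d1 d2.
          ?P (tens K C D c1 d1) (\<lambda>a b. ?t2 a (?t b (tens K C D c2 d2)))))"
      by (rule sw_tensor) ((intro lins)?; simp)+
    also have "\<dots> = ?C c (\<lambda>c1 c2. ?D d (\<lambda>d1 d2.
          ?C c1 (\<lambda>c11 c12. ?D d1 (\<lambda>d11 d12. ?E c11 d11 c12 d12 c2 d2))))"
      by (intro sw_cong sw_tensor lins) simp_all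
    also have "\<dots> = ?C c (\<lambda>c1 c2. ?C c1 (\<lambda>c11 c12. ?D d (\<lambda>d1 d2.
          ?D d1 (\<lambda>d11 d12. ?E c11 d11 c12 d12 c2 d2))))"
      by (intro sw_cong sw_swap) simp_all
    also have "\<dots> = ?C c (\<lambda>c1 c2. ?C c2 (\<lambda>c21 c22. ?D d (\<lambda>d1 d2.
          ?D d1 (\<lambda>d11 d12. ?E c1 d11 c21 d12 c22 d2))))"
      by (rule sw_coassoc) ((intro lins)?; simp)+
    also have "\<dots> = ?C c (\<lambda>c1 c2. ?C c2 (\<lambda>c21 c22. ?D d (\<lambda>d1 d2.
          ?D d2 (\<lambda>d21 d22. ?E c1 d1 c21 d21 c22 d22))))"
      by (intro sw_cong sw_coassoc lins) simp_all
    also have "\<dots> = ?C c (\<lambda>c1 c2. ?D d (\<lambda>d1 d2. ?C c2 (\<lambda>c21 c22.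
          ?D d2 (\<lambda>d21 d22. ?E c1 d1 c21 d21 c22 d22))))"
      by (intro sw_cong sw_swap) simp_all
    also have "\<dots> = ?C c (\<lambda>c1 c2. ?D d (\<lambda>d1 d2.
          ?P (tens K C D c2 d2) (\<lambda>a b. ?t2 (tens K C D c1 d1) (?t a b))))"
      by (intro sw_cong sw_tensor[symmetric] lins) simp_all
    also have "\<dots> = ?P (tens K C D c d) (\<lambda>x y. ?P y (\<lambda>a b. ?t2 x (?t a b)))"
      by (rule sw_tensor[symmetric]) ((intro lins)?; simp)+
    finally show "?P (tens K C D c d) (\<lambda>x y. ?P x (\<lambda>a b. ?t2 a (?t b y)))
      = ?P (tens K C D c d) (\<lambda>x y. ?P y (\<lambda>a b. ?t2 x (?t a b)))" .
  qed ((intro lins)?; simp)+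
qed

lemma tens_smult1: "k \<in> carrier K \<Longrightarrow> c \<in> carrier C \<Longrightarrow> d \<in> carrier D \<Longrightarrow>
    tens K C D (k \<odot>\<^bsub>C\<^esub> c) d = k \<odot>\<^bsub>CD\<^esub> tens K C D c d"
  by (rule lin_map_smult[OF lin_tens1[OF _ _ _ lin_map_id]]) (simp_all add: base)

lemma tens_smult2: "k \<in> carrier K \<Longrightarrow> c \<in> carrier C \<Longrightarrow> d \<in> carrier D \<Longrightarrow>
    tens K C D c (k \<odot>\<^bsub>D\<^esub> d) = k \<odot>\<^bsub>CD\<^esub> tens K C D c d"
  by (rule lin_map_smult[OF lin_tens2[OF _ _ _ lin_map_id]]) (simp_all add: base)

text \<open>
  The two factors are contracted independently of each other, each on the left or on the right. This
  covers the counit laws of \<open>C \<otimes> D\<close> as well as the recombination of a tensor from its components.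
\<close>

lemma tensor_of_counits:
  assumes c: "c \<in> carrier C" and d: "d \<in> carrier D"
    and f: "sweedler K C C c f = c" "\<And>x y. x \<in> carrier C \<Longrightarrow> y \<in> carrier C \<Longrightarrow> f x y \<in> carrier C"
    and g: "sweedler K D D d g = d" "\<And>x y. x \<in> carrier D \<Longrightarrow> y \<in> carrier D \<Longrightarrow> g x y \<in> carrier D"
  shows "sweedler K CD C c (\<lambda>c1 c2. sweedler K CD D d (\<lambda>d1 d2. tens K C D (f c1 c2) (g d1 d2))) = tens K C D c d"
proof -
  note [simp] = base c d f(2) g(2)
  have "sweedler K CD C c (\<lambda>c1 c2. sweedler K CD D d (\<lambda>d1 d2. tens K C D (f c1 c2) (g d1 d2)))
    = sweedler K CD C c (\<lambda>c1 c2. tens K C D (f c1 c2) (sweedler K D D d g))"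
    by (intro sw_cong sw_apply[symmetric] lin_basic) simp_all
  also have "\<dots> = tens K C D (sweedler K C C c f) (sweedler K D D d g)"
    unfolding g by (intro sw_apply[where f = "\<lambda>z. tens K C D z d", symmetric] lin_basic) simp_all
  finally show ?thesis by (simp add: f g)
qed

lemmas counit_laws = C.counit_left C.counit_right D.counit_left D.counit_right

lemmas smult_simps = module.smult_closed[OF base(5)] module.smult_closed[OF base(6)]
  module.smult_closed[OF base(7)] tens_smult1 tens_smult2
  module.smult_assoc1[OF base(7), symmetric] C.R.m_comm

lemma P_counit_laws:
  assumes t: "t \<in> carrier CD"
  shows "sweedler K CD P t (\<lambda>x y. counit P x \<odot>\<^bsub>CD\<^esub> y) = t"
    and "sweedler K CD P t (\<lambda>x y. counit P y \<odot>\<^bsub>CD\<^esub> x) = t"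
proof -
  let ?P = "sweedler K CD P" and ?C = "sweedler K CD C" and ?D = "sweedler K CD D"
  note [simp] = base P_counit_closed counit_tens smult_simps
  note lins = bilin_mapI lin_CD_sw P_counit_compose lin_basic
  note ext = tens_ext[where K = K and M = C and N = D and V = CD and t = t and g = "\<lambda>t. t"]
  have 1: "?P (tens K C D c d) (\<lambda>x y. counit P x \<odot>\<^bsub>CD\<^esub> y) = tens K C D c d"
    if [simp]: "c \<in> carrier C" "d \<in> carrier D" for c d
  proof -
    have "?P (tens K C D c d) (\<lambda>x y. counit P x \<odot>\<^bsub>CD\<^esub> y)
      = ?C c (\<lambda>c1 c2. ?D d (\<lambda>d1 d2. counit P (tens K C D c1 d1) \<odot>\<^bsub>CD\<^esub> tens K C D c2 d2))"
      by (intro sw_tensor lins) simp_all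
    also have "\<dots> = ?C c (\<lambda>c1 c2. ?D d (\<lambda>d1 d2. tens K C D (counit C c1 \<odot>\<^bsub>C\<^esub> c2) (counit D d1 \<odot>\<^bsub>D\<^esub> d2)))"
      by (intro sw_cong) simp_all
    also have "\<dots> = tens K C D c d" by (rule tensor_of_counits) (simp_all add: counit_laws)
    finally show ?thesis .
  qed
  have 2: "?P (tens K C D c d) (\<lambda>x y. counit P y \<odot>\<^bsub>CD\<^esub> x) = tens K C D c d"
    if [simp]: "c \<in> carrier C" "d \<in> carrier D" for c d
  proof -
    have "?P (tens K C D c d) (\<lambda>x y. counit P y \<odot>\<^bsub>CD\<^esub> x)
      = ?C c (\<lambda>c1 c2. ?D d (\<lambda>d1 d2. counit P (tens K C D c2 d2) \<odot>\<^bsub>CD\<^esub> tens K C D c1 d1))"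
      by (intro sw_tensor lins) simp_all
    also have "\<dots> = ?C c (\<lambda>c1 c2. ?D d (\<lambda>d1 d2. tens K C D (counit C c2 \<odot>\<^bsub>C\<^esub> c1) (counit D d2 \<odot>\<^bsub>D\<^esub> d1)))"
      by (intro sw_cong) simp_all
    also have "\<dots> = tens K C D c d" by (rule tensor_of_counits) (simp_all add: counit_laws)
    finally show ?thesis .
  qed
  show "?P t (\<lambda>x y. counit P x \<odot>\<^bsub>CD\<^esub> y) = t" using t by (intro ext lins 1) simp_all
  show "?P t (\<lambda>x y. counit P y \<odot>\<^bsub>CD\<^esub> x) = t" using t by (intro ext lins 2) simp_all
qed

text \<open>
  The coalgebra axioms only see the underlying space, the comultiplication and the counit, so they
  hold for every algebra structure put on \<open>C \<otimes> D\<close>.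
\<close>

lemma coalgebra_on_tensor:
  fixes S :: "('k, ('k, 'c, 'd) tensor, 's) bialg_scheme"
  assumes same: "same_space S CD" and com: "comult S = comult P" and eps: "counit S = counit P"
  shows "coalgebra K S"
proof -
  note S_simps = same_carrier[OF same] same_lin_dom[OF same]
    same_lin_cod[OF same] same_tlift[OF same] same_sweedler[OF same] same_tensor[OF same same]
    same_tens[OF same same] same_smult[OF same]
    same_tensor[OF same same_refl[of "tensor_mod K CD CD"]]
    same_tens[OF same same_refl[of "tensor_mod K CD CD"]]
  have S: "has_comult K S"
    using P_has_comult same_module[OF same base(7)] unfolding has_comult_def
    by (simp add: S_simps P_simps com base)
  have sw: "sweedler K V S = sweedler K V P" for V :: "('k, 'v, 'w) module_scheme"
    by (intro ext) (simp add: sweedler_def com)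
  show ?thesis
  proof (rule coalgebra.intro, rule has_comult_module[OF S], rule coalgebra_axioms.intro)
    show "lin_map K S (tensor_mod K S S) (comult S)" using S by (simp add: has_comult_def)
    show "lin_map K S (ground K) (counit S)" by (simp add: S_simps eps P_counit_lin)
    fix t assume t: "t \<in> carrier S"
    then have t': "t \<in> carrier CD" by (simp add: S_simps)
    show "tassoc K S S S (tmap K (tensor_mod K S S) S (comult S) id (comult S t))
        = tmap K S (tensor_mod K S S) id (comult S) (comult S t)"
      unfolding coassoc_lhs[OF S t] coassoc_rhs[OF S t]
      using P_coassoc[OF t'] by (simp add: S_simps sw)
    show "sweedler K S S t (\<lambda>x y. counit S x \<odot>\<^bsub>S\<^esub> y) = t"
      "sweedler K S S t (\<lambda>x y. counit S y \<odot>\<^bsub>S\<^esub> x) = t"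
      using P_counit_laws[OF t'] by (simp_all add: S_simps sw eps)
  qed
qed

end

text \<open>
  Two ways to write \<open>F(c\<^sub>1, c\<^sub>2, c\<^sub>3, c\<^sub>4)\<close>. On the right-hand side \<open>c\<^sub>2\<close> and \<open>c\<^sub>3\<close> come from one common
  element, so that a cocommutativity condition can exchange them.
\<close>

lemma sw4_middle:
  assumes C: "coalgebra K C" and V: "module K V" and c: "c \<in> carrier C"
    and F1: "\<And>y z w. y \<in> carrier C \<Longrightarrow> z \<in> carrier C \<Longrightarrow> w \<in> carrier C \<Longrightarrow> lin_map K C V (\<lambda>x. F x y z w)"
    and F2: "\<And>x z w. x \<in> carrier C \<Longrightarrow> z \<in> carrier C \<Longrightarrow> w \<in> carrier C \<Longrightarrow> lin_map K C V (\<lambda>y. F x y z w)"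
    and F3: "\<And>x y w. x \<in> carrier C \<Longrightarrow> y \<in> carrier C \<Longrightarrow> w \<in> carrier C \<Longrightarrow> lin_map K C V (\<lambda>z. F x y z w)"
    and F4: "\<And>x y z. x \<in> carrier C \<Longrightarrow> y \<in> carrier C \<Longrightarrow> z \<in> carrier C \<Longrightarrow> lin_map K C V (\<lambda>w. F x y z w)"
  shows "sweedler K V C c (\<lambda>c1 c2. sweedler K V C c1 (\<lambda>x y. sweedler K V C c2 (\<lambda>z w. F x y z w)))
    = sweedler K V C c (\<lambda>x c'. sweedler K V C c' (\<lambda>m w. sweedler K V C m (\<lambda>y z. F x y z w)))"
proof -
  let ?sw = "sweedler K V C"
  note [simp] = C V c coalgebra_has_comult[OF C] coalgebra_module[OF C]
  have "?sw c (\<lambda>c1 c2. ?sw c1 (\<lambda>x y. ?sw c2 (\<lambda>z w. F x y z w)))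
    = ?sw c (\<lambda>x c'. ?sw c' (\<lambda>y c''. ?sw c'' (\<lambda>z w. F x y z w)))"
    by (rule sw_coassoc) ((intro lin_sw_param lin_sw_arg bilin_mapI F1 F2 F3 F4 lin_map_id)?; simp)+
  also have "\<dots> = ?sw c (\<lambda>x c'. ?sw c' (\<lambda>m w. ?sw m (\<lambda>y z. F x y z w)))"
    by (intro sw_cong sw_coassoc[symmetric] F1 F2 F3 F4) simp_all
  finally show ?thesis .
qed

section \<open>Smash products are bialgebras\<close>

context semidirect_action
begin

sublocale AH: coalg_pair K A H
  by (simp add: coalg_pair_def A.coalgebra_axioms H.coalgebra_axioms)

sublocale HA: coalg_pair K H A
  by (simp add: coalg_pair_def A.coalgebra_axioms H.coalgebra_axioms)

abbreviation T where "T \<equiv> tensor_mod K A H"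
abbreviation TT where "TT \<equiv> tensor_mod K T T"
abbreviation S where "S \<equiv> smash K A H act"
abbreviation sharp (infixl \<open>#'#\<close> 65) where "a ## h \<equiv> tens K A H a h"
abbreviation mult_A (infixl \<open>\<cdot>\<close> 70) where "a \<cdot> b \<equiv> a \<otimes>\<^bsub>A\<^esub> b"
abbreviation mult_H (infixl \<open>\<star>\<close> 70) where "g \<star> h \<equiv> g \<otimes>\<^bsub>H\<^esub> h"
abbreviation mult_S (infixl \<open>\<bullet>\<close> 70) where "s \<bullet> t \<equiv> s \<otimes>\<^bsub>S\<^esub> t"

lemma bialgs: "bialgebra K A" "bialgebra K H" "assoc_algebra K A" "assoc_algebra K H"
  by (rule A.bialgebra_axioms H.bialgebra_axioms A.assoc_algebra_axioms H.assoc_algebra_axioms)+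

lemma act_closed [simp]: "h \<in> carrier H \<Longrightarrow> a \<in> carrier A \<Longrightarrow> h \<rhd> a \<in> carrier A"
  by (rule bilin_map_closed[OF act_bilin])

lemma lin_act1: "a \<in> carrier A \<Longrightarrow> lin_map K L H f \<Longrightarrow> lin_map K L A (\<lambda>x. f x \<rhd> a)"
  by (rule lin_map_compose[OF bilin_map_lin1[OF act_bilin]])

lemma lin_act2: "h \<in> carrier H \<Longrightarrow> lin_map K L A f \<Longrightarrow> lin_map K L A (\<lambda>x. h \<rhd> f x)"
  by (rule lin_map_compose[OF bilin_map_lin2[OF act_bilin]])

lemmas facts = AH.base bialgs AH.P_counit_closed counit_mult[OF bialgs(1)] counit_mult[OF bialgs(2)]

lemmas lins = bilin_mapI lin_act1 lin_act2 lin_basic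
  lin_sw_arg[of K A] lin_sw_param[of K A] lin_sw_arg[of K H] lin_sw_param[of K H]
  lin_tlift_arg[where M = A and N = H] lin_tlift_param[where M = A and N = H]

text \<open>
  The action is a coalgebra map \<open>H \<otimes> A \<rightarrow> A\<close>; here it is evaluated on a pure tensor.
\<close>

lemma sw_act:
  assumes V: "module K V" and G: "bilin_map K A A V G" and h: "h \<in> carrier H" and a: "a \<in> carrier A"
  shows "sweedler K V A (h \<rhd> a) G
    = sweedler K V H h (\<lambda>h1 h2. sweedler K V A a (\<lambda>a1 a2. G (h1 \<rhd> a1) (h2 \<rhd> a2)))"
proof -
  note [simp] = facts V h a
  have ev: "tlift K A act (tens K H A x y) = x \<rhd> y" if "x \<in> carrier H" "y \<in> carrier A" for x y
    using that by (simp add: tlift_tens act_bilin)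
  have L: "lin_map K HA.CD A (tlift K A act)"
    using coalg_hom_lin[OF act_coalg_hom] by (simp add: HA.P_simps)
  have G': "bilin_map K HA.CD HA.CD V (\<lambda>x y. G (tlift K A act x) (tlift K A act y))"
    by (intro bilin_mapI lin_map_compose[OF bilin_map_lin1[OF G] L] lin_map_compose[OF bilin_map_lin2[OF G] L]
        lin_map_closed[OF L])
  have "sweedler K V A (h \<rhd> a) G = sweedler K V A (tlift K A act (tens K H A h a)) G"
    by (simp add: ev)
  also have "\<dots> = sweedler K V HA.P (tens K H A h a) (\<lambda>x y. G (tlift K A act x) (tlift K A act y))"
    by (rule sw_coalg_hom[OF HA.P_has_comult _ _ act_coalg_hom]) (simp_all add: G HA.P_simps)
  also have "\<dots> = sweedler K V H h (\<lambda>h1 h2. sweedler K V A a (\<lambda>a1 a2.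
      G (tlift K A act (tens K H A h1 a1)) (tlift K A act (tens K H A h2 a2))))"
    by (rule HA.sw_tensor) (simp_all add: G')
  also have "\<dots> = sweedler K V H h (\<lambda>h1 h2. sweedler K V A a (\<lambda>a1 a2. G (h1 \<rhd> a1) (h2 \<rhd> a2)))"
    by (intro sw_cong) (simp_all add: ev)
  finally show ?thesis .
qed

lemma counit_act:
  assumes "h \<in> carrier H" "a \<in> carrier A"
  shows "counit A (h \<rhd> a) = counit H h \<otimes>\<^bsub>K\<^esub> counit A a"
proof -
  have "counit A (tlift K A act (tens K H A h a)) = counit HA.P (tens K H A h a)"
    using act_coalg_hom assms unfolding coalg_hom_def by (simp add: HA.P_simps facts)
  then show ?thesis using assms by (simp add: tlift_tens act_bilin facts HA.counit_tens)
qed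

text \<open>
  The cocommutativity condition on the action, transported along the linear map that \<open>G\<close> induces.
\<close>

lemma sw_cocomm:
  assumes V: "module K V" and G: "bilin_map K H A V G" and h: "h \<in> carrier H" and a: "a \<in> carrier A"
  shows "sweedler K V H h (\<lambda>h1 h2. G h1 (h2 \<rhd> a)) = sweedler K V H h (\<lambda>h1 h2. G h2 (h1 \<rhd> a))"
proof -
  note [simp] = facts V h a
  have L: "lin_map K HA.CD V (tlift K V G)"
    by (rule lin_tlift_arg[where M = H and N = A and f = "\<lambda>x. x"]) (simp_all add: G lin_map_id)
  have "sweedler K V H h (\<lambda>h1 h2. G h1 (h2 \<rhd> a))
    = sweedler K V H h (\<lambda>h1 h2. tlift K V G (tens K H A h1 (h2 \<rhd> a)))"
    by (intro sw_cong) (simp_all add: tlift_tens G)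
  also have "\<dots> = tlift K V G (sweedler K HA.CD H h (\<lambda>h1 h2. tens K H A h1 (h2 \<rhd> a)))"
    by (intro sw_apply[symmetric] L) simp_all
  also have "\<dots> = tlift K V G (sweedler K HA.CD H h (\<lambda>h1 h2. tens K H A h2 (h1 \<rhd> a)))"
    by (simp add: act_cocomm)
  also have "\<dots> = sweedler K V H h (\<lambda>h1 h2. tlift K V G (tens K H A h2 (h1 \<rhd> a)))"
    by (intro sw_apply L) simp_all
  also have "\<dots> = sweedler K V H h (\<lambda>h1 h2. G h2 (h1 \<rhd> a))"
    by (intro sw_cong) (simp_all add: tlift_tens G)
  finally show ?thesis .
qed

lemma S_same: "same_space S T"
  by (simp add: smash_def Let_def same_space_def tensor_coalg_def module.defs)

lemma S_comult: "comult S = comult AH.P"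
  by (simp add: smash_def Let_def)

lemma S_counit: "counit S = counit AH.P"
  by (simp add: smash_def Let_def)

lemma S_sweedler: "sweedler K V S = sweedler K V AH.P"
  by (intro ext) (simp add: sweedler_def S_comult)

lemma S_one: "\<one>\<^bsub>S\<^esub> = \<one>\<^bsub>A\<^esub> ## \<one>\<^bsub>H\<^esub>"
  by (simp add: smash_def Let_def)

lemma S_coalgebra: "coalgebra K S"
  by (rule AH.coalgebra_on_tensor[OF S_same S_comult S_counit])

lemmas S_simps = same_carrier[OF S_same] same_lin_dom[OF S_same]
    same_lin_cod[OF S_same] same_tlift[OF S_same] same_sweedler[OF S_same]
    same_tensor[OF S_same S_same] same_tens[OF S_same S_same]
    same_smult[OF S_same] same_add[OF S_same] S_sweedler S_counit

lemma S_mult: "s \<bullet> t = tlift K T (\<lambda>a h. tlift K T (\<lambda>c g.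
    sweedler K T H h (\<lambda>h1 h2. a \<cdot> (h1 \<rhd> c) ## h2 \<star> g)) t) s"
  by (simp add: smash_def Let_def)

text \<open>
  The multiplication of the smash product is lifted in two stages, and each stage needs
  bilinearity.
\<close>

lemma S_mult_bilin_aux:
  assumes "a \<in> carrier A" "h \<in> carrier H"
  shows "bilin_map K A H T (\<lambda>c g. sweedler K T H h (\<lambda>h1 h2. a \<cdot> (h1 \<rhd> c) ## h2 \<star> g))"
  by (intro lins) (simp_all add: facts assms)

lemma S_mult_bilin_aux2:
  assumes "t \<in> carrier T"
  shows "bilin_map K A H T (\<lambda>a h. tlift K T (\<lambda>c g.
    sweedler K T H h (\<lambda>h1 h2. a \<cdot> (h1 \<rhd> c) ## h2 \<star> g)) t)"
  by (intro lins) (simp_all add: facts assms)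

lemma lin_S_mult1: "t \<in> carrier T \<Longrightarrow> lin_map K L T f \<Longrightarrow> lin_map K L T (\<lambda>x. f x \<bullet> t)"
  unfolding S_mult
  by (rule lin_tlift_arg[where M = A and N = H]) (simp_all add: facts S_mult_bilin_aux2)

lemma lin_S_mult2: "s \<in> carrier T \<Longrightarrow> lin_map K L T f \<Longrightarrow> module K L \<Longrightarrow> lin_map K L T (\<lambda>x. s \<bullet> f x)"
  unfolding S_mult
  by (rule lin_tlift_param[where M = A and N = H],
      simp_all add: facts lin_tlift_arg[where M = A and N = H] S_mult_bilin_aux)

lemma S_closed: "s \<in> carrier T \<Longrightarrow> t \<in> carrier T \<Longrightarrow> s \<bullet> t \<in> carrier T"
  by (rule lin_map_closed[OF lin_S_mult1[OF _ lin_map_id]])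

lemma S_mult_tens:
  assumes "a \<in> carrier A" "h \<in> carrier H" "c \<in> carrier A" "g \<in> carrier H"
  shows "(a ## h) \<bullet> (c ## g) = sweedler K T H h (\<lambda>h1 h2. a \<cdot> (h1 \<rhd> c) ## h2 \<star> g)"
  unfolding S_mult
  by (subst tlift_tens[OF _ _ _ S_mult_bilin_aux2]; simp add: facts assms tlift_tens S_mult_bilin_aux)

lemma S_mult_tens_apply:
  assumes V: "module K V" and f: "lin_map K T V f"
    and "a \<in> carrier A" "h \<in> carrier H" "c \<in> carrier A" "g \<in> carrier H"
  shows "f ((a ## h) \<bullet> (c ## g)) = sweedler K V H h (\<lambda>h1 h2. f (a \<cdot> (h1 \<rhd> c) ## h2 \<star> g))"
  unfolding S_mult_tens[OF assms(3-6)] by (intro sw_apply f) (simp_all add: facts V assms(3-6))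

lemma S_assoc_tens:
  assumes [simp]: "a \<in> carrier A" "h \<in> carrier H" "c \<in> carrier A" "g \<in> carrier H" "d \<in> carrier A" "k \<in> carrier H"
  shows "((a ## h) \<bullet> (c ## g)) \<bullet> (d ## k) = (a ## h) \<bullet> ((c ## g) \<bullet> (d ## k))"
proof -
  let ?sw = "sweedler K T H"
  note [simp] = facts S_closed
  let ?E = "\<lambda>x y z g1 g2. a \<cdot> ((x \<rhd> c) \<cdot> ((y \<star> g1) \<rhd> d)) ## z \<star> (g2 \<star> k)"
  have "((a ## h) \<bullet> (c ## g)) \<bullet> (d ## k)
    = ?sw h (\<lambda>h1 h2. (a \<cdot> (h1 \<rhd> c) ## h2 \<star> g) \<bullet> (d ## k))"
    unfolding S_mult_tens[OF assms(1-4)] by (intro sw_apply lin_S_mult1 lin_map_id) simp_all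
  also have "\<dots> = ?sw h (\<lambda>h1 h2. ?sw (h2 \<star> g) (\<lambda>x y.
      (a \<cdot> (h1 \<rhd> c)) \<cdot> (x \<rhd> d) ## y \<star> k))"
    by (intro sw_cong) (simp_all add: S_mult_tens)
  also have "\<dots> = ?sw h (\<lambda>h1 h2. ?sw h2 (\<lambda>x y. ?sw g (\<lambda>g1 g2.
      (a \<cdot> (h1 \<rhd> c)) \<cdot> ((x \<star> g1) \<rhd> d) ## (y \<star> g2) \<star> k)))"
    by (intro sw_cong sw_mult[OF bialgs(2)] lins) simp_all
  also have "\<dots> = ?sw h (\<lambda>h1 h2. ?sw h2 (\<lambda>x y. ?sw g (\<lambda>g1 g2. ?E h1 x y g1 g2)))"
    by (intro sw_cong) (simp_all add: A.m_assoc H.m_assoc)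
  finally have left: "((a ## h) \<bullet> (c ## g)) \<bullet> (d ## k) = \<dots>" .
  have "(a ## h) \<bullet> ((c ## g) \<bullet> (d ## k))
    = ?sw g (\<lambda>g1 g2. (a ## h) \<bullet> (c \<cdot> (g1 \<rhd> d) ## g2 \<star> k))"
    unfolding S_mult_tens[OF assms(3-6)] by (intro sw_apply lin_S_mult2 lin_map_id) simp_all
  also have "\<dots> = ?sw g (\<lambda>g1 g2. ?sw h (\<lambda>h1 h2.
      a \<cdot> (h1 \<rhd> (c \<cdot> (g1 \<rhd> d))) ## h2 \<star> (g2 \<star> k)))"
    by (rule sw_cong; simp add: S_mult_tens)
  also have "\<dots> = ?sw g (\<lambda>g1 g2. ?sw h (\<lambda>h1 h2.
      a \<cdot> (sweedler K A H h1 (\<lambda>x y. (x \<rhd> c) \<cdot> (y \<rhd> (g1 \<rhd> d)))) ## h2 \<star> (g2 \<star> k)))"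
    by (intro sw_cong) (simp_all add: act_on_mult)
  also have "\<dots> = ?sw g (\<lambda>g1 g2. ?sw h (\<lambda>h1 h2. ?sw h1 (\<lambda>x y.
      a \<cdot> ((x \<rhd> c) \<cdot> (y \<rhd> (g1 \<rhd> d))) ## h2 \<star> (g2 \<star> k))))"
    by (intro sw_cong sw_apply[where f = "\<lambda>z. a \<cdot> z ## _"] lins) simp_all
  also have "\<dots> = ?sw g (\<lambda>g1 g2. ?sw h (\<lambda>h1 h2. ?sw h1 (\<lambda>x y. ?E x y h2 g1 g2)))"
    by (intro sw_cong) (simp_all add: act_mult)
  also have "\<dots> = ?sw h (\<lambda>h1 h2. ?sw g (\<lambda>g1 g2. ?sw h1 (\<lambda>x y. ?E x y h2 g1 g2)))"
    by (rule sw_swap) simp_all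
  also have "\<dots> = ?sw h (\<lambda>h1 h2. ?sw h1 (\<lambda>x y. ?sw g (\<lambda>g1 g2. ?E x y h2 g1 g2)))"
    by (intro sw_cong sw_swap) simp_all
  also have "\<dots> = ?sw h (\<lambda>h1 h2. ?sw h2 (\<lambda>x y. ?sw g (\<lambda>g1 g2. ?E h1 x y g1 g2)))"
    by (rule sw_coassoc) ((intro lins)?; simp)+
  finally show ?thesis using left by simp
qed

lemma S_assoc:
  assumes "s \<in> carrier T" "t \<in> carrier T" "u \<in> carrier T"
  shows "(s \<bullet> t) \<bullet> u = s \<bullet> (t \<bullet> u)"
proof -
  note [simp] = facts S_closed
  note ext = tens_ext[where K = K and M = A and N = H and V = T]
  have 1: "((a ## h) \<bullet> (c ## g)) \<bullet> u = (a ## h) \<bullet> ((c ## g) \<bullet> u)"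
    if "a \<in> carrier A" "h \<in> carrier H" "c \<in> carrier A" "g \<in> carrier H" "u \<in> carrier T" for a h c g u
    using that
    by (intro ext[where t = u and f = "\<lambda>u. ((a ## h) \<bullet> (c ## g)) \<bullet> u"]
        lin_S_mult1 lin_S_mult2 lin_map_id S_assoc_tens) simp_all
  have 2: "((a ## h) \<bullet> t) \<bullet> u = (a ## h) \<bullet> (t \<bullet> u)"
    if "a \<in> carrier A" "h \<in> carrier H" "t \<in> carrier T" "u \<in> carrier T" for a h t u
    using that
    by (intro ext[where t = t and f = "\<lambda>t. ((a ## h) \<bullet> t) \<bullet> u"]
        lin_S_mult1 lin_S_mult2 lin_map_id 1) simp_all
  show ?thesis
    using assms
    by (intro ext[where t = s and f = "\<lambda>s. (s \<bullet> t) \<bullet> u"]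
        lin_S_mult1 lin_S_mult2 lin_map_id 2) simp_all
qed

lemma S_units:
  assumes t: "t \<in> carrier T"
  shows "(\<one>\<^bsub>A\<^esub> ## \<one>\<^bsub>H\<^esub>) \<bullet> t = t" "t \<bullet> (\<one>\<^bsub>A\<^esub> ## \<one>\<^bsub>H\<^esub>) = t"
proof -
  note [simp] = facts S_closed
  note ext = tens_ext[where K = K and M = A and N = H and V = T and t = t, OF _ _ _ _ _ _ t]
  have 1: "(\<one>\<^bsub>A\<^esub> ## \<one>\<^bsub>H\<^esub>) \<bullet> (a ## h) = a ## h" if "a \<in> carrier A" "h \<in> carrier H" for a h
  proof -
    have "(\<one>\<^bsub>A\<^esub> ## \<one>\<^bsub>H\<^esub>) \<bullet> (a ## h)
      = sweedler K T H \<one>\<^bsub>H\<^esub> (\<lambda>h1 h2. \<one>\<^bsub>A\<^esub> \<cdot> (h1 \<rhd> a) ## h2 \<star> h)"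
      using that by (simp add: S_mult_tens)
    also have "\<dots> = \<one>\<^bsub>A\<^esub> \<cdot> (\<one>\<^bsub>H\<^esub> \<rhd> a) ## \<one>\<^bsub>H\<^esub> \<star> h"
      using that by (intro sw_one[OF bialgs(2)] lins) simp_all
    finally show ?thesis using that by (simp add: act_one)
  qed
  have 2: "(a ## h) \<bullet> (\<one>\<^bsub>A\<^esub> ## \<one>\<^bsub>H\<^esub>) = a ## h" if "a \<in> carrier A" "h \<in> carrier H" for a h
  proof -
    have "(a ## h) \<bullet> (\<one>\<^bsub>A\<^esub> ## \<one>\<^bsub>H\<^esub>)
      = sweedler K T H h (\<lambda>h1 h2. a \<cdot> (h1 \<rhd> \<one>\<^bsub>A\<^esub>) ## h2 \<star> \<one>\<^bsub>H\<^esub>)"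
      using that by (simp add: S_mult_tens)
    also have "\<dots> = sweedler K T H h (\<lambda>h1 h2. counit H h1 \<odot>\<^bsub>T\<^esub> (a ## h2))"
      using that by (intro sw_cong) (simp_all add: act_on_one A.smult_mult_right AH.tens_smult1)
    also have "\<dots> = a ## h"
      using that by (intro sw_counit_left lins) simp_all
    finally show ?thesis .
  qed
  show "(\<one>\<^bsub>A\<^esub> ## \<one>\<^bsub>H\<^esub>) \<bullet> t = t"
    by (intro ext[where f = "\<lambda>t. (\<one>\<^bsub>A\<^esub> ## \<one>\<^bsub>H\<^esub>) \<bullet> t" and g = "\<lambda>t. t"]
        lin_S_mult1 lin_S_mult2 lin_map_id 1) simp_all
  show "t \<bullet> (\<one>\<^bsub>A\<^esub> ## \<one>\<^bsub>H\<^esub>) = t"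
    by (intro ext[where f = "\<lambda>t. t \<bullet> (\<one>\<^bsub>A\<^esub> ## \<one>\<^bsub>H\<^esub>)" and g = "\<lambda>t. t"]
        lin_S_mult1 lin_S_mult2 lin_map_id 2) simp_all
qed

lemma S_algebra: "assoc_algebra K S"
proof -
  have S: "module K S" by (rule same_module[OF S_same]) (simp add: facts)
  have T: "module K T" by (simp add: facts)
  note lin1 = lin_S_mult1[OF _ lin_map_id] and lin2 = lin_S_mult2[OF _ lin_map_id T]
  have "ring S"
  proof (rule ringI)
    show "abelian_group S" by (rule module.axioms(2)[OF S])
    show "Group.monoid S"
      by (rule monoidI) (simp_all add: S_simps S_one S_closed S_assoc S_units facts)
  qed (simp_all add: S_simps lin_map_add[OF lin1] lin_map_add[OF lin2])
  then show ?thesis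
    by (intro assoc_algebra.intro assoc_algebra_axioms.intro S)
       (simp_all add: S_simps lin_map_smult[OF lin1] lin_map_smult[OF lin2])
qed

lemmas lins_T = bilin_mapI lin_act1 lin_act2 lin_S_mult1 lin_S_mult2 lin_basic
  AH.lin_sw_P AH.lin_sw_P_param
  lin_sw_arg[of K A] lin_sw_param[of K A] lin_sw_arg[of K H] lin_sw_param[of K H]
  lin_tlift_arg[where M = A and N = H] lin_tlift_param[where M = A and N = H]

text \<open>
  The comultiplication of \<open>(a # h)(c # g)\<close> is
  \<open>a\<^sub>1 (h\<^sub>1 \<rhd> c\<^sub>1) # h\<^sub>3 g\<^sub>1 \<otimes> a\<^sub>2 (h\<^sub>2 \<rhd> c\<^sub>2) # h\<^sub>4 g\<^sub>2\<close>, the product of the comultiplications is the same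
  with \<open>h\<^sub>2\<close> and \<open>h\<^sub>3\<close> exchanged. As \<open>h\<^sub>2\<close> or \<open>h\<^sub>3\<close> acts on \<open>c\<^sub>2\<close>, the cocommutativity condition makes them
  equal.
\<close>

lemma S_comult_mult_tens:
  assumes [simp]: "a \<in> carrier A" "h \<in> carrier H" "c \<in> carrier A" "g \<in> carrier H"
  shows "sweedler K TT AH.P ((a ## h) \<bullet> (c ## g)) (tens K T T)
    = sweedler K TT AH.P (a ## h) (\<lambda>x1 x2. sweedler K TT AH.P (c ## g) (\<lambda>y1 y2.
        tens K T T (x1 \<bullet> y1) (x2 \<bullet> y2)))"
proof -
  let ?t = "tens K T T"
  let ?A = "sweedler K TT A" and ?H = "sweedler K TT H" and ?P = "sweedler K TT AH.P"
  note [simp] = facts S_closed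
  let ?E = "\<lambda>a1 a2 c1 c2 g1 g2 x y z w. ?t (a1 \<cdot> (x \<rhd> c1) ## y \<star> g1) (a2 \<cdot> (z \<rhd> c2) ## w \<star> g2)"
  have "?P ((a ## h) \<bullet> (c ## g)) (?t)
    = ?H h (\<lambda>h1 h2. ?P (a \<cdot> (h1 \<rhd> c) ## h2 \<star> g) (?t))"
    unfolding S_mult_tens[OF assms] by (intro sw_apply lins_T) simp_all
  also have "\<dots> = ?H h (\<lambda>h1 h2. ?A (a \<cdot> (h1 \<rhd> c)) (\<lambda>x y.
      ?H (h2 \<star> g) (\<lambda>z w. ?t (x ## z) (y ## w))))"
    by (intro sw_cong AH.sw_tensor lins_T) simp_all
  also have "\<dots> = ?H h (\<lambda>h1 h2. ?A a (\<lambda>a1 a2. ?A (h1 \<rhd> c) (\<lambda>x y.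
      ?H (h2 \<star> g) (\<lambda>z w. ?t (a1 \<cdot> x ## z) (a2 \<cdot> y ## w)))))"
    by (intro sw_cong sw_mult[OF bialgs(1)] lins_T) simp_all
  also have "\<dots> = ?H h (\<lambda>h1 h2. ?A a (\<lambda>a1 a2. ?H h1 (\<lambda>x z. ?A c (\<lambda>c1 c2.
      ?H (h2 \<star> g) (\<lambda>y w. ?t (a1 \<cdot> (x \<rhd> c1) ## y) (a2 \<cdot> (z \<rhd> c2) ## w))))))"
    by (intro sw_cong sw_act lins_T) simp_all
  also have "\<dots> = ?H h (\<lambda>h1 h2. ?A a (\<lambda>a1 a2. ?H h1 (\<lambda>x z. ?A c (\<lambda>c1 c2.
      ?H h2 (\<lambda>y w. ?H g (\<lambda>g1 g2. ?E a1 a2 c1 c2 g1 g2 x y z w))))))"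
    by (intro sw_cong sw_mult[OF bialgs(2)] lins_T) simp_all
  \<comment> \<open>From here on the expansions of \<open>a\<close>, \<open>c\<close> and \<open>g\<close> are moved outwards, past those of \<open>h\<close>.\<close>
  also have "\<dots> = ?A a (\<lambda>a1 a2. ?H h (\<lambda>h1 h2. ?H h1 (\<lambda>x z. ?A c (\<lambda>c1 c2. ?H h2 (\<lambda>y w. ?H g (\<lambda>g1 g2. ?E a1 a2 c1 c2 g1 g2 x y z w))))))"
    by (rule sw_swap) simp_all
  also have "\<dots> = ?A a (\<lambda>a1 a2. ?H h (\<lambda>h1 h2. ?A c (\<lambda>c1 c2. ?H h1 (\<lambda>x z. ?H h2 (\<lambda>y w. ?H g (\<lambda>g1 g2. ?E a1 a2 c1 c2 g1 g2 x y z w))))))"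
    by (intro sw_cong sw_swap) simp_all
  also have "\<dots> = ?A a (\<lambda>a1 a2. ?A c (\<lambda>c1 c2. ?H h (\<lambda>h1 h2. ?H h1 (\<lambda>x z. ?H h2 (\<lambda>y w. ?H g (\<lambda>g1 g2. ?E a1 a2 c1 c2 g1 g2 x y z w))))))"
    by (intro sw_cong sw_swap) simp_all
  also have "\<dots> = ?A a (\<lambda>a1 a2. ?A c (\<lambda>c1 c2. ?H h (\<lambda>h1 h2. ?H h1 (\<lambda>x z. ?H g (\<lambda>g1 g2. ?H h2 (\<lambda>y w. ?E a1 a2 c1 c2 g1 g2 x y z w))))))"
    by (intro sw_cong sw_swap) simp_all
  also have "\<dots> = ?A a (\<lambda>a1 a2. ?A c (\<lambda>c1 c2. ?H h (\<lambda>h1 h2. ?H g (\<lambda>g1 g2. ?H h1 (\<lambda>x z. ?H h2 (\<lambda>y w. ?E a1 a2 c1 c2 g1 g2 x y z w))))))"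
    by (intro sw_cong sw_swap) simp_all
  also have "\<dots> = ?A a (\<lambda>a1 a2. ?A c (\<lambda>c1 c2. ?H g (\<lambda>g1 g2. ?H h (\<lambda>h1 h2. ?H h1 (\<lambda>x z. ?H h2 (\<lambda>y w. ?E a1 a2 c1 c2 g1 g2 x y z w))))))"
    by (intro sw_cong sw_swap) simp_all
  finally have left: "?P ((a ## h) \<bullet> (c ## g)) (?t) = \<dots>" .
  have "?P (a ## h) (\<lambda>x1 x2. ?P (c ## g) (\<lambda>y1 y2.
        ?t (x1 \<bullet> y1) (x2 \<bullet> y2)))
    = ?A a (\<lambda>a1 a2. ?H h (\<lambda>h1 h2. ?P (c ## g) (\<lambda>y1 y2.
        ?t ((a1 ## h1) \<bullet> y1) ((a2 ## h2) \<bullet> y2))))"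
    by (intro AH.sw_tensor lins_T) simp_all
  also have "\<dots> = ?A a (\<lambda>a1 a2. ?H h (\<lambda>h1 h2. ?A c (\<lambda>c1 c2. ?H g (\<lambda>g1 g2.
        ?t ((a1 ## h1) \<bullet> (c1 ## g1)) ((a2 ## h2) \<bullet> (c2 ## g2))))))"
    by (intro sw_cong AH.sw_tensor lins_T) simp_all
  also have "\<dots> = ?A a (\<lambda>a1 a2. ?H h (\<lambda>h1 h2. ?A c (\<lambda>c1 c2. ?H g (\<lambda>g1 g2.
        ?H h1 (\<lambda>x y. ?t (a1 \<cdot> (x \<rhd> c1) ## y \<star> g1) ((a2 ## h2) \<bullet> (c2 ## g2)))))))"
    by (intro sw_cong S_mult_tens_apply[where f = "\<lambda>z. ?t z _"] lins_T) simp_all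
  also have "\<dots> = ?A a (\<lambda>a1 a2. ?H h (\<lambda>h1 h2. ?A c (\<lambda>c1 c2. ?H g (\<lambda>g1 g2.
        ?H h1 (\<lambda>x y. ?H h2 (\<lambda>z w. ?E a1 a2 c1 c2 g1 g2 x y z w))))))"
    by (intro sw_cong S_mult_tens_apply[where f = "\<lambda>z. ?t _ z"] lins_T) simp_all
  also have "\<dots> = ?A a (\<lambda>a1 a2. ?A c (\<lambda>c1 c2. ?H h (\<lambda>h1 h2. ?H g (\<lambda>g1 g2. ?H h1 (\<lambda>x y. ?H h2 (\<lambda>z w. ?E a1 a2 c1 c2 g1 g2 x y z w))))))"
    by (intro sw_cong sw_swap) simp_all
  also have "\<dots> = ?A a (\<lambda>a1 a2. ?A c (\<lambda>c1 c2. ?H g (\<lambda>g1 g2. ?H h (\<lambda>h1 h2. ?H h1 (\<lambda>x y. ?H h2 (\<lambda>z w. ?E a1 a2 c1 c2 g1 g2 x y z w))))))"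
    by (intro sw_cong sw_swap) simp_all
  finally have right: "?P (a ## h) (\<lambda>x1 x2. ?P (c ## g) (\<lambda>y1 y2.
        ?t (x1 \<bullet> y1) (x2 \<bullet> y2))) = \<dots>" .
  have mid: "?H h (\<lambda>h1 h2. ?H h1 (\<lambda>x z. ?H h2 (\<lambda>y w. ?E a1 a2 c1 c2 g1 g2 x y z w)))
    = ?H h (\<lambda>h1 h2. ?H h1 (\<lambda>x y. ?H h2 (\<lambda>z w. ?E a1 a2 c1 c2 g1 g2 x y z w)))"
    if [simp]: "a1 \<in> carrier A" "a2 \<in> carrier A" "c1 \<in> carrier A" "c2 \<in> carrier A" "g1 \<in> carrier H" "g2 \<in> carrier H"
    for a1 a2 c1 c2 g1 g2
  proof -
    have "?H h (\<lambda>h1 h2. ?H h1 (\<lambda>x z. ?H h2 (\<lambda>y w. ?E a1 a2 c1 c2 g1 g2 x y z w)))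
      = ?H h (\<lambda>x h'. ?H h' (\<lambda>m w. ?H m (\<lambda>z y. ?E a1 a2 c1 c2 g1 g2 x y z w)))"
      by (rule sw4_middle) ((intro lins_T)?; simp)+
    also have "\<dots> = ?H h (\<lambda>x h'. ?H h' (\<lambda>m w. ?H m (\<lambda>y z. ?E a1 a2 c1 c2 g1 g2 x y z w)))"
      by (intro sw_cong sw_cocomm[symmetric, where G = "\<lambda>y b. ?t (_ ## y \<star> _) (_ \<cdot> b ## _)"] lins_T)
         simp_all
    also have "\<dots> = ?H h (\<lambda>h1 h2. ?H h1 (\<lambda>x y. ?H h2 (\<lambda>z w. ?E a1 a2 c1 c2 g1 g2 x y z w)))"
      by (rule sw4_middle[symmetric]) ((intro lins_T)?; simp)+
    finally show ?thesis .
  qed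
  show ?thesis unfolding left right
    by (intro sw_cong mid) simp_all
qed

lemma S_counit_mult_tens:
  assumes [simp]: "a \<in> carrier A" "h \<in> carrier H" "c \<in> carrier A" "g \<in> carrier H"
  shows "counit AH.P ((a ## h) \<bullet> (c ## g)) = counit AH.P (a ## h) \<otimes>\<^bsub>K\<^esub> counit AH.P (c ## g)"
proof -
  note [simp] = facts S_closed AH.counit_tens counit_act
  let ?k = "counit A a \<otimes>\<^bsub>K\<^esub> (counit A c \<otimes>\<^bsub>K\<^esub> counit H g)"
  have "counit AH.P ((a ## h) \<bullet> (c ## g))
    = sweedler K (ground K) H h (\<lambda>h1 h2. counit AH.P (a \<cdot> (h1 \<rhd> c) ## h2 \<star> g))"
    by (intro S_mult_tens_apply AH.P_counit_lin) simp_all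
  also have "\<dots> = sweedler K (ground K) H h (\<lambda>h1 h2. counit H h1 \<odot>\<^bsub>ground K\<^esub> (counit H h2 \<otimes>\<^bsub>K\<^esub> ?k))"
    by (intro sw_cong) (simp_all add: H.R.m_ac)
  also have "\<dots> = counit H h \<otimes>\<^bsub>K\<^esub> ?k"
    by (intro sw_counit_left lins) simp_all
  finally show ?thesis by (simp add: H.R.m_ac)
qed

text \<open>
  The compatibilities are bilinear in the two factors, which reduces them to pure tensors.
\<close>

lemma S_bialgebra: "bialgebra K S"
proof (rule bialgebraI[OF S_algebra S_coalgebra])
  note [simp] = facts S_closed
  note ext = tens_ext[where K = K and M = A and N = H and V = TT]
  note ext' = tens_ext[where K = K and M = A and N = H and V = "ground K"]
  have 1: "sweedler K TT AH.P (s \<bullet> (c ## g)) (tens K T T)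
    = sweedler K TT AH.P s (\<lambda>x1 x2. sweedler K TT AH.P (c ## g) (\<lambda>y1 y2.
        tens K T T (x1 \<bullet> y1) (x2 \<bullet> y2)))"
    if "s \<in> carrier T" "c \<in> carrier A" "g \<in> carrier H" for s c g
    using that
    by (intro ext[where t = s and f = "\<lambda>s. sweedler K TT AH.P (s \<bullet> (c ## g)) (tens K T T)"] lins_T S_comult_mult_tens)
       simp_all
  have 2: "sweedler K TT AH.P (s \<bullet> t) (tens K T T)
    = sweedler K TT AH.P s (\<lambda>x1 x2. sweedler K TT AH.P t (\<lambda>y1 y2.
        tens K T T (x1 \<bullet> y1) (x2 \<bullet> y2)))"
    if "s \<in> carrier T" "t \<in> carrier T" for s t
    using that
    by (intro ext[where t = t and f = "\<lambda>t. sweedler K TT AH.P (s \<bullet> t) (tens K T T)"] lins_T 1)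
       simp_all
  show "sweedler K (tensor_mod K S S) S (x \<bullet> y) (tens K S S)
      = sweedler K (tensor_mod K S S) S x (\<lambda>x1 x2. sweedler K (tensor_mod K S S) S y (\<lambda>y1 y2.
        tens K S S (x1 \<bullet> y1) (x2 \<bullet> y2)))"
    if "x \<in> carrier S" "y \<in> carrier S" for x y
    using 2[of x y] that by (simp add: S_simps)
  have "sweedler K TT AH.P (\<one>\<^bsub>A\<^esub> ## \<one>\<^bsub>H\<^esub>) (tens K T T) = tens K T T (\<one>\<^bsub>A\<^esub> ## \<one>\<^bsub>H\<^esub>) (\<one>\<^bsub>A\<^esub> ## \<one>\<^bsub>H\<^esub>)"
  proof -
    have "sweedler K TT AH.P (\<one>\<^bsub>A\<^esub> ## \<one>\<^bsub>H\<^esub>) (tens K T T)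
      = sweedler K TT A \<one>\<^bsub>A\<^esub> (\<lambda>a b. sweedler K TT H \<one>\<^bsub>H\<^esub> (\<lambda>x y. tens K T T (a ## x) (b ## y)))"
      by (intro AH.sw_tensor lins_T) simp_all
    also have "\<dots> = sweedler K TT H \<one>\<^bsub>H\<^esub> (\<lambda>x y. tens K T T (\<one>\<^bsub>A\<^esub> ## x) (\<one>\<^bsub>A\<^esub> ## y))"
      by (intro sw_one[OF bialgs(1)] lins_T) simp_all
    also have "\<dots> = tens K T T (\<one>\<^bsub>A\<^esub> ## \<one>\<^bsub>H\<^esub>) (\<one>\<^bsub>A\<^esub> ## \<one>\<^bsub>H\<^esub>)"
      by (intro sw_one[OF bialgs(2)] lins_T) simp_all
    finally show ?thesis .
  qed
  then show "comult S \<one>\<^bsub>S\<^esub> = tens K S S \<one>\<^bsub>S\<^esub> \<one>\<^bsub>S\<^esub>"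
    using comult_sw[OF AH.P_has_comult, of "\<one>\<^bsub>A\<^esub> ## \<one>\<^bsub>H\<^esub>"]
    by (simp add: S_simps S_one S_comult AH.P_simps)
  have 3: "counit AH.P (s \<bullet> (c ## g)) = counit AH.P s \<otimes>\<^bsub>K\<^esub> counit AH.P (c ## g)"
    if "s \<in> carrier T" "c \<in> carrier A" "g \<in> carrier H" for s c g
    using that
    by (intro ext'[where t = s and f = "\<lambda>s. counit AH.P (s \<bullet> (c ## g))"]
        AH.P_counit_compose lins_T S_counit_mult_tens) simp_all
  have 4: "counit AH.P (s \<bullet> t) = counit AH.P s \<otimes>\<^bsub>K\<^esub> counit AH.P t"
    if "s \<in> carrier T" "t \<in> carrier T" for s t
    using that
    by (intro ext'[where t = t and f = "\<lambda>t. counit AH.P (s \<bullet> t)"]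
        AH.P_counit_compose lins_T 3) simp_all
  show "counit S (x \<bullet> y) = counit S x \<otimes>\<^bsub>K\<^esub> counit S y" if "x \<in> carrier S" "y \<in> carrier S" for x y
    using 4[of x y] that by (simp add: S_simps)
  show "counit S \<one>\<^bsub>S\<^esub> = \<one>\<^bsub>K\<^esub>"
    by (simp add: S_simps S_one AH.counit_tens counit_one[OF bialgs(1)] counit_one[OF bialgs(2)])
qed

end

section \<open>Coalgebra maps into a tensor product\<close>

text \<open>
  The maps \<open>id \<otimes> \<epsilon>\<close> and \<open>\<epsilon> \<otimes> id\<close> on \<open>C \<otimes> D\<close>.
\<close>

definition proj1 where
  "proj1 K C D = tlift K C (\<lambda>c d. counit D d \<odot>\<^bsub>C\<^esub> c)"

definition proj2 where
  "proj2 K C D = tlift K D (\<lambda>c d. counit C c \<odot>\<^bsub>D\<^esub> d)"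

text \<open>
  The composite of \<open>f \<otimes> g\<close> with the comultiplication of \<open>E\<close>: the only candidate for a coalgebra map into
  \<open>C \<otimes> D\<close> with components \<open>f\<close> and \<open>g\<close>. It is one exactly if \<open>f\<close> and \<open>g\<close> commute in the following sense.
\<close>

definition conv_pair where
  "conv_pair K C D E f g e = sweedler K (tensor_mod K C D) E e (\<lambda>x y. tens K C D (f x) (g y))"

definition commuting where
  "commuting K C D E f g \<longleftrightarrow> (\<forall>e\<in>carrier E.
     sweedler K (tensor_mod K C D) E e (\<lambda>x y. tens K C D (f x) (g y))
     = sweedler K (tensor_mod K C D) E e (\<lambda>x y. tens K C D (f y) (g x)))"

lemma coalg_hom_counit: "coalg_hom K C D f \<Longrightarrow> c \<in> carrier C \<Longrightarrow> counit D (f c) = counit C c"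
  by (simp add: coalg_hom_def)

lemma coalg_hom_cong:
  assumes C: "has_comult K C" and f: "coalg_hom K C D f" and eq: "\<And>x. x \<in> carrier C \<Longrightarrow> g x = f x"
  shows "coalg_hom K C D g"
  unfolding coalg_hom_def
proof (intro conjI ballI)
  show "lin_map K C D g"
    by (rule lin_map_cong[OF has_comult_module[OF C] eq coalg_hom_lin[OF f]])
  show "counit D (g c) = counit C c" if "c \<in> carrier C" for c
    using f that by (simp add: eq coalg_hom_def)
  fix c assume c: "c \<in> carrier C"
  have "comult D (g c) = tmap K D D f f (comult C c)" using f c by (simp add: eq coalg_hom_def)
  also have "\<dots> = tmap K D D g g (comult C c)"
    unfolding tmap_comult_sw[OF C] by (intro sw_cong C c) (simp add: eq)
  finally show "comult D (g c) = tmap K D D g g (comult C c)" .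
qed

context coalg_pair
begin

abbreviation p1 where "p1 \<equiv> proj1 K C D"
abbreviation p2 where "p2 \<equiv> proj2 K C D"

lemma proj1_lin: "lin_map K CD C p1"
  unfolding proj1_def
  by (rule lin_tlift_arg[where M = C and N = D and f = "\<lambda>x. x"])
     ((intro bilin_mapI lin_basic)?; simp add: base module.smult_closed[OF base(5)])+

lemma proj2_lin: "lin_map K CD D p2"
  unfolding proj2_def
  by (rule lin_tlift_arg[where M = C and N = D and f = "\<lambda>x. x"])
     ((intro bilin_mapI lin_basic)?; simp add: base)+

lemma proj1_tens: "c \<in> carrier C \<Longrightarrow> d \<in> carrier D \<Longrightarrow> p1 (tens K C D c d) = counit D d \<odot>\<^bsub>C\<^esub> c"
  unfolding proj1_def by (rule tlift_tens) ((intro bilin_mapI lin_basic)?; simp add: base)+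

lemma proj2_tens: "c \<in> carrier C \<Longrightarrow> d \<in> carrier D \<Longrightarrow> p2 (tens K C D c d) = counit C c \<odot>\<^bsub>D\<^esub> d"
  unfolding proj2_def by (rule tlift_tens) ((intro bilin_mapI lin_basic)?; simp add: base)+

lemma lin_proj1: "lin_map K L CD f \<Longrightarrow> lin_map K L C (\<lambda>x. p1 (f x))"
  by (rule lin_map_compose[OF proj1_lin])

lemma lin_proj2: "lin_map K L CD f \<Longrightarrow> lin_map K L D (\<lambda>x. p2 (f x))"
  by (rule lin_map_compose[OF proj2_lin])

lemmas proj_closed = lin_map_closed[OF proj1_lin] lin_map_closed[OF proj2_lin]

lemmas pair_lins = bilin_mapI lin_CD_sw P_counit_compose lin_proj1 lin_proj2 lin_basic

lemma proj1_coalg_hom: "coalg_hom K P C p1"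
proof (rule coalg_homI[OF P_has_comult])
  note [simp] = base proj_closed proj1_tens counit_tens module.smult_closed[OF base(5)]
  let ?V = "tensor_mod K C C"
  let ?t = "tens K C C"
  let ?C = "sweedler K ?V C" and ?D = "sweedler K ?V D" and ?P = "sweedler K ?V P"
  interpret V: module K ?V by simp
  show "lin_map K P C p1" by (simp add: P_simps proj1_lin)
  note ext = tens_ext[where K = K and M = C and N = D and V = ?V]
  note ext' = tens_ext[where K = K and M = C and N = D and V = "ground K"]
  have 1: "?C (p1 (tens K C D c d)) (?t)
    = ?P (tens K C D c d) (\<lambda>x y. ?t (p1 x) (p1 y))"
    if [simp]: "c \<in> carrier C" "d \<in> carrier D" for c d
  proof -
    have "?P (tens K C D c d) (\<lambda>x y. ?t (p1 x) (p1 y))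
      = ?C c (\<lambda>c1 c2. ?D d (\<lambda>d1 d2.
          ?t (p1 (tens K C D c1 d1)) (p1 (tens K C D c2 d2))))"
      by (intro sw_tensor pair_lins) simp_all
    also have "\<dots> = ?C c (\<lambda>c1 c2. ?D d (\<lambda>d1 d2.
          counit D d1 \<odot>\<^bsub>?V\<^esub> ?t c1 (counit D d2 \<odot>\<^bsub>C\<^esub> c2)))"
      by (intro sw_cong) (simp_all add: lin_map_smult[OF lin_tens1[OF _ _ _ lin_map_id]])
    also have "\<dots> = ?C c (\<lambda>c1 c2. ?t c1 (counit D d \<odot>\<^bsub>C\<^esub> c2))"
      by (intro sw_cong sw_counit_left pair_lins) simp_all
    also have "\<dots> = ?C c (\<lambda>c1 c2. counit D d \<odot>\<^bsub>?V\<^esub> ?t c1 c2)"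
      by (intro sw_cong) (simp_all add: lin_map_smult[OF lin_tens2[OF _ _ _ lin_map_id]])
    also have "\<dots> = counit D d \<odot>\<^bsub>?V\<^esub> ?C c (?t)"
      by (intro sw_apply[symmetric] pair_lins) simp_all
    also have "\<dots> = ?C (counit D d \<odot>\<^bsub>C\<^esub> c) (?t)"
      by (intro lin_map_smult[OF lin_sw_arg[where C = C], symmetric] pair_lins) simp_all
    finally show ?thesis by simp
  qed
  show "?C (p1 t) (?t)
    = ?P t (\<lambda>x y. ?t (p1 x) (p1 y))" if "t \<in> carrier P" for t
    using that
    by (intro ext[where t = t and f = "\<lambda>t. ?C (p1 t) (?t)"] pair_lins 1)
       (simp_all add: P_simps)
  have 2: "counit C (counit D d \<odot>\<^bsub>C\<^esub> c) = counit C c \<otimes>\<^bsub>K\<^esub> counit D d"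
    if "c \<in> carrier C" "d \<in> carrier D" for c d
    using that lin_map_smult[OF C.counit_lin] by (simp add: C.R.m_comm)
  show "counit C (p1 t) = counit P t" if "t \<in> carrier P" for t
    using that
    by (intro ext'[where t = t and f = "\<lambda>t. counit C (p1 t)"] pair_lins)
       (simp_all add: P_simps 2)
qed (simp add: base)

lemma proj2_coalg_hom: "coalg_hom K P D p2"
proof (rule coalg_homI[OF P_has_comult])
  note [simp] = base proj_closed proj2_tens counit_tens module.smult_closed[OF base(6)]
  let ?V = "tensor_mod K D D"
  let ?t = "tens K D D"
  let ?C = "sweedler K ?V C" and ?D = "sweedler K ?V D" and ?P = "sweedler K ?V P"
  interpret V: module K ?V by simp
  show "lin_map K P D p2" by (simp add: P_simps proj2_lin)
  note ext = tens_ext[where K = K and M = C and N = D and V = ?V]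
  note ext' = tens_ext[where K = K and M = C and N = D and V = "ground K"]
  have 1: "?D (p2 (tens K C D c d)) (?t)
    = ?P (tens K C D c d) (\<lambda>x y. ?t (p2 x) (p2 y))"
    if [simp]: "c \<in> carrier C" "d \<in> carrier D" for c d
  proof -
    have "?P (tens K C D c d) (\<lambda>x y. ?t (p2 x) (p2 y))
      = ?C c (\<lambda>c1 c2. ?D d (\<lambda>d1 d2.
          ?t (p2 (tens K C D c1 d1)) (p2 (tens K C D c2 d2))))"
      by (intro sw_tensor pair_lins) simp_all
    also have "\<dots> = ?C c (\<lambda>c1 c2. ?D d (\<lambda>d1 d2.
          counit C c1 \<odot>\<^bsub>?V\<^esub> ?t d1 (counit C c2 \<odot>\<^bsub>D\<^esub> d2)))"
      by (intro sw_cong) (simp_all add: lin_map_smult[OF lin_tens1[OF _ _ _ lin_map_id]])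
    also have "\<dots> = ?C c (\<lambda>c1 c2. counit C c1 \<odot>\<^bsub>?V\<^esub> ?D d (\<lambda>d1 d2.
          ?t d1 (counit C c2 \<odot>\<^bsub>D\<^esub> d2)))"
      by (intro sw_cong sw_apply[symmetric] pair_lins) simp_all
    also have "\<dots> = ?D d (\<lambda>d1 d2. ?t d1 (counit C c \<odot>\<^bsub>D\<^esub> d2))"
      by (intro sw_counit_left pair_lins) simp_all
    also have "\<dots> = ?D d (\<lambda>d1 d2. counit C c \<odot>\<^bsub>?V\<^esub> ?t d1 d2)"
      by (intro sw_cong) (simp_all add: lin_map_smult[OF lin_tens2[OF _ _ _ lin_map_id]])
    also have "\<dots> = counit C c \<odot>\<^bsub>?V\<^esub> ?D d (?t)"
      by (intro sw_apply[symmetric] pair_lins) simp_all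
    also have "\<dots> = ?D (counit C c \<odot>\<^bsub>D\<^esub> d) (?t)"
      by (intro lin_map_smult[OF lin_sw_arg[where C = D], symmetric] pair_lins) simp_all
    finally show ?thesis by simp
  qed
  show "?D (p2 t) (?t)
    = ?P t (\<lambda>x y. ?t (p2 x) (p2 y))" if "t \<in> carrier P" for t
    using that
    by (intro ext[where t = t and f = "\<lambda>t. ?D (p2 t) (?t)"] pair_lins 1)
       (simp_all add: P_simps)
  have 2: "counit D (counit C c \<odot>\<^bsub>D\<^esub> d) = counit C c \<otimes>\<^bsub>K\<^esub> counit D d"
    if "c \<in> carrier C" "d \<in> carrier D" for c d
    using that lin_map_smult[OF D.counit_lin] by simp
  show "counit D (p2 t) = counit P t" if "t \<in> carrier P" for t
    using that
    by (intro ext'[where t = t and f = "\<lambda>t. counit D (p2 t)"] pair_lins)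
       (simp_all add: P_simps 2)
qed (simp add: base)

text \<open>
  For \<open>t = c \<otimes> d\<close> the left-hand sides are \<open>c\<^sub>1 \<epsilon>(d\<^sub>1) \<otimes> \<epsilon>(c\<^sub>2) d\<^sub>2\<close> and \<open>c\<^sub>2 \<epsilon>(d\<^sub>2) \<otimes> \<epsilon>(c\<^sub>1) d\<^sub>1\<close>. The two orders
  together are the reason why the components of a coalgebra map commute.
\<close>

lemma proj_recombine:
  assumes t: "t \<in> carrier CD"
  shows "sweedler K CD P t (\<lambda>x y. tens K C D (p1 x) (p2 y)) = t"
    and "sweedler K CD P t (\<lambda>x y. tens K C D (p1 y) (p2 x)) = t"
proof -
  let ?P = "sweedler K CD P" and ?C = "sweedler K CD C" and ?D = "sweedler K CD D"
  note [simp] = base proj_closed proj1_tens proj2_tens smult_simps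
  note ext = tens_ext[where K = K and M = C and N = D and V = CD and t = t and g = "\<lambda>t. t"]
  have 1: "?P (tens K C D c d) (\<lambda>x y. tens K C D (p1 x) (p2 y)) = tens K C D c d"
    if [simp]: "c \<in> carrier C" "d \<in> carrier D" for c d
  proof -
    have "?P (tens K C D c d) (\<lambda>x y. tens K C D (p1 x) (p2 y))
      = ?C c (\<lambda>c1 c2. ?D d (\<lambda>d1 d2. tens K C D (p1 (tens K C D c1 d1)) (p2 (tens K C D c2 d2))))"
      by (intro sw_tensor pair_lins) simp_all
    also have "\<dots> = ?C c (\<lambda>c1 c2. ?D d (\<lambda>d1 d2. tens K C D (counit C c2 \<odot>\<^bsub>C\<^esub> c1) (counit D d1 \<odot>\<^bsub>D\<^esub> d2)))"
      by (intro sw_cong) simp_all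
    also have "\<dots> = tens K C D c d" by (rule tensor_of_counits) (simp_all add: counit_laws)
    finally show ?thesis .
  qed
  have 2: "?P (tens K C D c d) (\<lambda>x y. tens K C D (p1 y) (p2 x)) = tens K C D c d"
    if [simp]: "c \<in> carrier C" "d \<in> carrier D" for c d
  proof -
    have "?P (tens K C D c d) (\<lambda>x y. tens K C D (p1 y) (p2 x))
      = ?C c (\<lambda>c1 c2. ?D d (\<lambda>d1 d2. tens K C D (p1 (tens K C D c2 d2)) (p2 (tens K C D c1 d1))))"
      by (intro sw_tensor pair_lins) simp_all
    also have "\<dots> = ?C c (\<lambda>c1 c2. ?D d (\<lambda>d1 d2. tens K C D (counit C c1 \<odot>\<^bsub>C\<^esub> c2) (counit D d2 \<odot>\<^bsub>D\<^esub> d1)))"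
      by (intro sw_cong) simp_all
    also have "\<dots> = tens K C D c d" by (rule tensor_of_counits) (simp_all add: counit_laws)
    finally show ?thesis .
  qed
  show "?P t (\<lambda>x y. tens K C D (p1 x) (p2 y)) = t" using t by (intro ext pair_lins 1) simp_all
  show "?P t (\<lambda>x y. tens K C D (p1 y) (p2 x)) = t" using t by (intro ext pair_lins 2) simp_all
qed

lemma sw_coalg_hom_P:
  assumes "has_comult K E" "module K V" "coalg_hom K E P \<phi>" "e \<in> carrier E" "bilin_map K CD CD V G"
  shows "sweedler K V P (\<phi> e) G = sweedler K V E e (\<lambda>x y. G (\<phi> x) (\<phi> y))"
  by (rule sw_coalg_hom[OF assms(1) P_has_comult assms(2,3,4)])
     (use assms(5) in \<open>simp add: bilin_map_def P_simps\<close>)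

text \<open>
  Recombine \<open>\<phi>(e)\<close> from its components, in either order, and move the comultiplication through \<open>\<phi>\<close>.
\<close>

lemma
  assumes E: "has_comult K E" and \<phi>: "coalg_hom K E P \<phi>"
  shows coalg_hom_conv_pair: "e \<in> carrier E \<Longrightarrow>
      \<phi> e = conv_pair K C D E (\<lambda>x. p1 (\<phi> x)) (\<lambda>x. p2 (\<phi> x)) e"
    and coalg_hom_commuting: "commuting K C D E (\<lambda>x. p1 (\<phi> x)) (\<lambda>x. p2 (\<phi> x))"
proof -
  note [simp] = base proj_closed
  have cl [simp]: "\<phi> e \<in> carrier CD" if "e \<in> carrier E" for e
    using lin_map_closed[OF coalg_hom_lin[OF \<phi>] that] by (simp add: P_simps)
  have 1: "\<phi> e = conv_pair K C D E (\<lambda>x. p1 (\<phi> x)) (\<lambda>x. p2 (\<phi> x)) e"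
    if e: "e \<in> carrier E" for e
  proof -
    have "\<phi> e = sweedler K CD P (\<phi> e) (\<lambda>x y. tens K C D (p1 x) (p2 y))"
      using e by (simp add: proj_recombine)
    also have "\<dots> = sweedler K CD E e (\<lambda>x y. tens K C D (p1 (\<phi> x)) (p2 (\<phi> y)))"
      using e by (intro sw_coalg_hom_P[OF E _ \<phi>] pair_lins) simp_all
    finally show ?thesis by (simp add: conv_pair_def)
  qed
  then show "e \<in> carrier E \<Longrightarrow>
      \<phi> e = conv_pair K C D E (\<lambda>x. p1 (\<phi> x)) (\<lambda>x. p2 (\<phi> x)) e" .
  show "commuting K C D E (\<lambda>x. p1 (\<phi> x)) (\<lambda>x. p2 (\<phi> x))"
    unfolding commuting_def
  proof
    fix e assume e: "e \<in> carrier E"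
    have "\<phi> e = sweedler K CD P (\<phi> e) (\<lambda>x y. tens K C D (p1 y) (p2 x))"
      using e by (simp add: proj_recombine)
    also have "\<dots> = sweedler K CD E e (\<lambda>x y. tens K C D (p1 (\<phi> y)) (p2 (\<phi> x)))"
      using e by (intro sw_coalg_hom_P[OF E _ \<phi>] pair_lins) simp_all
    finally show "sweedler K CD E e (\<lambda>x y. tens K C D (p1 (\<phi> x)) (p2 (\<phi> y)))
      = sweedler K CD E e (\<lambda>x y. tens K C D (p1 (\<phi> y)) (p2 (\<phi> x)))"
      using 1[OF e] by (simp add: conv_pair_def)
  qed
qed

lemma coalg_hom_eqI:
  assumes E: "has_comult K E" and \<phi>: "coalg_hom K E P \<phi>" and \<phi>': "coalg_hom K E P \<phi>'"
    and 1: "\<And>x. x \<in> carrier E \<Longrightarrow> p1 (\<phi> x) = p1 (\<phi>' x)"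
    and 2: "\<And>x. x \<in> carrier E \<Longrightarrow> p2 (\<phi> x) = p2 (\<phi>' x)"
    and e: "e \<in> carrier E"
  shows "\<phi> e = \<phi>' e"
  unfolding coalg_hom_conv_pair[OF E \<phi> e] coalg_hom_conv_pair[OF E \<phi>' e] conv_pair_def
  by (intro sw_cong E e) (simp add: 1 2)

lemma conv_pair_lin:
  assumes E: "has_comult K E" and f: "lin_map K E C f" and g: "lin_map K E D g"
  shows "lin_map K E CD (conv_pair K C D E f g)"
  unfolding conv_pair_def
  by (intro lin_sw_arg bilin_mapI lin_tens1 lin_tens2 f g lin_map_id E)
     (simp_all add: base lin_map_closed[OF f] lin_map_closed[OF g])

lemma commuting_apply:
  assumes E: "has_comult K E" and f: "lin_map K E C f" and g: "lin_map K E D g"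
    and com: "commuting K C D E f g" and e: "e \<in> carrier E"
    and V: "module K V" and G: "bilin_map K C D V G"
  shows "sweedler K V E e (\<lambda>x y. G (f x) (g y)) = sweedler K V E e (\<lambda>x y. G (f y) (g x))"
proof -
  note [simp] = base V lin_map_closed[OF f] lin_map_closed[OF g]
  have L: "lin_map K CD V (tlift K V G)"
    by (rule lin_tlift_arg[where M = C and N = D and f = "\<lambda>x. x"]) (simp_all add: G lin_map_id)
  have "sweedler K V E e (\<lambda>x y. G (f x) (g y)) = sweedler K V E e (\<lambda>x y. tlift K V G (tens K C D (f x) (g y)))"
    by (intro sw_cong E e) (simp add: tlift_tens G)
  also have "\<dots> = tlift K V G (sweedler K CD E e (\<lambda>x y. tens K C D (f x) (g y)))"
    by (intro sw_apply[symmetric] E e L) simp_all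
  also have "\<dots> = tlift K V G (sweedler K CD E e (\<lambda>x y. tens K C D (f y) (g x)))"
    using com e by (simp add: commuting_def)
  also have "\<dots> = sweedler K V E e (\<lambda>x y. tlift K V G (tens K C D (f y) (g x)))"
    by (intro sw_apply E e L) simp_all
  also have "\<dots> = sweedler K V E e (\<lambda>x y. G (f y) (g x))"
    by (intro sw_cong E e) (simp add: tlift_tens G)
  finally show ?thesis .
qed

lemma proj_conv_pair:
  assumes E: "coalgebra K E" and f: "coalg_hom K E C f" and g: "coalg_hom K E D g" and e: "e \<in> carrier E"
  shows "p1 (conv_pair K C D E f g e) = f e" "p2 (conv_pair K C D E f g e) = g e"
proof -
  note [simp] = base E e lin_map_closed[OF coalg_hom_lin[OF f]] lin_map_closed[OF coalg_hom_lin[OF g]]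
    coalgebra_has_comult[OF E] coalg_hom_counit[OF f] coalg_hom_counit[OF g]
  have "p1 (conv_pair K C D E f g e) = sweedler K C E e (\<lambda>x y. p1 (tens K C D (f x) (g y)))"
    unfolding conv_pair_def by (intro sw_apply proj1_lin) simp_all
  also have "\<dots> = sweedler K C E e (\<lambda>x y. counit E y \<odot>\<^bsub>C\<^esub> f x)"
    by (intro sw_cong) (simp_all add: proj1_tens)
  also have "\<dots> = f e" by (intro sw_counit_right coalg_hom_lin[OF f]) simp_all
  finally show "p1 (conv_pair K C D E f g e) = f e" .
  have "p2 (conv_pair K C D E f g e) = sweedler K D E e (\<lambda>x y. p2 (tens K C D (f x) (g y)))"
    unfolding conv_pair_def by (intro sw_apply proj2_lin) simp_all
  also have "\<dots> = sweedler K D E e (\<lambda>x y. counit E x \<odot>\<^bsub>D\<^esub> g y)"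
    by (intro sw_cong) (simp_all add: proj2_tens)
  also have "\<dots> = g e" by (intro sw_counit_left coalg_hom_lin[OF g]) simp_all
  finally show "p2 (conv_pair K C D E f g e) = g e" .
qed

text \<open>
  The comultiplication of \<open>f(e\<^sub>1) \<otimes> g(e\<^sub>2)\<close> is \<open>f(e\<^sub>1) \<otimes> g(e\<^sub>3) \<otimes> f(e\<^sub>2) \<otimes> g(e\<^sub>4)\<close>. Exchanging \<open>e\<^sub>2\<close> and \<open>e\<^sub>3\<close>,
  as the commutation of \<open>f\<close> and \<open>g\<close> permits, gives what is wanted.
\<close>

lemma conv_pair_coalg_hom:
  assumes E: "coalgebra K E" and f: "coalg_hom K E C f" and g: "coalg_hom K E D g"
    and com: "commuting K C D E f g"
  shows "coalg_hom K E P (conv_pair K C D E f g)"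
proof (rule coalg_homI[OF _ P_has_comult])
  let ?\<phi> = "conv_pair K C D E f g"
  note fl = coalg_hom_lin[OF f] and gl = coalg_hom_lin[OF g]
  note [simp] = base E lin_map_closed[OF fl] lin_map_closed[OF gl]
    coalgebra_has_comult[OF E] coalgebra_module[OF E] coalg_hom_counit[OF f] coalg_hom_counit[OF g] counit_tens
  note pl = conv_pair_lin[OF coalgebra_has_comult[OF E] fl gl]
  note [simp] = lin_map_closed[OF pl]
  let ?W = "tensor_mod K CD CD"
  let ?t = "tens K CD CD"
  let ?E = "sweedler K ?W E" and ?P = "sweedler K ?W P" and ?C = "sweedler K ?W C" and ?D = "sweedler K ?W D"
  note lins = bilin_mapI lin_map_compose[OF fl] lin_map_compose[OF gl] lin_sw_arg[of K E] lin_sw_param[of K E]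
     lin_CD_sw lin_basic
  show "has_comult K E" by simp
  show "lin_map K E P (?\<phi>)" using pl by (simp add: P_simps)
  fix e assume e [simp]: "e \<in> carrier E"
  have "counit P (?\<phi> e) = sweedler K (ground K) E e (\<lambda>x y. counit P (tens K C D (f x) (g y)))"
    unfolding conv_pair_def by (intro sw_apply P_counit_lin) simp_all
  also have "\<dots> = sweedler K (ground K) E e (\<lambda>x y. counit E x \<odot>\<^bsub>ground K\<^esub> counit E y)"
    by (intro sw_cong) simp_all
  also have "\<dots> = counit E e"
    by (intro sw_counit_left coalgebra.counit_lin[OF E]) simp_all
  finally show "counit P (?\<phi> e) = counit E e" .
  let ?Q = "\<lambda>x y z w. ?t (tens K C D (f x) (g y)) (tens K C D (f z) (g w))"
  have "?P (?\<phi> e) (?t)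
    = ?E e (\<lambda>e1 e2. ?P (tens K C D (f e1) (g e2)) (?t))"
    unfolding conv_pair_def by (intro sw_apply pair_lins) simp_all
  also have "\<dots> = ?E e (\<lambda>e1 e2. ?C (f e1) (\<lambda>c1 c2. ?D (g e2) (\<lambda>d1 d2.
      ?t (tens K C D c1 d1) (tens K C D c2 d2))))"
    by (intro sw_cong sw_tensor pair_lins) simp_all
  also have "\<dots> = ?E e (\<lambda>e1 e2. ?E e1 (\<lambda>x z. ?D (g e2) (\<lambda>d1 d2.
      ?t (tens K C D (f x) d1) (tens K C D (f z) d2))))"
    by (intro sw_cong sw_coalg_hom[OF _ _ _ f] pair_lins) simp_all
  also have "\<dots> = ?E e (\<lambda>e1 e2. ?E e1 (\<lambda>x z. ?E e2 (\<lambda>y w. ?Q x y z w)))"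
    by (intro sw_cong sw_coalg_hom[OF _ _ _ g] pair_lins) simp_all
  also have "\<dots> = ?E e (\<lambda>x e'. ?E e' (\<lambda>m w. ?E m (\<lambda>z y. ?Q x y z w)))"
    by (rule sw4_middle) ((intro lins)?; simp)+
  also have "\<dots> = ?E e (\<lambda>x e'. ?E e' (\<lambda>m w. ?E m (\<lambda>y z. ?Q x y z w)))"
    by (intro sw_cong commuting_apply[OF _ fl gl com, where G = "\<lambda>c d. ?t (tens K C D _ d) (tens K C D c _)"]
        pair_lins) simp_all
  also have "\<dots> = ?E e (\<lambda>e1 e2. ?E e1 (\<lambda>x y. ?E e2 (\<lambda>z w. ?Q x y z w)))"
    by (rule sw4_middle[symmetric]) ((intro lins)?; simp)+
  also have "\<dots> = ?E e (\<lambda>e1 e2. ?E e1 (\<lambda>x y.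
      ?t (tens K C D (f x) (g y)) (?\<phi> e2)))"
    unfolding conv_pair_def by (intro sw_cong sw_apply[symmetric] lins) simp_all
  also have "\<dots> = ?E e (\<lambda>e1 e2. ?t (?\<phi> e1) (?\<phi> e2))"
    unfolding conv_pair_def[of K C D E f g "_ :: _"]
    by (intro sw_cong sw_apply[symmetric, where f = "\<lambda>z. ?t z _"] lins) simp_all
  finally show "sweedler K (tensor_mod K P P) P (?\<phi> e) (tens K P P)
    = sweedler K (tensor_mod K P P) E e (\<lambda>x y. tens K P P (?\<phi> x) (?\<phi> y))"
    by (simp add: P_simps)
qed

text \<open>
  This is where multiplicativity of the comultiplication of \<open>B\<close> enters: it says that multiplication
  \<open>B \<otimes> B \<rightarrow> B\<close> is a coalgebra map.
\<close>

lemma mult_coalg_hom: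
  assumes B: "bialgebra K B" and \<alpha>: "coalg_hom K C B \<alpha>" and \<beta>: "coalg_hom K D B \<beta>"
  shows "coalg_hom K P B (tlift K B (\<lambda>c d. \<alpha> c \<otimes>\<^bsub>B\<^esub> \<beta> d))"
    and "\<And>c d. c \<in> carrier C \<Longrightarrow> d \<in> carrier D \<Longrightarrow>
      tlift K B (\<lambda>c d. \<alpha> c \<otimes>\<^bsub>B\<^esub> \<beta> d) (tens K C D c d) = \<alpha> c \<otimes>\<^bsub>B\<^esub> \<beta> d"
proof -
  interpret B: bialgebra K B by fact
  note al = coalg_hom_lin[OF \<alpha>] and bl = coalg_hom_lin[OF \<beta>]
  note [simp] = base B bialgebra_algebra[OF B] bialgebra_coalgebra[OF B]
    coalgebra_has_comult[OF bialgebra_coalgebra[OF B]] coalgebra_module[OF bialgebra_coalgebra[OF B]]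
    lin_map_closed[OF al] lin_map_closed[OF bl]
    coalg_hom_counit[OF \<alpha>] coalg_hom_counit[OF \<beta>] counit_tens counit_mult[OF B]
  let ?V = "tensor_mod K B B"
  let ?t = "tens K B B"
  let ?C = "sweedler K ?V C" and ?D = "sweedler K ?V D" and ?P = "sweedler K ?V P" and ?B = "sweedler K ?V B"
  let ?m = "tlift K B (\<lambda>c d. \<alpha> c \<otimes>\<^bsub>B\<^esub> \<beta> d)"
  note lins = pair_lins lin_sw_arg[of K B] lin_sw_param[of K B] lin_map_compose[OF al] lin_map_compose[OF bl]
  have b: "bilin_map K C D B (\<lambda>c d. \<alpha> c \<otimes>\<^bsub>B\<^esub> \<beta> d)"
    by (intro bilin_mapI lin_mult1 lin_mult2 al bl) simp_all
  have m: "lin_map K CD B ?m"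
    by (rule lin_tlift_arg[where M = C and N = D and f = "\<lambda>x. x"]) (simp_all add: b lin_map_id)
  show ev: "?m (tens K C D c d) = \<alpha> c \<otimes>\<^bsub>B\<^esub> \<beta> d" if "c \<in> carrier C" "d \<in> carrier D" for c d
    using that by (simp add: tlift_tens b)
  note [simp] = ev lin_map_closed[OF m]
  have 1: "?B (?m (tens K C D c d)) (?t)
    = ?P (tens K C D c d) (\<lambda>x y. ?t (?m x) (?m y))"
    if [simp]: "c \<in> carrier C" "d \<in> carrier D" for c d
  proof -
    have "?P (tens K C D c d) (\<lambda>x y. ?t (?m x) (?m y))
      = ?C c (\<lambda>c1 c2. ?D d (\<lambda>d1 d2. ?t (?m (tens K C D c1 d1)) (?m (tens K C D c2 d2))))"
      by (intro sw_tensor bilin_mapI lin_tens1 lin_tens2 m) simp_all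
    also have "\<dots> = ?C c (\<lambda>c1 c2. ?D d (\<lambda>d1 d2. ?t (\<alpha> c1 \<otimes>\<^bsub>B\<^esub> \<beta> d1) (\<alpha> c2 \<otimes>\<^bsub>B\<^esub> \<beta> d2)))"
      by (intro sw_cong) simp_all
    also have "\<dots> = ?C c (\<lambda>c1 c2. ?B (\<beta> d) (\<lambda>y1 y2. ?t (\<alpha> c1 \<otimes>\<^bsub>B\<^esub> y1) (\<alpha> c2 \<otimes>\<^bsub>B\<^esub> y2)))"
      by (intro sw_cong sw_coalg_hom[OF _ _ _ \<beta>, symmetric] lins) simp_all
    also have "\<dots> = ?B (\<alpha> c) (\<lambda>x1 x2. ?B (\<beta> d) (\<lambda>y1 y2. ?t (x1 \<otimes>\<^bsub>B\<^esub> y1) (x2 \<otimes>\<^bsub>B\<^esub> y2)))"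
      by (intro sw_coalg_hom[OF _ _ _ \<alpha>, symmetric] lins) simp_all
    also have "\<dots> = ?B (\<alpha> c \<otimes>\<^bsub>B\<^esub> \<beta> d) (?t)"
      by (intro sw_mult[OF B, symmetric] lins) simp_all
    finally show ?thesis by simp
  qed
  note ext = tens_ext[where K = K and M = C and N = D and V = ?V]
  note ext' = tens_ext[where K = K and M = C and N = D and V = "ground K"]
  show "coalg_hom K P B ?m"
  proof (rule coalg_homI[OF P_has_comult])
    show "lin_map K P B ?m" using m by (simp add: P_simps)
    show "?B (?m t) (?t) = ?P t (\<lambda>x y. ?t (?m x) (?m y))"
      if "t \<in> carrier P" for t
      using that
      by (intro ext[where t = t and f = "\<lambda>t. ?B (?m t) (?t)"]
          lin_sw_arg[of K B] bilin_mapI lin_tens1 lin_tens2 lin_map_id m lin_sw_P 1) (simp_all add: P_simps)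
    show "counit B (?m t) = counit P t" if "t \<in> carrier P" for t
      using that
      by (intro ext'[where t = t and f = "\<lambda>t. counit B (?m t)"] lin_counit m P_counit_lin) (simp_all add: P_simps)
  qed simp
qed

end

section \<open>Hopf algebra maps into and out of a smash product\<close>

lemma alg_hom_lin: "alg_hom K A B f \<Longrightarrow> lin_map K A B f"
  by (simp add: alg_hom_def)

lemma alg_hom_mult:
  "alg_hom K A B f \<Longrightarrow> x \<in> carrier A \<Longrightarrow> y \<in> carrier A \<Longrightarrow> f (x \<otimes>\<^bsub>A\<^esub> y) = f x \<otimes>\<^bsub>B\<^esub> f y"
  by (simp add: alg_hom_def)

lemma alg_hom_one: "alg_hom K A B f \<Longrightarrow> f \<one>\<^bsub>A\<^esub> = \<one>\<^bsub>B\<^esub>"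
  by (simp add: alg_hom_def)

lemma hopf_homD: "hopf_hom K A B f \<Longrightarrow> alg_hom K A B f" "hopf_hom K A B f \<Longrightarrow> coalg_hom K A B f"
  by (simp_all add: hopf_hom_def)

lemma hopf_homI:
  assumes "coalg_hom K A B f"
    and "\<And>x y. x \<in> carrier A \<Longrightarrow> y \<in> carrier A \<Longrightarrow> f (x \<otimes>\<^bsub>A\<^esub> y) = f x \<otimes>\<^bsub>B\<^esub> f y"
    and "f \<one>\<^bsub>A\<^esub> = \<one>\<^bsub>B\<^esub>"
  shows "hopf_hom K A B f"
  using assms by (simp add: hopf_hom_def alg_hom_def coalg_hom_lin)

lemma bialgebra_has_comult: "bialgebra K A \<Longrightarrow> has_comult K A"
  by (intro coalgebra_has_comult bialgebra_coalgebra)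

lemma bialgebra_closed:
  assumes "bialgebra K A"
  shows "x \<in> carrier A \<Longrightarrow> y \<in> carrier A \<Longrightarrow> x \<otimes>\<^bsub>A\<^esub> y \<in> carrier A" "\<one>\<^bsub>A\<^esub> \<in> carrier A"
proof -
  interpret bialgebra K A by fact
  show "x \<in> carrier A \<Longrightarrow> y \<in> carrier A \<Longrightarrow> x \<otimes>\<^bsub>A\<^esub> y \<in> carrier A" "\<one>\<^bsub>A\<^esub> \<in> carrier A" by simp_all
qed

lemma hopf_hom_cong:
  assumes A: "bialgebra K A" and f: "hopf_hom K A B f" and eq: "\<And>x. x \<in> carrier A \<Longrightarrow> g x = f x"
  shows "hopf_hom K A B g"
  using alg_hom_mult[OF hopf_homD(1)[OF f]] alg_hom_one[OF hopf_homD(1)[OF f]]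
  by (intro hopf_homI coalg_hom_cong[OF bialgebra_has_comult[OF A] hopf_homD(2)[OF f]])
     (simp_all add: eq bialgebra_closed[OF A])

lemma hopf_hom_compose:
  assumes A: "bialgebra K A" and B: "bialgebra K B" and C: "bialgebra K C"
    and f: "hopf_hom K A B f" and g: "hopf_hom K B C g"
  shows "hopf_hom K A C (\<lambda>x. g (f x))"
  using coalg_hom_compose[OF bialgebra_has_comult[OF A] bialgebra_has_comult[OF B] bialgebra_has_comult[OF C]
      hopf_homD(2)[OF f] hopf_homD(2)[OF g]]
    lin_map_closed[OF alg_hom_lin[OF hopf_homD(1)[OF f]]]
  by (intro hopf_homI)
     (simp_all add: alg_hom_mult[OF hopf_homD(1)[OF f]] alg_hom_mult[OF hopf_homD(1)[OF g]]
       alg_hom_one[OF hopf_homD(1)[OF f]] alg_hom_one[OF hopf_homD(1)[OF g]])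

lemma coalg_hom_id: "has_comult K C \<Longrightarrow> coalg_hom K C C (\<lambda>x. x)"
  by (rule coalg_homI) (simp_all add: lin_map_id)

context semidirect_action
begin

lemma S_coalg_cod: "coalg_hom K E S f \<longleftrightarrow> coalg_hom K E AH.P f"
  by (simp add: coalg_hom_def tmap_def S_simps AH.P_simps S_comult)

lemma S_coalg_dom: "coalg_hom K S E f \<longleftrightarrow> coalg_hom K AH.P E f"
  by (simp add: coalg_hom_def S_simps AH.P_simps S_comult)

lemma proj1_mult_left:
  assumes "a \<in> carrier A" "h \<in> carrier H" "t \<in> carrier T"
  shows "AH.p1 ((a ## h) \<bullet> t) = a \<cdot> (h \<rhd> AH.p1 t)"
proof -
  note [simp] = facts S_closed AH.proj1_tens AH.proj_closed assms
  have 1: "AH.p1 ((a ## h) \<bullet> (c ## g)) = a \<cdot> (h \<rhd> AH.p1 (c ## g))"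
    if [simp]: "c \<in> carrier A" "g \<in> carrier H" for c g
  proof -
    have "AH.p1 ((a ## h) \<bullet> (c ## g))
      = sweedler K A H h (\<lambda>h1 h2. AH.p1 (a \<cdot> (h1 \<rhd> c) ## h2 \<star> g))"
      by (intro S_mult_tens_apply AH.proj1_lin) simp_all
    also have "\<dots> = sweedler K A H h (\<lambda>h1 h2. counit H h2 \<odot>\<^bsub>A\<^esub> (a \<cdot> (h1 \<rhd> (counit H g \<odot>\<^bsub>A\<^esub> c))))"
      by (intro sw_cong)
         (simp_all add: lin_map_smult[OF lin_act2[OF _ lin_map_id]] A.smult_mult_right A.smult_assoc1)
    also have "\<dots> = a \<cdot> (h \<rhd> (counit H g \<odot>\<^bsub>A\<^esub> c))"
      by (intro sw_counit_right lins) simp_all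
    finally show ?thesis by simp
  qed
  show ?thesis
    by (rule tens_ext[where K = K and M = A and N = H and V = A and t = t
          and f = "\<lambda>t. AH.p1 ((a ## h) \<bullet> t)"])
       ((intro AH.lin_proj1 lins_T 1)?; simp)+
qed

lemma proj2_mult:
  assumes "s \<in> carrier T" "t \<in> carrier T"
  shows "AH.p2 (s \<bullet> t) = AH.p2 s \<star> AH.p2 t"
proof -
  note [simp] = facts S_closed AH.proj2_tens AH.proj_closed
  have 1: "AH.p2 ((a ## h) \<bullet> (c ## g)) = AH.p2 (a ## h) \<star> AH.p2 (c ## g)"
    if [simp]: "a \<in> carrier A" "h \<in> carrier H" "c \<in> carrier A" "g \<in> carrier H" for a h c g
  proof -
    have "AH.p2 ((a ## h) \<bullet> (c ## g))
      = sweedler K H H h (\<lambda>h1 h2. AH.p2 (a \<cdot> (h1 \<rhd> c) ## h2 \<star> g))"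
      by (intro S_mult_tens_apply AH.proj2_lin) simp_all
    also have "\<dots> = sweedler K H H h (\<lambda>h1 h2. counit H h1 \<odot>\<^bsub>H\<^esub>
        ((counit A a \<odot>\<^bsub>H\<^esub> h2) \<star> (counit A c \<odot>\<^bsub>H\<^esub> g)))"
      by (intro sw_cong)
         (simp_all add: counit_act H.smult_mult_right H.smult_mult_left H.smult_assoc1[symmetric] H.R.m_ac)
    also have "\<dots> = (counit A a \<odot>\<^bsub>H\<^esub> h) \<star> (counit A c \<odot>\<^bsub>H\<^esub> g)"
      by (intro sw_counit_left lins) simp_all
    finally show ?thesis by simp
  qed
  have 2: "AH.p2 ((a ## h) \<bullet> t) = AH.p2 (a ## h) \<star> AH.p2 t"
    if "a \<in> carrier A" "h \<in> carrier H" "t \<in> carrier T" for a h t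
    by (rule tens_ext[where K = K and M = A and N = H and V = H and t = t
          and f = "\<lambda>t. AH.p2 ((a ## h) \<bullet> t)"])
       ((intro AH.lin_proj2 lins_T 1)?; simp add: that)+
  show ?thesis
    by (rule tens_ext[where K = K and M = A and N = H and V = H and t = s
          and f = "\<lambda>s. AH.p2 (s \<bullet> t)"])
       ((intro AH.lin_proj2 lins_T 2)?; simp add: assms)+
qed

lemma proj_one: "AH.p1 \<one>\<^bsub>S\<^esub> = \<one>\<^bsub>A\<^esub>" "AH.p2 \<one>\<^bsub>S\<^esub> = \<one>\<^bsub>H\<^esub>"
  by (simp_all add: S_one AH.proj1_tens AH.proj2_tens counit_one[OF bialgs(1)] counit_one[OF bialgs(2)])

lemma proj1_conv_pair_mult:
  assumes E: "has_comult K E" and f: "lin_map K E A f" and g: "lin_map K E H g"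
    and e: "e \<in> carrier E" and t: "t \<in> carrier T"
  shows "AH.p1 (conv_pair K A H E f g e \<bullet> t)
    = sweedler K A E e (\<lambda>x y. f x \<cdot> (g y \<rhd> AH.p1 t))"
proof -
  note [simp] = facts S_closed E e t lin_map_closed[OF f] lin_map_closed[OF g]
  have "AH.p1 (conv_pair K A H E f g e \<bullet> t)
    = sweedler K A E e (\<lambda>x y. AH.p1 ((f x ## g y) \<bullet> t))"
    unfolding conv_pair_def
    by (rule sw_apply[where f = "\<lambda>z. AH.p1 (z \<bullet> t)"]) ((intro AH.lin_proj1 lins_T)?; simp)+
  also have "\<dots> = sweedler K A E e (\<lambda>x y. f x \<cdot> (g y \<rhd> AH.p1 t))"
    by (intro sw_cong) (simp_all add: proj1_mult_left)
  finally show ?thesis .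
qed

lemma conv_pair_mult:
  assumes E: "coalgebra K E" and E': "coalgebra K E'"
    and f: "lin_map K E A f" and g: "coalg_hom K E H g" and f': "lin_map K E' A f'" and g': "lin_map K E' H g'"
    and [simp]: "b \<in> carrier E" "c \<in> carrier E'"
  shows "conv_pair K A H E f g b \<bullet> conv_pair K A H E' f' g' c
    = sweedler K T E b (\<lambda>b1 b'. sweedler K T E b' (\<lambda>b2 b3. sweedler K T E' c (\<lambda>c1 c2.
        f b1 \<cdot> (g b2 \<rhd> f' c1) ## g b3 \<star> g' c2)))"
proof -
  note gl = coalg_hom_lin[OF g]
  note [simp] = facts S_closed E E' coalgebra_has_comult[OF E] coalgebra_has_comult[OF E']
    coalgebra_module[OF E] coalgebra_module[OF E']
    lin_map_closed[OF f] lin_map_closed[OF gl] lin_map_closed[OF f'] lin_map_closed[OF g']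
    lin_map_closed[OF AH.conv_pair_lin[OF coalgebra_has_comult[OF E'] f' g']]
  have "conv_pair K A H E f g b \<bullet> conv_pair K A H E' f' g' c
    = sweedler K T E b (\<lambda>b1 b2. (f b1 ## g b2) \<bullet> conv_pair K A H E' f' g' c)"
    unfolding conv_pair_def[of K A H E f g b]
    by (rule sw_apply[where f = "\<lambda>z. z \<bullet> conv_pair K A H E' f' g' c"]) ((intro lins_T)?; simp)+
  also have "\<dots> = sweedler K T E b (\<lambda>b1 b2. sweedler K T E' c (\<lambda>c1 c2. (f b1 ## g b2) \<bullet> (f' c1 ## g' c2)))"
    unfolding conv_pair_def[of K A H E' f' g' c]
    by (intro sw_cong sw_apply lins_T) simp_all
  also have "\<dots> = sweedler K T E b (\<lambda>b1 b2. sweedler K T E' c (\<lambda>c1 c2. sweedler K T H (g b2) (\<lambda>x y.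
      f b1 \<cdot> (x \<rhd> f' c1) ## y \<star> g' c2)))"
    by (intro sw_cong S_mult_tens) simp_all
  also have "\<dots> = sweedler K T E b (\<lambda>b1 b'. sweedler K T E' c (\<lambda>c1 c2. sweedler K T E b' (\<lambda>b2 b3.
      f b1 \<cdot> (g b2 \<rhd> f' c1) ## g b3 \<star> g' c2)))"
    by (intro sw_cong sw_coalg_hom[OF _ _ _ g] lins) simp_all
  also have "\<dots> = sweedler K T E b (\<lambda>b1 b'. sweedler K T E b' (\<lambda>b2 b3. sweedler K T E' c (\<lambda>c1 c2.
      f b1 \<cdot> (g b2 \<rhd> f' c1) ## g b3 \<star> g' c2)))"
    by (intro sw_cong sw_swap) simp_all
  finally show ?thesis .
qed

text \<open>
  For multiplicativity, \<open>?l\<close> and \<open>\<phi> \<circ> ?m\<close> are coalgebra maps \<open>E \<otimes> E \<rightarrow> A # H\<close> with the same components: the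
  first components agree by the formula for \<open>f(bc)\<close>, the second ones because \<open>g\<close> is multiplicative.
\<close>

lemma conv_pair_hopf_hom:
  assumes E: "bialgebra K E" and f: "coalg_hom K E A f" and f1: "f \<one>\<^bsub>E\<^esub> = \<one>\<^bsub>A\<^esub>" and g: "hopf_hom K E H g"
    and com: "commuting K A H E f g"
    and fm: "\<And>b c. b \<in> carrier E \<Longrightarrow> c \<in> carrier E \<Longrightarrow>
      f (b \<otimes>\<^bsub>E\<^esub> c) = sweedler K A E b (\<lambda>b1 b2. f b1 \<cdot> (g b2 \<rhd> f c))"
  shows "hopf_hom K E S (conv_pair K A H E f g)"
proof -
  note Ec = bialgebra_coalgebra[OF E] and Eh = bialgebra_has_comult[OF E]
  interpret EE: coalg_pair K E E using Ec by (simp add: coalg_pair_def)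
  let ?\<phi> = "conv_pair K A H E f g"
  note gc = hopf_homD(2)[OF g] and ga = hopf_homD(1)[OF g]
  note fl = coalg_hom_lin[OF f] and gl = coalg_hom_lin[OF gc]
  note [simp] = facts S_closed Ec Eh coalgebra_module[OF Ec] bialgebra_closed[OF E] bialgebra_algebra[OF E]
    lin_map_closed[OF fl] lin_map_closed[OF gl]
  have \<phi>: "coalg_hom K E AH.P ?\<phi>" by (rule AH.conv_pair_coalg_hom[OF Ec f gc com])
  note pl = AH.conv_pair_lin[OF Eh fl gl]
  note [simp] = lin_map_closed[OF pl] AH.proj_conv_pair[OF Ec f gc]
  let ?l = "tlift K S (\<lambda>b c. ?\<phi> b \<bullet> ?\<phi> c)" and ?m = "tlift K E (\<lambda>b c. b \<otimes>\<^bsub>E\<^esub> c)"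
  have \<phi>': "coalg_hom K E S ?\<phi>" using \<phi> by (simp add: S_coalg_cod)
  have l: "coalg_hom K EE.P AH.P ?l" and lt: "\<And>b c. b \<in> carrier E \<Longrightarrow> c \<in> carrier E \<Longrightarrow>
      ?l (tens K E E b c) = ?\<phi> b \<bullet> ?\<phi> c"
    using EE.mult_coalg_hom[OF S_bialgebra \<phi>' \<phi>'] by (simp_all add: S_coalg_cod)
  have m: "coalg_hom K EE.P E ?m" and mt: "\<And>b c. b \<in> carrier E \<Longrightarrow> c \<in> carrier E \<Longrightarrow>
      ?m (tens K E E b c) = b \<otimes>\<^bsub>E\<^esub> c"
    using EE.mult_coalg_hom[OF E coalg_hom_id[OF Eh] coalg_hom_id[OF Eh]] by simp_all
  have r: "coalg_hom K EE.P AH.P (\<lambda>t. ?\<phi> (?m t))"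
    by (rule coalg_hom_compose[OF EE.P_has_comult Eh AH.P_has_comult m \<phi>])
  have ll: "lin_map K EE.CD T ?l" and rl: "lin_map K EE.CD T (\<lambda>t. ?\<phi> (?m t))"
    using coalg_hom_lin[OF l] coalg_hom_lin[OF r] by (simp_all add: EE.P_simps AH.P_simps)
  have "?\<phi> (b \<otimes>\<^bsub>E\<^esub> c) = ?\<phi> b \<bullet> ?\<phi> c" if [simp]: "b \<in> carrier E" "c \<in> carrier E" for b c
  proof -
    have "?\<phi> (?m (tens K E E b c)) = ?l (tens K E E b c)"
    proof (rule AH.coalg_hom_eqI[OF EE.P_has_comult r l])
      show "AH.p1 (?\<phi> (?m t)) = AH.p1 (?l t)" if "t \<in> carrier EE.P" for t
        by (rule tens_ext[where K = K and M = E and N = E and V = A and t = t])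
           ((intro AH.lin_proj1 ll rl)?; use that in \<open>simp add: EE.P_simps lt mt fm
             proj1_conv_pair_mult[OF Eh fl gl]\<close>)+
      show "AH.p2 (?\<phi> (?m t)) = AH.p2 (?l t)" if "t \<in> carrier EE.P" for t
        by (rule tens_ext[where K = K and M = E and N = E and V = H and t = t])
           ((intro AH.lin_proj2 ll rl)?; use that in \<open>simp add: EE.P_simps lt mt proj2_mult alg_hom_mult[OF ga]\<close>)+
      show "tens K E E b c \<in> carrier EE.P" by (simp add: EE.P_simps)
    qed
    then show ?thesis by (simp add: lt mt)
  qed
  moreover have "?\<phi> \<one>\<^bsub>E\<^esub> = \<one>\<^bsub>S\<^esub>"
  proof -
    have "?\<phi> \<one>\<^bsub>E\<^esub> = f \<one>\<^bsub>E\<^esub> ## g \<one>\<^bsub>E\<^esub>"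
      unfolding conv_pair_def by (intro sw_one[OF E] bilin_mapI lin_tens1 lin_tens2 fl gl) simp_all
    then show ?thesis by (simp add: f1 alg_hom_one[OF ga] S_one)
  qed
  ultimately show ?thesis by (intro hopf_homI \<phi>')
qed

text \<open>
  Conversely, the formula for \<open>f(bc)\<close> is the first component of \<open>\<phi>(b)\<phi>(c)\<close>. The maps \<open>f\<close> and \<open>g\<close> are only
  prescribed on the carrier, so that restrictions to it are covered.
\<close>

lemma hopf_hom_components:
  assumes E: "bialgebra K E" and \<phi>: "hopf_hom K E S \<phi>"
    and f: "\<And>x. x \<in> carrier E \<Longrightarrow> f x = AH.p1 (\<phi> x)" and g: "\<And>x. x \<in> carrier E \<Longrightarrow> g x = AH.p2 (\<phi> x)"
  shows "coalg_hom K E A f" "f \<one>\<^bsub>E\<^esub> = \<one>\<^bsub>A\<^esub>" "hopf_hom K E H g" "commuting K A H E f g"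
    and "\<And>e. e \<in> carrier E \<Longrightarrow> conv_pair K A H E f g e = \<phi> e"
    and "\<And>b c. b \<in> carrier E \<Longrightarrow> c \<in> carrier E \<Longrightarrow>
      f (b \<otimes>\<^bsub>E\<^esub> c) = sweedler K A E b (\<lambda>b1 b2. f b1 \<cdot> (g b2 \<rhd> f c))"
proof -
  note Ec = bialgebra_coalgebra[OF E] and Eh = bialgebra_has_comult[OF E]
  note \<phi>a = hopf_homD(1)[OF \<phi>]
  have \<phi>c: "coalg_hom K E AH.P \<phi>" using hopf_homD(2)[OF \<phi>] by (simp add: S_coalg_cod)
  note [simp] = bialgebra_closed[OF E] f g Eh
  have cl [simp]: "\<phi> x \<in> carrier T" if "x \<in> carrier E" for x
    using lin_map_closed[OF coalg_hom_lin[OF \<phi>c] that] by (simp add: AH.P_simps)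
  show fc: "coalg_hom K E A f"
    by (rule coalg_hom_cong[OF Eh coalg_hom_compose[OF Eh AH.P_has_comult _ \<phi>c AH.proj1_coalg_hom]])
       (simp_all add: facts)
  have gc: "coalg_hom K E H g"
    by (rule coalg_hom_cong[OF Eh coalg_hom_compose[OF Eh AH.P_has_comult _ \<phi>c AH.proj2_coalg_hom]])
       (simp_all add: facts)
  show "f \<one>\<^bsub>E\<^esub> = \<one>\<^bsub>A\<^esub>" by (simp add: alg_hom_one[OF \<phi>a] proj_one)
  show "hopf_hom K E H g"
    by (intro hopf_homI gc) (simp_all add: alg_hom_one[OF \<phi>a] proj_one alg_hom_mult[OF \<phi>a] proj2_mult)
  show "commuting K A H E f g"
    unfolding commuting_def
  proof
    fix e assume e [simp]: "e \<in> carrier E"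
    have "sweedler K T E e (\<lambda>x y. f x ## g y) = sweedler K T E e (\<lambda>x y. AH.p1 (\<phi> x) ## AH.p2 (\<phi> y))"
      by (intro sw_cong) simp_all
    also have "\<dots> = sweedler K T E e (\<lambda>x y. AH.p1 (\<phi> y) ## AH.p2 (\<phi> x))"
      using AH.coalg_hom_commuting[OF Eh \<phi>c] by (simp add: commuting_def)
    also have "\<dots> = sweedler K T E e (\<lambda>x y. f y ## g x)"
      by (intro sw_cong) simp_all
    finally show "sweedler K T E e (\<lambda>x y. f x ## g y) = sweedler K T E e (\<lambda>x y. f y ## g x)" .
  qed
  show conv: "conv_pair K A H E f g e = \<phi> e" if e [simp]: "e \<in> carrier E" for e
    unfolding AH.coalg_hom_conv_pair[OF Eh \<phi>c e] conv_pair_def by (intro sw_cong) simp_all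
  show "f (b \<otimes>\<^bsub>E\<^esub> c) = sweedler K A E b (\<lambda>b1 b2. f b1 \<cdot> (g b2 \<rhd> f c))"
    if [simp]: "b \<in> carrier E" "c \<in> carrier E" for b c
  proof -
    have "f (b \<otimes>\<^bsub>E\<^esub> c) = AH.p1 (conv_pair K A H E f g b \<bullet> \<phi> c)"
      by (simp add: alg_hom_mult[OF \<phi>a] conv)
    also have "\<dots> = sweedler K A E b (\<lambda>b1 b2. f b1 \<cdot> (g b2 \<rhd> f c))"
      using proj1_conv_pair_mult[OF Eh coalg_hom_lin[OF fc] coalg_hom_lin[OF gc], of b "\<phi> c"] by simp
    finally show ?thesis .
  qed
qed

lemma incl_mult:
  assumes [simp]: "h \<in> carrier H"
  shows "a \<in> carrier A \<Longrightarrow> b \<in> carrier A \<Longrightarrow> (a ## \<one>\<^bsub>H\<^esub>) \<bullet> (b ## h) = a \<cdot> b ## h"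
    and "g \<in> carrier H \<Longrightarrow> (\<one>\<^bsub>A\<^esub> ## h) \<bullet> (\<one>\<^bsub>A\<^esub> ## g) = \<one>\<^bsub>A\<^esub> ## h \<star> g"
    and "b \<in> carrier A \<Longrightarrow> (\<one>\<^bsub>A\<^esub> ## h) \<bullet> (b ## \<one>\<^bsub>H\<^esub>) = sweedler K T H h (\<lambda>h1 h2. (h1 \<rhd> b) ## h2)"
proof -
  note [simp] = facts
  {
  assume [simp]: "a \<in> carrier A" "b \<in> carrier A"
  have "(a ## \<one>\<^bsub>H\<^esub>) \<bullet> (b ## h) = sweedler K T H \<one>\<^bsub>H\<^esub> (\<lambda>h1 h2. a \<cdot> (h1 \<rhd> b) ## h2 \<star> h)"
    by (simp add: S_mult_tens)
  also have "\<dots> = a \<cdot> (\<one>\<^bsub>H\<^esub> \<rhd> b) ## \<one>\<^bsub>H\<^esub> \<star> h"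
    by (intro sw_one[OF bialgs(2)] lins) simp_all
  finally show "(a ## \<one>\<^bsub>H\<^esub>) \<bullet> (b ## h) = a \<cdot> b ## h" by (simp add: act_one)
  next
  assume [simp]: "g \<in> carrier H"
  have "(\<one>\<^bsub>A\<^esub> ## h) \<bullet> (\<one>\<^bsub>A\<^esub> ## g)
    = sweedler K T H h (\<lambda>h1 h2. \<one>\<^bsub>A\<^esub> \<cdot> (h1 \<rhd> \<one>\<^bsub>A\<^esub>) ## h2 \<star> g)"
    by (simp add: S_mult_tens)
  also have "\<dots> = sweedler K T H h (\<lambda>h1 h2. counit H h1 \<odot>\<^bsub>T\<^esub> (\<one>\<^bsub>A\<^esub> ## h2 \<star> g))"
    by (intro sw_cong) (simp_all add: act_on_one AH.tens_smult1)
  also have "\<dots> = \<one>\<^bsub>A\<^esub> ## h \<star> g"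
    by (intro sw_counit_left lins) simp_all
  finally show "(\<one>\<^bsub>A\<^esub> ## h) \<bullet> (\<one>\<^bsub>A\<^esub> ## g) = \<one>\<^bsub>A\<^esub> ## h \<star> g" .
  next
  assume [simp]: "b \<in> carrier A"
  have "(\<one>\<^bsub>A\<^esub> ## h) \<bullet> (b ## \<one>\<^bsub>H\<^esub>)
    = sweedler K T H h (\<lambda>h1 h2. \<one>\<^bsub>A\<^esub> \<cdot> (h1 \<rhd> b) ## h2 \<star> \<one>\<^bsub>H\<^esub>)"
    by (simp add: S_mult_tens)
  also have "\<dots> = sweedler K T H h (\<lambda>h1 h2. (h1 \<rhd> b) ## h2)"
    by (intro sw_cong) simp_all
  finally show "(\<one>\<^bsub>A\<^esub> ## h) \<bullet> (b ## \<one>\<^bsub>H\<^esub>) = sweedler K T H h (\<lambda>h1 h2. (h1 \<rhd> b) ## h2)" .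
  }
qed

lemma incl_hopf_hom: "hopf_hom K A S (\<lambda>a. a ## \<one>\<^bsub>H\<^esub>)" "hopf_hom K H S (\<lambda>h. \<one>\<^bsub>A\<^esub> ## h)"
proof -
  note [simp] = facts AH.counit_tens counit_one[OF bialgs(1)] counit_one[OF bialgs(2)]
  have "coalg_hom K A AH.P (\<lambda>a. a ## \<one>\<^bsub>H\<^esub>)"
  proof (rule coalg_homI[OF _ AH.P_has_comult])
    show "lin_map K A AH.P (\<lambda>a. a ## \<one>\<^bsub>H\<^esub>)"
      unfolding AH.P_simps by (intro lins) simp_all
    fix a assume [simp]: "a \<in> carrier A"
    show "counit AH.P (a ## \<one>\<^bsub>H\<^esub>) = counit A a" by simp
    have "sweedler K TT AH.P (a ## \<one>\<^bsub>H\<^esub>) (tens K T T)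
      = sweedler K TT A a (\<lambda>x y. sweedler K TT H \<one>\<^bsub>H\<^esub> (\<lambda>z w. tens K T T (x ## z) (y ## w)))"
      by (intro AH.sw_tensor lins_T) simp_all
    also have "\<dots> = sweedler K TT A a (\<lambda>x y. tens K T T (x ## \<one>\<^bsub>H\<^esub>) (y ## \<one>\<^bsub>H\<^esub>))"
      by (intro sw_cong sw_one[OF bialgs(2)] lins_T) simp_all
    finally show "sweedler K (tensor_mod K AH.P AH.P) AH.P (a ## \<one>\<^bsub>H\<^esub>) (tens K AH.P AH.P)
      = sweedler K (tensor_mod K AH.P AH.P) A a (\<lambda>x y. tens K AH.P AH.P (x ## \<one>\<^bsub>H\<^esub>) (y ## \<one>\<^bsub>H\<^esub>))"
      by (simp add: AH.P_simps)
  qed simp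
  then show "hopf_hom K A S (\<lambda>a. a ## \<one>\<^bsub>H\<^esub>)"
    by (intro hopf_homI) (simp_all add: S_coalg_cod incl_mult S_one)
  have "coalg_hom K H AH.P (\<lambda>h. \<one>\<^bsub>A\<^esub> ## h)"
  proof (rule coalg_homI[OF _ AH.P_has_comult])
    show "lin_map K H AH.P (\<lambda>h. \<one>\<^bsub>A\<^esub> ## h)"
      unfolding AH.P_simps by (intro lins) simp_all
    fix h assume [simp]: "h \<in> carrier H"
    show "counit AH.P (\<one>\<^bsub>A\<^esub> ## h) = counit H h" by simp
    have "sweedler K TT AH.P (\<one>\<^bsub>A\<^esub> ## h) (tens K T T)
      = sweedler K TT A \<one>\<^bsub>A\<^esub> (\<lambda>x y. sweedler K TT H h (\<lambda>z w. tens K T T (x ## z) (y ## w)))"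
      by (intro AH.sw_tensor lins_T) simp_all
    also have "\<dots> = sweedler K TT H h (\<lambda>z w. tens K T T (\<one>\<^bsub>A\<^esub> ## z) (\<one>\<^bsub>A\<^esub> ## w))"
      by (intro sw_one[OF bialgs(1)] lins_T) simp_all
    finally show "sweedler K (tensor_mod K AH.P AH.P) AH.P (\<one>\<^bsub>A\<^esub> ## h) (tens K AH.P AH.P)
      = sweedler K (tensor_mod K AH.P AH.P) H h (\<lambda>x y. tens K AH.P AH.P (\<one>\<^bsub>A\<^esub> ## x) (\<one>\<^bsub>A\<^esub> ## y))"
      by (simp add: AH.P_simps)
  qed simp
  then show "hopf_hom K H S (\<lambda>h. \<one>\<^bsub>A\<^esub> ## h)"
    by (intro hopf_homI) (simp_all add: S_coalg_cod incl_mult S_one)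
qed

text \<open>
  \<open>\<psi>((a # h)(b # g)) = \<alpha>(a) \<alpha>(h\<^sub>1 \<rhd> b) \<beta>(h\<^sub>2) \<beta>(g)\<close>, and the hypothesis turns the middle into \<open>\<beta>(h) \<alpha>(b)\<close>.
\<close>

lemma smash_hopf_homI:
  assumes B: "bialgebra K B" and \<alpha>: "hopf_hom K A B \<alpha>" and \<beta>: "hopf_hom K H B \<beta>"
    and compat: "\<And>h b. h \<in> carrier H \<Longrightarrow> b \<in> carrier A \<Longrightarrow>
      \<beta> h \<otimes>\<^bsub>B\<^esub> \<alpha> b = sweedler K B H h (\<lambda>h1 h2. \<alpha> (h1 \<rhd> b) \<otimes>\<^bsub>B\<^esub> \<beta> h2)"
  shows "hopf_hom K S B (tlift K B (\<lambda>a h. \<alpha> a \<otimes>\<^bsub>B\<^esub> \<beta> h))"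
proof -
  interpret B: bialgebra K B by fact
  let ?\<psi> = "tlift K B (\<lambda>a h. \<alpha> a \<otimes>\<^bsub>B\<^esub> \<beta> h)"
  note \<alpha>a = hopf_homD(1)[OF \<alpha>] and \<beta>a = hopf_homD(1)[OF \<beta>]
  note \<alpha>l = alg_hom_lin[OF \<alpha>a] and \<beta>l = alg_hom_lin[OF \<beta>a]
  note c = AH.mult_coalg_hom[OF B hopf_homD(2)[OF \<alpha>] hopf_homD(2)[OF \<beta>]]
  have \<psi>l: "lin_map K T B ?\<psi>" using coalg_hom_lin[OF c(1)] by (simp add: AH.P_simps)
  note [simp] = facts S_closed c(2) lin_map_closed[OF \<alpha>l] lin_map_closed[OF \<beta>l] lin_map_closed[OF \<psi>l]
    bialgebra_algebra[OF B] coalgebra_module[OF bialgebra_coalgebra[OF B]]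
  have 1: "?\<psi> ((a ## h) \<bullet> (b ## g)) = ?\<psi> (a ## h) \<otimes>\<^bsub>B\<^esub> ?\<psi> (b ## g)"
    if [simp]: "a \<in> carrier A" "h \<in> carrier H" "b \<in> carrier A" "g \<in> carrier H" for a h b g
  proof -
    have "?\<psi> ((a ## h) \<bullet> (b ## g)) = sweedler K B H h (\<lambda>h1 h2. ?\<psi> (a \<cdot> (h1 \<rhd> b) ## h2 \<star> g))"
      by (intro S_mult_tens_apply \<psi>l) simp_all
    also have "\<dots> = sweedler K B H h (\<lambda>h1 h2. \<alpha> a \<otimes>\<^bsub>B\<^esub> ((\<alpha> (h1 \<rhd> b) \<otimes>\<^bsub>B\<^esub> \<beta> h2) \<otimes>\<^bsub>B\<^esub> \<beta> g))"
      by (intro sw_cong) (simp_all add: alg_hom_mult[OF \<alpha>a] alg_hom_mult[OF \<beta>a] B.m_assoc)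
    also have "\<dots> = \<alpha> a \<otimes>\<^bsub>B\<^esub> ((sweedler K B H h (\<lambda>h1 h2. \<alpha> (h1 \<rhd> b) \<otimes>\<^bsub>B\<^esub> \<beta> h2)) \<otimes>\<^bsub>B\<^esub> \<beta> g)"
      by (rule sw_apply[where f = "\<lambda>z. \<alpha> a \<otimes>\<^bsub>B\<^esub> (z \<otimes>\<^bsub>B\<^esub> \<beta> g)", symmetric]) ((intro lin_mult1 lin_mult2 lin_map_id)?; simp)+
    also have "\<dots> = \<alpha> a \<otimes>\<^bsub>B\<^esub> ((\<beta> h \<otimes>\<^bsub>B\<^esub> \<alpha> b) \<otimes>\<^bsub>B\<^esub> \<beta> g)"
      by (simp add: compat)
    finally show ?thesis by (simp add: B.m_assoc)
  qed
  have 2: "?\<psi> ((a ## h) \<bullet> t) = ?\<psi> (a ## h) \<otimes>\<^bsub>B\<^esub> ?\<psi> t"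
    if "a \<in> carrier A" "h \<in> carrier H" "t \<in> carrier T" for a h t
    by (rule tens_ext[where K = K and M = A and N = H and V = B and t = t
          and f = "\<lambda>t. ?\<psi> ((a ## h) \<bullet> t)" and g = "\<lambda>t. ?\<psi> (a ## h) \<otimes>\<^bsub>B\<^esub> ?\<psi> t"])
       ((intro lin_map_compose[OF \<psi>l] lin_S_mult1 lin_S_mult2 lin_map_id lin_mult1 lin_mult2 \<psi>l 1)?; simp add: that)+
  have 3: "?\<psi> (s \<bullet> t) = ?\<psi> s \<otimes>\<^bsub>B\<^esub> ?\<psi> t" if "s \<in> carrier T" "t \<in> carrier T" for s t
    by (rule tens_ext[where K = K and M = A and N = H and V = B and t = s
          and f = "\<lambda>s. ?\<psi> (s \<bullet> t)" and g = "\<lambda>s. ?\<psi> s \<otimes>\<^bsub>B\<^esub> ?\<psi> t"])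
       ((intro lin_map_compose[OF \<psi>l] lin_S_mult1 lin_S_mult2 lin_map_id lin_mult1 lin_mult2 \<psi>l 2)?; simp add: that)+
  show ?thesis
    using c(1) by (intro hopf_homI)
      (simp_all add: S_coalg_dom S_simps 3 S_one alg_hom_one[OF \<alpha>a] alg_hom_one[OF \<beta>a])
qed

text \<open>
  Restrict \<open>\<psi>\<close> along the inclusions \<open>incl_hopf_hom\<close> and apply it to the products in \<open>incl_mult\<close>.
\<close>

lemma smash_hopf_homD:
  assumes B: "bialgebra K B" and \<psi>: "hopf_hom K S B \<psi>"
  shows "hopf_hom K A B (\<lambda>a. \<psi> (a ## \<one>\<^bsub>H\<^esub>))" "hopf_hom K H B (\<lambda>h. \<psi> (\<one>\<^bsub>A\<^esub> ## h))"
    and "\<And>a h. a \<in> carrier A \<Longrightarrow> h \<in> carrier H \<Longrightarrow> \<psi> (a ## h) = \<psi> (a ## \<one>\<^bsub>H\<^esub>) \<otimes>\<^bsub>B\<^esub> \<psi> (\<one>\<^bsub>A\<^esub> ## h)"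
    and "\<And>h b. h \<in> carrier H \<Longrightarrow> b \<in> carrier A \<Longrightarrow> \<psi> (\<one>\<^bsub>A\<^esub> ## h) \<otimes>\<^bsub>B\<^esub> \<psi> (b ## \<one>\<^bsub>H\<^esub>)
      = sweedler K B H h (\<lambda>h1 h2. \<psi> ((h1 \<rhd> b) ## \<one>\<^bsub>H\<^esub>) \<otimes>\<^bsub>B\<^esub> \<psi> (\<one>\<^bsub>A\<^esub> ## h2))"
proof -
  note [simp] = facts S_closed coalgebra_module[OF bialgebra_coalgebra[OF B]]
  note \<psi>a = hopf_homD(1)[OF \<psi>]
  have \<psi>l: "lin_map K T B \<psi>" using alg_hom_lin[OF \<psi>a] by (simp add: S_simps)
  have m: "\<psi> (s \<bullet> t) = \<psi> s \<otimes>\<^bsub>B\<^esub> \<psi> t" if "s \<in> carrier T" "t \<in> carrier T" for s t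
    using alg_hom_mult[OF \<psi>a, of s t] that by (simp add: S_simps)
  show "hopf_hom K A B (\<lambda>a. \<psi> (a ## \<one>\<^bsub>H\<^esub>))" "hopf_hom K H B (\<lambda>h. \<psi> (\<one>\<^bsub>A\<^esub> ## h))"
    by (rule hopf_hom_compose[OF bialgs(1) S_bialgebra B incl_hopf_hom(1) \<psi>],
        rule hopf_hom_compose[OF bialgs(2) S_bialgebra B incl_hopf_hom(2) \<psi>])
  show \<psi>t: "\<psi> (a ## h) = \<psi> (a ## \<one>\<^bsub>H\<^esub>) \<otimes>\<^bsub>B\<^esub> \<psi> (\<one>\<^bsub>A\<^esub> ## h)" if "a \<in> carrier A" "h \<in> carrier H" for a h
    using that m[of "a ## \<one>\<^bsub>H\<^esub>" "\<one>\<^bsub>A\<^esub> ## h"] by (simp add: incl_mult)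
  fix h b assume [simp]: "h \<in> carrier H" "b \<in> carrier A"
  have "\<psi> (\<one>\<^bsub>A\<^esub> ## h) \<otimes>\<^bsub>B\<^esub> \<psi> (b ## \<one>\<^bsub>H\<^esub>) = \<psi> (sweedler K T H h (\<lambda>h1 h2. (h1 \<rhd> b) ## h2))"
    by (simp add: m[symmetric] incl_mult)
  also have "\<dots> = sweedler K B H h (\<lambda>h1 h2. \<psi> ((h1 \<rhd> b) ## h2))"
    by (intro sw_apply \<psi>l) simp_all
  also have "\<dots> = sweedler K B H h (\<lambda>h1 h2. \<psi> ((h1 \<rhd> b) ## \<one>\<^bsub>H\<^esub>) \<otimes>\<^bsub>B\<^esub> \<psi> (\<one>\<^bsub>A\<^esub> ## h2))"
    by (intro sw_cong \<psi>t) simp_all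
  finally show "\<psi> (\<one>\<^bsub>A\<^esub> ## h) \<otimes>\<^bsub>B\<^esub> \<psi> (b ## \<one>\<^bsub>H\<^esub>)
      = sweedler K B H h (\<lambda>h1 h2. \<psi> ((h1 \<rhd> b) ## \<one>\<^bsub>H\<^esub>) \<otimes>\<^bsub>B\<^esub> \<psi> (\<one>\<^bsub>A\<^esub> ## h2))" .
qed

end

section \<open>Hopf algebra maps between smash products\<close>

locale two_actions = X: semidirect_action K H A act + Y: semidirect_action K H' A' act'
  for K and H :: "('k, 'h, 'n) bialg_scheme" and A :: "('k, 'a, 'o) bialg_scheme" and act
    and H' :: "('k, 'd, 'p) bialg_scheme" and A' :: "('k, 'c, 'q) bialg_scheme" and act'
begin

abbreviation pairA where "pairA \<equiv> conv_pair K A' H' A"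
abbreviation pairH where "pairH \<equiv> conv_pair K A' H' H"

text \<open>
  The conditions on the values of the four maps, separated from their extensionality, so that they can be
  verified for maps given by formulas.
\<close>

definition quadruple where
  "quadruple u p r v \<longleftrightarrow>
     coalg_hom K A A' u \<and> u \<one>\<^bsub>A\<^esub> = \<one>\<^bsub>A'\<^esub> \<and> hopf_hom K A H' p \<and>
     coalg_hom K H A' r \<and> r \<one>\<^bsub>H\<^esub> = \<one>\<^bsub>A'\<^esub> \<and> hopf_hom K H H' v \<and>
     commuting K A' H' A u p \<and> commuting K A' H' H r v \<and>
     (\<forall>a\<in>carrier A. \<forall>b\<in>carrier A.
        u (a \<otimes>\<^bsub>A\<^esub> b) = sweedler K A' A a (\<lambda>a1 a2. u a1 \<otimes>\<^bsub>A'\<^esub> act' (p a2) (u b))) \<and>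
     (\<forall>h\<in>carrier H. \<forall>g\<in>carrier H.
        r (h \<otimes>\<^bsub>H\<^esub> g) = sweedler K A' H h (\<lambda>h1 h2. r h1 \<otimes>\<^bsub>A'\<^esub> act' (v h2) (r g))) \<and>
     (\<forall>h\<in>carrier H. \<forall>b\<in>carrier A.
        sweedler K A' H h (\<lambda>h1 h2. r h1 \<otimes>\<^bsub>A'\<^esub> act' (v h2) (u b)) =
        sweedler K A' H h (\<lambda>h1 h'. sweedler K A' H h' (\<lambda>h2 h3.
          sweedler K A' A b (\<lambda>b1 b2. u (act h1 b1) \<otimes>\<^bsub>A'\<^esub> act' (p (act h2 b2)) (r h3))))) \<and>
     (\<forall>h\<in>carrier H. \<forall>b\<in>carrier A.
        v h \<otimes>\<^bsub>H'\<^esub> p b = sweedler K H' H h (\<lambda>h1 h2. p (act h1 b) \<otimes>\<^bsub>H'\<^esub> v h2))"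

lemma smash_quadruples_iff:
  "(u, p, r, v) \<in> smash_quadruples K A H act A' H' act' \<longleftrightarrow>
     u \<in> extensional (carrier A) \<and> p \<in> extensional (carrier A) \<and>
     r \<in> extensional (carrier H) \<and> v \<in> extensional (carrier H) \<and> quadruple u p r v"
  unfolding smash_quadruples_def quadruple_def unitary_coalg_Hom_def unitary_coalg_hom_def
    hopf_Hom_def commuting_def
  by blast

abbreviation from_quadruple where
  "from_quadruple u p r v \<equiv> tlift K Y.S (\<lambda>a h.
     pairA u p a \<otimes>\<^bsub>Y.S\<^esub> pairH r v h)"

text \<open>
  The components of the two sides of \<open>\<beta>(h) \<alpha>(b) = \<alpha>(h\<^sub>1 \<rhd> b) \<beta>(h\<^sub>2)\<close> are the two sides of the last two
  conditions on a quadruple.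
\<close>

lemma
  assumes u: "coalg_hom K A A' u" and p: "hopf_hom K A H' p"
    and r: "coalg_hom K H A' r" and v: "hopf_hom K H H' v"
    and com: "commuting K A' H' A u p" "commuting K A' H' H r v"
    and h [simp]: "h \<in> carrier H" and b [simp]: "b \<in> carrier A"
  defines "\<alpha> \<equiv> pairA u p" and "\<beta> \<equiv> pairH r v"
  defines "mixed \<equiv> sweedler K Y.S H h (\<lambda>h1 h2. \<alpha> (act h1 b) \<otimes>\<^bsub>Y.S\<^esub> \<beta> h2)"
  shows proj1_product: "Y.AH.p1 (\<beta> h \<otimes>\<^bsub>Y.S\<^esub> \<alpha> b) =
      sweedler K A' H h (\<lambda>h1 h2. r h1 \<otimes>\<^bsub>A'\<^esub> act' (v h2) (u b))"
    and proj2_product: "Y.AH.p2 (\<beta> h \<otimes>\<^bsub>Y.S\<^esub> \<alpha> b) = v h \<otimes>\<^bsub>H'\<^esub> p b"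
    and proj1_mixed: "Y.AH.p1 mixed =
      sweedler K A' H h (\<lambda>h1 h'. sweedler K A' H h' (\<lambda>h2 h3.
          sweedler K A' A b (\<lambda>b1 b2. u (act h1 b1) \<otimes>\<^bsub>A'\<^esub> act' (p (act h2 b2)) (r h3))))"
    and proj2_mixed: "Y.AH.p2 mixed = sweedler K H' H h (\<lambda>h1 h2. p (act h1 b) \<otimes>\<^bsub>H'\<^esub> v h2)"
proof -
  note pc = hopf_homD(2)[OF p] and vc = hopf_homD(2)[OF v]
  note ul = coalg_hom_lin[OF u] and rl = coalg_hom_lin[OF r] and pl = coalg_hom_lin[OF pc] and vl = coalg_hom_lin[OF vc]
  note [simp] = X.facts Y.facts Y.S_closed Y.S_simps
    lin_map_closed[OF ul] lin_map_closed[OF pl] lin_map_closed[OF rl] lin_map_closed[OF vl]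
  have \<alpha>l: "lin_map K A Y.T \<alpha>" unfolding \<alpha>_def by (rule Y.AH.conv_pair_lin[OF _ ul pl]) simp
  have \<beta>l: "lin_map K H Y.T \<beta>" unfolding \<beta>_def by (rule Y.AH.conv_pair_lin[OF _ rl vl]) simp
  note [simp] = lin_map_closed[OF \<alpha>l] lin_map_closed[OF \<beta>l]
  have [simp]: "Y.AH.p1 (\<alpha> a) = u a" "Y.AH.p2 (\<alpha> a) = p a" if "a \<in> carrier A" for a
    using that unfolding \<alpha>_def by (simp_all add: Y.AH.proj_conv_pair[OF _ u pc])
  have [simp]: "Y.AH.p1 (\<beta> a) = r a" "Y.AH.p2 (\<beta> a) = v a" if "a \<in> carrier H" for a
    using that unfolding \<beta>_def by (simp_all add: Y.AH.proj_conv_pair[OF _ r vc])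
  have p\<alpha>: "Y.AH.p1 (\<alpha> a \<otimes>\<^bsub>Y.S\<^esub> t) = sweedler K A' A a (\<lambda>x y. u x \<otimes>\<^bsub>A'\<^esub> act' (p y) (Y.AH.p1 t))"
    if "a \<in> carrier A" "t \<in> carrier Y.T" for a t
    using that unfolding \<alpha>_def by (intro Y.proj1_conv_pair_mult ul pl) simp_all
  have p\<beta>: "Y.AH.p1 (\<beta> a \<otimes>\<^bsub>Y.S\<^esub> t) = sweedler K A' H a (\<lambda>x y. r x \<otimes>\<^bsub>A'\<^esub> act' (v y) (Y.AH.p1 t))"
    if "a \<in> carrier H" "t \<in> carrier Y.T" for a t
    using that unfolding \<beta>_def by (intro Y.proj1_conv_pair_mult rl vl) simp_all
  show "Y.AH.p1 (\<beta> h \<otimes>\<^bsub>Y.S\<^esub> \<alpha> b) = sweedler K A' H h (\<lambda>h1 h2. r h1 \<otimes>\<^bsub>A'\<^esub> act' (v h2) (u b))"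
    by (simp add: p\<beta>)
  show "Y.AH.p2 (\<beta> h \<otimes>\<^bsub>Y.S\<^esub> \<alpha> b) = v h \<otimes>\<^bsub>H'\<^esub> p b"
    by (simp add: Y.proj2_mult)
  note lins = lin_map_compose[OF ul] lin_map_compose[OF pl] lin_map_compose[OF rl] lin_map_compose[OF vl]
    Y.lin_act1 Y.lin_act2 X.lins
  have "Y.AH.p1 mixed = sweedler K A' H h (\<lambda>h1 h2. Y.AH.p1 (\<alpha> (act h1 b) \<otimes>\<^bsub>Y.S\<^esub> \<beta> h2))"
    unfolding mixed_def Y.S_simps by (intro sw_apply Y.AH.proj1_lin) simp_all
  also have "\<dots> = sweedler K A' H h (\<lambda>h1 h2. sweedler K A' A (act h1 b) (\<lambda>x y. u x \<otimes>\<^bsub>A'\<^esub> act' (p y) (r h2)))"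
    by (intro sw_cong) (simp_all add: p\<alpha>)
  also have "\<dots> = sweedler K A' H h (\<lambda>h' h3. sweedler K A' H h' (\<lambda>h1 h2. sweedler K A' A b (\<lambda>b1 b2.
      u (act h1 b1) \<otimes>\<^bsub>A'\<^esub> act' (p (act h2 b2)) (r h3))))"
    by (intro sw_cong X.sw_act lins) simp_all
  also have "\<dots> = sweedler K A' H h (\<lambda>h1 h'. sweedler K A' H h' (\<lambda>h2 h3. sweedler K A' A b (\<lambda>b1 b2.
      u (act h1 b1) \<otimes>\<^bsub>A'\<^esub> act' (p (act h2 b2)) (r h3))))"
    by (rule sw_coassoc) ((intro lins)?; simp)+
  finally show "Y.AH.p1 mixed = \<dots>" .
  have "Y.AH.p2 mixed = sweedler K H' H h (\<lambda>h1 h2. Y.AH.p2 (\<alpha> (act h1 b) \<otimes>\<^bsub>Y.S\<^esub> \<beta> h2))"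
    unfolding mixed_def Y.S_simps by (intro sw_apply Y.AH.proj2_lin) simp_all
  also have "\<dots> = sweedler K H' H h (\<lambda>h1 h2. p (act h1 b) \<otimes>\<^bsub>H'\<^esub> v h2)"
    by (intro sw_cong) (simp_all add: Y.proj2_mult)
  finally show "Y.AH.p2 mixed = \<dots>" .
qed

lemma quadruple_halves:
  assumes "quadruple u p r v"
  shows "hopf_hom K A Y.S (pairA u p)" "hopf_hom K H Y.S (pairH r v)"
  using assms unfolding quadruple_def
  by (auto intro!: Y.conv_pair_hopf_hom X.bialgs)

text \<open>
  Both sides are coalgebra maps in \<open>h \<otimes> b\<close>. For the left-hand side this is \<open>mult_coalg_hom\<close>. The
  right-hand side is \<open>?\<psi>((1 # h)(b # 1))\<close> with \<open>?\<psi>(a # h) = \<alpha>(a) \<beta>(h)\<close>, where \<open>?\<psi>\<close> and the product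
  \<open>?i\<close> are coalgebra maps for the same reason; here it matters that \<open>A # H\<close> is itself a bialgebra.
\<close>

lemma quadruple_compat:
  assumes q: "quadruple u p r v" and h: "h \<in> carrier H" and b: "b \<in> carrier A"
  defines "\<alpha> \<equiv> pairA u p" and "\<beta> \<equiv> pairH r v"
  shows "\<beta> h \<otimes>\<^bsub>Y.S\<^esub> \<alpha> b = sweedler K Y.S H h (\<lambda>h1 h2. \<alpha> (act h1 b) \<otimes>\<^bsub>Y.S\<^esub> \<beta> h2)"
proof -
  note q' = q[unfolded quadruple_def]
  from q' have u: "coalg_hom K A A' u" and p: "hopf_hom K A H' p"
    and r: "coalg_hom K H A' r" and v: "hopf_hom K H H' v"
    and com: "commuting K A' H' A u p" "commuting K A' H' H r v" by blast+
  note projs = proj1_product[OF u p r v com] proj2_product[OF u p r v com]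
    proj1_mixed[OF u p r v com] proj2_mixed[OF u p r v com]
  note projs = projs[folded \<alpha>_def \<beta>_def]
  have \<alpha>: "coalg_hom K A Y.S \<alpha>" and \<beta>: "coalg_hom K H Y.S \<beta>"
    unfolding \<alpha>_def \<beta>_def using quadruple_halves[OF q] hopf_homD(2) by blast+
  note [simp] = X.facts Y.facts h b X.S_simps
  let ?\<Phi> = "tlift K Y.S (\<lambda>h b. \<beta> h \<otimes>\<^bsub>Y.S\<^esub> \<alpha> b)"
  let ?i = "tlift K X.S (\<lambda>h b. tens K A H \<one>\<^bsub>A\<^esub> h \<otimes>\<^bsub>X.S\<^esub> tens K A H b \<one>\<^bsub>H\<^esub>)"
  let ?\<psi> = "tlift K Y.S (\<lambda>a h. \<alpha> a \<otimes>\<^bsub>Y.S\<^esub> \<beta> h)"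
  note \<Phi> = X.HA.mult_coalg_hom[OF Y.S_bialgebra \<beta> \<alpha>]
  note i = X.HA.mult_coalg_hom[OF X.S_bialgebra hopf_homD(2)[OF X.incl_hopf_hom(2)] hopf_homD(2)[OF X.incl_hopf_hom(1)]]
  note \<psi> = X.AH.mult_coalg_hom[OF Y.S_bialgebra \<alpha> \<beta>]
  have \<psi>l: "lin_map K X.T Y.T ?\<psi>"
    using coalg_hom_lin[OF \<psi>(1)] by (simp only: X.AH.P_simps Y.S_simps)
  have \<Phi>P: "coalg_hom K X.HA.P Y.AH.P ?\<Phi>" using \<Phi>(1) by (simp only: Y.S_coalg_cod)
  have i\<psi>P: "coalg_hom K X.HA.P Y.AH.P (\<lambda>t. ?\<psi> (?i t))"
  proof (rule coalg_hom_compose[OF X.HA.P_has_comult X.AH.P_has_comult Y.AH.P_has_comult])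
    show "coalg_hom K X.HA.P X.AH.P ?i" using i(1) by (simp only: X.S_coalg_cod)
    show "coalg_hom K X.AH.P Y.AH.P ?\<psi>" using \<psi>(1) by (simp only: Y.S_coalg_cod)
  qed
  have mixed: "?\<psi> (?i (tens K H A g c)) = sweedler K Y.S H g (\<lambda>h1 h2. \<alpha> (act h1 c) \<otimes>\<^bsub>Y.S\<^esub> \<beta> h2)"
    if [simp]: "g \<in> carrier H" "c \<in> carrier A" for g c
  proof -
    have "?\<psi> (?i (tens K H A g c)) = ?\<psi> (sweedler K X.T H g (\<lambda>h1 h2. tens K A H (act h1 c) h2))"
      by (simp only: i(2)[OF that] X.incl_mult(3)[OF that])
    also have "\<dots> = sweedler K Y.T H g (\<lambda>h1 h2. ?\<psi> (tens K A H (act h1 c) h2))"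
      by (intro sw_apply \<psi>l) simp_all
    also have "\<dots> = sweedler K Y.T H g (\<lambda>h1 h2. \<alpha> (act h1 c) \<otimes>\<^bsub>Y.S\<^esub> \<beta> h2)"
      by (intro sw_cong \<psi>(2)) simp_all
    finally show ?thesis by (simp only: Y.S_simps)
  qed
  note lin = coalg_hom_lin[OF \<Phi>P, unfolded X.HA.P_simps Y.AH.P_simps]
    coalg_hom_lin[OF i\<psi>P, unfolded X.HA.P_simps Y.AH.P_simps]
  have "?\<Phi> (tens K H A h b) = ?\<psi> (?i (tens K H A h b))"
  proof (rule Y.AH.coalg_hom_eqI[OF X.HA.P_has_comult \<Phi>P i\<psi>P])
    fix t assume "t \<in> carrier X.HA.P"
    then have t: "t \<in> carrier X.HA.CD" by (simp only: X.HA.P_simps)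
    have "Y.AH.p1 (?\<Phi> (tens K H A g c)) = Y.AH.p1 (?\<psi> (?i (tens K H A g c)))"
      if "g \<in> carrier H" "c \<in> carrier A" for g c
      using q' that unfolding \<Phi>(2)[OF that] mixed[OF that] projs[OF that] by blast
    then show "Y.AH.p1 (?\<Phi> t) = Y.AH.p1 (?\<psi> (?i t))"
      by (intro tens_ext[where K = K and M = H and N = A and V = A' and t = t
            and f = "\<lambda>t. Y.AH.p1 (?\<Phi> t)" and g = "\<lambda>t. Y.AH.p1 (?\<psi> (?i t))"]
          Y.AH.lin_proj1 lin t) simp_all
    have "Y.AH.p2 (?\<Phi> (tens K H A g c)) = Y.AH.p2 (?\<psi> (?i (tens K H A g c)))"
      if "g \<in> carrier H" "c \<in> carrier A" for g c
      using q' that unfolding \<Phi>(2)[OF that] mixed[OF that] projs[OF that] by blast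
    then show "Y.AH.p2 (?\<Phi> t) = Y.AH.p2 (?\<psi> (?i t))"
      by (intro tens_ext[where K = K and M = H and N = A and V = H' and t = t
            and f = "\<lambda>t. Y.AH.p2 (?\<Phi> t)" and g = "\<lambda>t. Y.AH.p2 (?\<psi> (?i t))"]
          Y.AH.lin_proj2 lin t) simp_all
  next
    show "tens K H A h b \<in> carrier X.HA.P" by (simp add: X.HA.P_simps)
  qed
  then show ?thesis by (simp only: \<Phi>(2)[OF h b] mixed[OF h b])
qed

lemma from_quadruple_hopf_hom:
  assumes "quadruple u p r v"
  shows "hopf_hom K X.S Y.S (from_quadruple u p r v)"
  by (intro X.smash_hopf_homI Y.S_bialgebra quadruple_halves(1)[OF assms] quadruple_halves(2)[OF assms]
      quadruple_compat[OF assms])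

lemma from_quadruple_tens:
  assumes q: "quadruple u p r v" and a: "a \<in> carrier A" and h: "h \<in> carrier H"
  shows "from_quadruple u p r v (tens K A H a h)
    = pairA u p a \<otimes>\<^bsub>Y.S\<^esub> pairH r v h"
  by (rule X.AH.mult_coalg_hom(2)[OF Y.S_bialgebra])
     (intro hopf_homD(2)[OF quadruple_halves(1)[OF q]] hopf_homD(2)[OF quadruple_halves(2)[OF q]] a h)+

lemma from_quadruple_formula:
  assumes q: "quadruple u p r v" and a: "a \<in> carrier A" and h: "h \<in> carrier H"
  shows "from_quadruple u p r v (tens K A H a h) =
        sweedler K (tensor_mod K A' H') A a (\<lambda>a1 a'. sweedler K (tensor_mod K A' H') A a' (\<lambda>a2 a3.
          sweedler K (tensor_mod K A' H') H h (\<lambda>h1 h2.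
            tens K A' H' (u a1 \<otimes>\<^bsub>A'\<^esub> act' (p a2) (r h1)) (p a3 \<otimes>\<^bsub>H'\<^esub> v h2))))"
  unfolding from_quadruple_tens[OF assms]
  using q a h unfolding quadruple_def
  by (intro Y.conv_pair_mult X.A.coalgebra_axioms X.H.coalgebra_axioms)
     (simp_all add: hopf_hom_def coalg_hom_lin)

text \<open>
  As in \<open>hopf_hom_components\<close>, the four maps are prescribed on the carriers only.
\<close>

lemma quadruple_of_hopf_hom:
  assumes \<psi>: "hopf_hom K X.S Y.S \<psi>"
    and u: "\<And>a. a \<in> carrier A \<Longrightarrow> u a = Y.AH.p1 (\<psi> (tens K A H a \<one>\<^bsub>H\<^esub>))"
    and p: "\<And>a. a \<in> carrier A \<Longrightarrow> p a = Y.AH.p2 (\<psi> (tens K A H a \<one>\<^bsub>H\<^esub>))"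
    and r: "\<And>h. h \<in> carrier H \<Longrightarrow> r h = Y.AH.p1 (\<psi> (tens K A H \<one>\<^bsub>A\<^esub> h))"
    and v: "\<And>h. h \<in> carrier H \<Longrightarrow> v h = Y.AH.p2 (\<psi> (tens K A H \<one>\<^bsub>A\<^esub> h))"
  shows "quadruple u p r v"
    and "t \<in> carrier X.T \<Longrightarrow> from_quadruple u p r v t = \<psi> t"
proof -
  note D = X.smash_hopf_homD[OF Y.S_bialgebra \<psi>]
  note a = Y.hopf_hom_components[OF X.bialgs(1) D(1) u p]
  note b = Y.hopf_hom_components[OF X.bialgs(2) D(2) r v]
  have eqs: "pairH r v h \<otimes>\<^bsub>Y.S\<^esub> pairA u p b
      = sweedler K Y.S H h (\<lambda>h1 h2. pairA u p (act h1 b) \<otimes>\<^bsub>Y.S\<^esub> pairH r v h2)"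
    if "h \<in> carrier H" "b \<in> carrier A" for h b
  proof -
    have "pairH r v h \<otimes>\<^bsub>Y.S\<^esub> pairA u p b
      = \<psi> (tens K A H \<one>\<^bsub>A\<^esub> h) \<otimes>\<^bsub>Y.S\<^esub> \<psi> (tens K A H b \<one>\<^bsub>H\<^esub>)"
      using that by (simp add: a(5) b(5))
    also have "\<dots> = sweedler K Y.S H h (\<lambda>h1 h2. \<psi> (tens K A H (act h1 b) \<one>\<^bsub>H\<^esub>) \<otimes>\<^bsub>Y.S\<^esub> \<psi> (tens K A H \<one>\<^bsub>A\<^esub> h2))"
      by (rule D(4)[OF that])
    also have "\<dots> = sweedler K Y.S H h (\<lambda>h1 h2. pairA u p (act h1 b) \<otimes>\<^bsub>Y.S\<^esub> pairH r v h2)"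
      using that by (intro sw_cong) (simp_all add: X.facts a(5) b(5))
    finally show ?thesis .
  qed
  have parts: "coalg_hom K A A' u" "hopf_hom K A H' p" "coalg_hom K H A' r" "hopf_hom K H H' v"
    "commuting K A' H' A u p" "commuting K A' H' H r v"
    by (rule a b; assumption)+
  note projs = proj1_product[OF parts] proj2_product[OF parts] proj1_mixed[OF parts] proj2_mixed[OF parts]
  show q: "quadruple u p r v"
    unfolding quadruple_def
  proof (intro conjI ballI)
    fix h b assume hb: "h \<in> carrier H" "b \<in> carrier A"
    show "sweedler K A' H h (\<lambda>h1 h2. r h1 \<otimes>\<^bsub>A'\<^esub> act' (v h2) (u b)) =
        sweedler K A' H h (\<lambda>h1 h'. sweedler K A' H h' (\<lambda>h2 h3.
          sweedler K A' A b (\<lambda>b1 b2. u (act h1 b1) \<otimes>\<^bsub>A'\<^esub> act' (p (act h2 b2)) (r h3))))"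
      by (simp only: projs(1)[OF hb, symmetric] projs(3)[OF hb, symmetric] eqs[OF hb])
    show "v h \<otimes>\<^bsub>H'\<^esub> p b = sweedler K H' H h (\<lambda>h1 h2. p (act h1 b) \<otimes>\<^bsub>H'\<^esub> v h2)"
      by (simp only: projs(2)[OF hb, symmetric] projs(4)[OF hb, symmetric] eqs[OF hb])
  qed (rule a b | assumption)+
  show "from_quadruple u p r v t = \<psi> t" if t: "t \<in> carrier X.T"
  proof (rule tens_ext[where K = K and M = A and N = H and V = Y.T, OF _ _ _ _ _ _ t])
    show "lin_map K X.T Y.T (from_quadruple u p r v)" "lin_map K X.T Y.T \<psi>"
      using alg_hom_lin[OF hopf_homD(1)[OF from_quadruple_hopf_hom[OF q]]] alg_hom_lin[OF hopf_homD(1)[OF \<psi>]]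
      by (simp_all only: X.S_simps Y.S_simps)
    show "from_quadruple u p r v (tens K A H c h) = \<psi> (tens K A H c h)"
      if "c \<in> carrier A" "h \<in> carrier H" for c h
      using that by (simp add: from_quadruple_tens[OF q] a(5) b(5) D(3)[OF that, symmetric])
  qed (simp_all add: X.facts Y.facts)
qed

text \<open>
  On \<open>a # 1\<close> and \<open>1 # h\<close> one of the two factors is \<open>1\<close>, so \<open>proj_conv_pair\<close> applies to the other.
\<close>

lemma quadruple_recovered:
  assumes q: "quadruple u p r v"
  shows "a \<in> carrier A \<Longrightarrow> Y.AH.p1 (from_quadruple u p r v (tens K A H a \<one>\<^bsub>H\<^esub>)) = u a"
    and "a \<in> carrier A \<Longrightarrow> Y.AH.p2 (from_quadruple u p r v (tens K A H a \<one>\<^bsub>H\<^esub>)) = p a"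
    and "h \<in> carrier H \<Longrightarrow> Y.AH.p1 (from_quadruple u p r v (tens K A H \<one>\<^bsub>A\<^esub> h)) = r h"
    and "h \<in> carrier H \<Longrightarrow> Y.AH.p2 (from_quadruple u p r v (tens K A H \<one>\<^bsub>A\<^esub> h)) = v h"
proof -
  interpret S: assoc_algebra K Y.S by (rule Y.S_algebra)
  note q' = q[unfolded quadruple_def]
  note \<alpha> = hopf_homD(1)[OF quadruple_halves(1)[OF q]] and \<beta> = hopf_homD(1)[OF quadruple_halves(2)[OF q]]
  note one = alg_hom_one[OF \<alpha>] alg_hom_one[OF \<beta>]
  have pa: "coalg_hom K A H' p" and va: "coalg_hom K H H' v" and u: "coalg_hom K A A' u" and r: "coalg_hom K H A' r"
    using q' hopf_homD(2) by blast+
  note projs = Y.AH.proj_conv_pair[OF X.A.coalgebra_axioms u pa] Y.AH.proj_conv_pair[OF X.H.coalgebra_axioms r va]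
  show "a \<in> carrier A \<Longrightarrow> Y.AH.p1 (from_quadruple u p r v (tens K A H a \<one>\<^bsub>H\<^esub>)) = u a"
    "a \<in> carrier A \<Longrightarrow> Y.AH.p2 (from_quadruple u p r v (tens K A H a \<one>\<^bsub>H\<^esub>)) = p a"
    "h \<in> carrier H \<Longrightarrow> Y.AH.p1 (from_quadruple u p r v (tens K A H \<one>\<^bsub>A\<^esub> h)) = r h"
    "h \<in> carrier H \<Longrightarrow> Y.AH.p2 (from_quadruple u p r v (tens K A H \<one>\<^bsub>A\<^esub> h)) = v h"
    using lin_map_closed[OF alg_hom_lin[OF \<alpha>]] lin_map_closed[OF alg_hom_lin[OF \<beta>]]
    by (simp_all add: from_quadruple_tens[OF q] one projs)
qed

end

theorem corollary2p3:
  fixes K :: "('k, 'm) ring_scheme"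
    and A :: "('k, 'a) bialg" and H :: "('k, 'h) bialg"
    and A' :: "('k, 'c) bialg" and H' :: "('k, 'd) bialg"
    and act :: "'h \<Rightarrow> 'a \<Rightarrow> 'a" and act' :: "'d \<Rightarrow> 'c \<Rightarrow> 'c"
  assumes "field K"
    and "semidirect_action K H A act"
    and "semidirect_action K H' A' act'"
  shows "\<exists>\<Phi>.
    bij_betw \<Phi> (smash_quadruples K A H act A' H' act')
      (hopf_Hom K (smash K A H act) (smash K A' H' act')) \<and>
    (\<forall>(u, p, r, v) \<in> smash_quadruples K A H act A' H' act'. \<forall>a\<in>carrier A. \<forall>h\<in>carrier H.
      \<Phi> (u, p, r, v) (tens K A H a h) =
        sweedler K (tensor_mod K A' H') A a (\<lambda>a1 a'. sweedler K (tensor_mod K A' H') A a' (\<lambda>a2 a3.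
          sweedler K (tensor_mod K A' H') H h (\<lambda>h1 h2.
            tens K A' H' (u a1 \<otimes>\<^bsub>A'\<^esub> act' (p a2) (r h1)) (p a3 \<otimes>\<^bsub>H'\<^esub> v h2)))))"
proof -
  interpret two_actions K H A act H' A' act'
    using assms(2,3) by (rule two_actions.intro)
  let ?Q = "smash_quadruples K A H act A' H' act'"
  let ?u = "\<lambda>\<psi>. restrict (\<lambda>a. Y.AH.p1 (\<psi> (tens K A H a \<one>\<^bsub>H\<^esub>))) (carrier A)"
  let ?p = "\<lambda>\<psi>. restrict (\<lambda>a. Y.AH.p2 (\<psi> (tens K A H a \<one>\<^bsub>H\<^esub>))) (carrier A)"
  let ?r = "\<lambda>\<psi>. restrict (\<lambda>h. Y.AH.p1 (\<psi> (tens K A H \<one>\<^bsub>A\<^esub> h))) (carrier H)"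
  let ?v = "\<lambda>\<psi>. restrict (\<lambda>h. Y.AH.p2 (\<psi> (tens K A H \<one>\<^bsub>A\<^esub> h))) (carrier H)"
  define \<Phi> where "\<Phi> = (\<lambda>(u, p, r, v). restrict (from_quadruple u p r v) (carrier X.T))"
  define \<Psi> where "\<Psi> = (\<lambda>\<psi>. (?u \<psi>, ?p \<psi>, ?r \<psi>, ?v \<psi>))"
  have [simp]: "tens K A H a \<one>\<^bsub>H\<^esub> \<in> carrier X.T" if "a \<in> carrier A" for a using that by (simp add: X.facts)
  have [simp]: "tens K A H \<one>\<^bsub>A\<^esub> h \<in> carrier X.T" if "h \<in> carrier H" for h using that by (simp add: X.facts)
  have carr: "carrier X.S = carrier X.T" by (simp add: X.S_simps)
  have recovered: "\<Psi> (\<Phi> (u, p, r, v)) = (u, p, r, v)" if "(u, p, r, v) \<in> ?Q" for u p r v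
  proof -
    from that have q: "quadruple u p r v" and ext: "u \<in> extensional (carrier A)" "p \<in> extensional (carrier A)"
      "r \<in> extensional (carrier H)" "v \<in> extensional (carrier H)"
      by (simp_all add: smash_quadruples_iff)
    have "?u (\<Phi> (u, p, r, v)) = u" "?p (\<Phi> (u, p, r, v)) = p" "?r (\<Phi> (u, p, r, v)) = r" "?v (\<Phi> (u, p, r, v)) = v"
      by (rule extensionalityI[OF restrict_extensional], rule ext,
          simp add: \<Phi>_def quadruple_recovered[OF q])+
    then show ?thesis by (simp add: \<Psi>_def)
  qed
  have maps_to: "\<Phi> (u, p, r, v) \<in> hopf_Hom K X.S Y.S" if "(u, p, r, v) \<in> ?Q" for u p r v
  proof -
    have q: "quadruple u p r v" using that by (simp add: smash_quadruples_iff)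
    show ?thesis
      unfolding hopf_Hom_def \<Phi>_def
      using hopf_hom_cong[OF X.S_bialgebra from_quadruple_hopf_hom[OF q],
          of "restrict (from_quadruple u p r v) (carrier X.T)"]
      by (simp add: carr)
  qed
  have forth: "\<Psi> \<psi> \<in> ?Q" "\<Phi> (\<Psi> \<psi>) = \<psi>" if "\<psi> \<in> hopf_Hom K X.S Y.S" for \<psi>
  proof -
    have \<psi>: "hopf_hom K X.S Y.S \<psi>" and ext: "\<psi> \<in> extensional (carrier X.T)"
      using that by (simp_all add: hopf_Hom_def carr)
    have q: "quadruple (?u \<psi>) (?p \<psi>) (?r \<psi>) (?v \<psi>)"
      by (rule quadruple_of_hopf_hom(1)[OF \<psi>]) simp_all
    then show "\<Psi> \<psi> \<in> ?Q" by (simp add: \<Psi>_def smash_quadruples_iff)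
    have "from_quadruple (?u \<psi>) (?p \<psi>) (?r \<psi>) (?v \<psi>) t = \<psi> t" if "t \<in> carrier X.T" for t
      by (rule quadruple_of_hopf_hom(2)[OF \<psi> _ _ _ _ that]) simp_all
    then show "\<Phi> (\<Psi> \<psi>) = \<psi>"
      unfolding \<Phi>_def \<Psi>_def prod.case
      by (intro extensionalityI[OF restrict_extensional ext]) simp
  qed
  have "bij_betw \<Phi> ?Q (hopf_Hom K X.S Y.S)"
    by (rule bij_betw_byWitness[where f' = \<Psi>]) (use recovered maps_to forth in auto)
  moreover have "\<Phi> (u, p, r, v) (tens K A H a h) =
        sweedler K (tensor_mod K A' H') A a (\<lambda>a1 a'. sweedler K (tensor_mod K A' H') A a' (\<lambda>a2 a3.
          sweedler K (tensor_mod K A' H') H h (\<lambda>h1 h2.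
            tens K A' H' (u a1 \<otimes>\<^bsub>A'\<^esub> act' (p a2) (r h1)) (p a3 \<otimes>\<^bsub>H'\<^esub> v h2))))"
    if "(u, p, r, v) \<in> ?Q" "a \<in> carrier A" "h \<in> carrier H" for u p r v a h
    using that from_quadruple_formula[of u p r v a h] by (simp add: \<Phi>_def smash_quadruples_iff X.facts)
  ultimately show ?thesis by (intro exI[of _ \<Phi>]) auto
qed

end
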